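(* Let $\tau>0$ and let $\ell:[0,\tau]\to(0,\infty)$ be a strictly positive, twice continuously differentiable function with $$\ell(0)=1,\qquad \ell'(t)>0\quad\text{and}\quad \ell'(t)\,\ell(t)<\frac1\pi\qquad\text{for all }t\in(0,\tau).$$ Then there exists a constant $c(\tau)>0$ such that for every $u_0\in H_0^1(0,1)$ the solution $u$ of $$i\,\partial_t u+\partial_x^2u=0\ \ (x\in[0,\ell(t)],\ t\in[0,\tau]),\qquad u(0,t)=u(\ell(t),t)=0,\qquad u(x,0)=u_0(x)\ \ (x\in[0,1])$$ satisfies $$c(\tau)\,\|u_0\|_{H_0^1(0,1)}^2\ \le\ \int_0^\tau\bigl(|u_x(0,t)|^2+|u_x(\ell(t),t)|^2\bigr)\,dt .$$
   Context: All functions are complex valued. The norm is $\|\varphi\|_{H_0^1(0,1)}=\|\varphi'\|_{L_2(0,1)}$. The constant may depend on $\tau$ and $\ell$ but not on $u_0$. Notion of solution: with $w(y,t)=u(\ell(t)y,t)$, $y\in[0,1]$, the moving-domain system is equivalent to $w_t=A(t)w$, $w(\cdot,0)=u_0$, where $A(t)w=\frac{i}{\ell(t)^2}w_{yy}+\frac{\ell'(t)}{\ell(t)}\,y\,w_y$ with domain $D=H^2(0,1)\cap H_0^1(0,1)$ in $L_2(0,1)$. The family $(A(t))_{t\in[0,\tau]}$ generates a unique evolution family $U(t,s)$, $0\le s\le t\le\tau$, on $L_2(0,1)$; the solution is $w(t)=U(t,0)u_0$, $u(x,t)=w(x/\ell(t),t)$, and it is a classical $D$-valued solution if $u_0\in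 D$. For $u_0\in H_0^1(0,1)$ the boundary traces $u_x(0,\cdot)$, $u_x(\ell(\cdot),\cdot)$ are understood by density, as extensions from $u_0\in D$. *)

theory Defs
  imports "HOL-Analysis.Analysis"
begin

text \<open>
  Elements of \<open>L\<^sub>2(a,b)\<close> are represented by complex functions on the real line, of which
  only the values on the open interval matter; equality in \<open>L\<^sub>2(a,b)\<close> is equality almost everywhere.
\<close>

definition L2 :: "real \<Rightarrow> real \<Rightarrow> (real \<Rightarrow> complex) set" where
  "L2 a b = {f. f \<in> borel_measurable (lebesgue_on {a<..<b}) \<and>
                integrable (lebesgue_on {a<..<b}) (\<lambda>x. (cmod (f x))\<^sup>2)}"

definition L2norm :: "real \<Rightarrow> real \<Rightarrow> (real \<Rightarrow> complex) \<Rightarrow> real" where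
  "L2norm a b f = sqrt (LINT x|lebesgue_on {a<..<b}. (cmod (f x))\<^sup>2)"

definition L2_eq :: "real \<Rightarrow> real \<Rightarrow> (real \<Rightarrow> complex) \<Rightarrow> (real \<Rightarrow> complex) \<Rightarrow> bool" where
  "L2_eq a b f g \<longleftrightarrow> (AE x in lebesgue_on {a<..<b}. f x = g x)"

text \<open>Membership is required explicitly because \<^const>\<open>L2norm\<close> has the junk value 0 outside
  \<^const>\<open>L2\<close>.\<close>

definition L2_converges ::
    "real \<Rightarrow> real \<Rightarrow> (nat \<Rightarrow> real \<Rightarrow> complex) \<Rightarrow> (real \<Rightarrow> complex) \<Rightarrow> bool" where
  "L2_converges a b F g \<longleftrightarrow>
     (\<forall>n. F n \<in> L2 a b) \<and> g \<in> L2 a b \<and> (\<lambda>n. L2norm a b (\<lambda>x. F n x - g x)) \<longlonglongrightarrow> 0"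

definition smooth_fun :: "(real \<Rightarrow> complex) \<Rightarrow> bool" where
  "smooth_fun \<phi> \<longleftrightarrow>
     (\<exists>d :: nat \<Rightarrow> real \<Rightarrow> complex. d 0 = \<phi> \<and>
        (\<forall>n x. (d n has_vector_derivative d (Suc n) x) (at x)))"

definition test_functions :: "real \<Rightarrow> real \<Rightarrow> (real \<Rightarrow> complex) set" where
  "test_functions a b =
     {\<phi>. smooth_fun \<phi> \<and> (\<exists>c d. a < c \<and> c \<le> d \<and> d < b \<and> (\<forall>x. x \<notin> {c..d} \<longrightarrow> \<phi> x = 0))}"

text \<open>Weak derivatives are only considered within \<open>L\<^sub>2(a,b)\<close>, so that both integrals exist.\<close>

definition has_weak_deriv ::
    "real \<Rightarrow> real \<Rightarrow> (real \<Rightarrow> complex) \<Rightarrow> (real \<Rightarrow> complex) \<Rightarrow> bool" where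
  "has_weak_deriv a b f g \<longleftrightarrow> f \<in> L2 a b \<and> g \<in> L2 a b \<and>
     (\<forall>\<phi>\<in>test_functions a b.
        (LINT x|lebesgue_on {a<..<b}. f x * vector_derivative \<phi> (at x)) =
        - (LINT x|lebesgue_on {a<..<b}. g x * \<phi> x))"

text \<open>The weak derivative is unique up to equality almost everywhere; a representative is chosen.\<close>

definition wderiv :: "real \<Rightarrow> real \<Rightarrow> (real \<Rightarrow> complex) \<Rightarrow> real \<Rightarrow> complex" where
  "wderiv a b f = (SOME g. has_weak_deriv a b f g)"

definition H1 :: "real \<Rightarrow> real \<Rightarrow> (real \<Rightarrow> complex) set" where
  "H1 a b = {f. \<exists>g. has_weak_deriv a b f g}"

definition H2 :: "real \<Rightarrow> real \<Rightarrow> (real \<Rightarrow> complex) set" where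
  "H2 a b = {f. f \<in> H1 a b \<and> wderiv a b f \<in> H1 a b}"

definition H1norm :: "real \<Rightarrow> real \<Rightarrow> (real \<Rightarrow> complex) \<Rightarrow> real" where
  "H1norm a b f = sqrt ((L2norm a b f)\<^sup>2 + (L2norm a b (wderiv a b f))\<^sup>2)"

definition H2norm :: "real \<Rightarrow> real \<Rightarrow> (real \<Rightarrow> complex) \<Rightarrow> real" where
  "H2norm a b f = sqrt ((L2norm a b f)\<^sup>2 + (L2norm a b (wderiv a b f))\<^sup>2
                        + (L2norm a b (wderiv a b (wderiv a b f)))\<^sup>2)"

definition H10 :: "real \<Rightarrow> real \<Rightarrow> (real \<Rightarrow> complex) set" where
  "H10 a b = {f. f \<in> H1 a b \<and>
     (\<exists>\<phi>. (\<forall>n::nat. \<phi> n \<in> test_functions a b) \<and> (\<lambda>n. H1norm a b (\<lambda>x. \<phi> n x - f x)) \<longlonglongrightarrow> 0)}"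

definition H10norm :: "real \<Rightarrow> real \<Rightarrow> (real \<Rightarrow> complex) \<Rightarrow> real" where
  "H10norm a b f = L2norm a b (wderiv a b f)"

text \<open>Pointwise value at \<open>x \<in> [a,b]\<close> of (the class of) an \<open>H\<^sup>1(a,b)\<close> function, endpoints included:
  the value of its continuous representative, which is unique on \<open>[a,b]\<close>.\<close>

definition cont_value :: "real \<Rightarrow> real \<Rightarrow> (real \<Rightarrow> complex) \<Rightarrow> real \<Rightarrow> complex" where
  "cont_value a b f x = (SOME h. continuous_on {a..b} h \<and> L2_eq a b h f) x"

definition dom_A :: "(real \<Rightarrow> complex) set" where
  "dom_A = H2 0 1 \<inter> H10 0 1"

text \<open>The operator \<open>A(t)\<close>; the argument \<open>l'\<close> stands for the derivative of \<open>l\<close>.\<close>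

definition op_A ::
    "(real \<Rightarrow> real) \<Rightarrow> (real \<Rightarrow> real) \<Rightarrow> real \<Rightarrow> (real \<Rightarrow> complex) \<Rightarrow> real \<Rightarrow> complex" where
  "op_A l l' t w = (\<lambda>y.
     \<i> / (complex_of_real (l t))\<^sup>2 * wderiv 0 1 (wderiv 0 1 w) y
     + complex_of_real (l' t / l t * y) * wderiv 0 1 w y)"

definition time_triangle :: "real \<Rightarrow> (real \<times> real) set" where
  "time_triangle \<tau> = {(t, s). 0 \<le> s \<and> s \<le> t \<and> t \<le> \<tau>}"

text \<open>
  \<open>U\<close> is a strongly continuous family of bounded linear operators on \<open>L\<^sub>2(0,1)\<close> satisfying the
  evolution law. Compatibility with equality almost everywhere follows from linearity and boundedness.
\<close>

definition evolution_family ::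
    "real \<Rightarrow> (real \<Rightarrow> real \<Rightarrow> (real \<Rightarrow> complex) \<Rightarrow> (real \<Rightarrow> complex)) \<Rightarrow> bool" where
  "evolution_family \<tau> U \<longleftrightarrow>
     (\<forall>(t, s)\<in>time_triangle \<tau>.
        (\<forall>f\<in>L2 0 1. U t s f \<in> L2 0 1) \<and>
        (\<forall>f\<in>L2 0 1. \<forall>g\<in>L2 0 1. \<forall>\<alpha> \<beta>.
           L2_eq 0 1 (U t s (\<lambda>y. \<alpha> * f y + \<beta> * g y)) (\<lambda>y. \<alpha> * U t s f y + \<beta> * U t s g y)) \<and>
        (\<exists>C. \<forall>f\<in>L2 0 1. L2norm 0 1 (U t s f) \<le> C * L2norm 0 1 f)) \<and>
     (\<forall>s\<in>{0..\<tau>}. \<forall>f\<in>L2 0 1. L2_eq 0 1 (U s s f) f) \<and>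
     (\<forall>s r t. 0 \<le> s \<and> s \<le> r \<and> r \<le> t \<and> t \<le> \<tau> \<longrightarrow>
        (\<forall>f\<in>L2 0 1. L2_eq 0 1 (U t r (U r s f)) (U t s f))) \<and>
     (\<forall>f\<in>L2 0 1. \<forall>(t, s)\<in>time_triangle \<tau>.
        ((\<lambda>(t', s'). L2norm 0 1 (\<lambda>y. U t' s' f y - U t s f y)) \<longlongrightarrow> 0)
          (at (t, s) within time_triangle \<tau>))"

text \<open>
  \<open>(A(t))\<close> generates \<open>U\<close>: for data \<open>f\<close> in the domain, \<open>t \<mapsto> U(t,s) f\<close> is a classical solution, i.e.
  it belongs to \<open>C([s,\<tau>]; D) \<inter> C\<^sup>1([s,\<tau>]; L\<^sub>2)\<close>, where \<open>D\<close> carries the \<open>H\<^sup>2\<close> norm, and its derivative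
  is \<open>A(t) U(t,s) f\<close>.
\<close>

definition generates_evolution_family ::
    "real \<Rightarrow> (real \<Rightarrow> real) \<Rightarrow> (real \<Rightarrow> real) \<Rightarrow>
     (real \<Rightarrow> real \<Rightarrow> (real \<Rightarrow> complex) \<Rightarrow> (real \<Rightarrow> complex)) \<Rightarrow> bool" where
  "generates_evolution_family \<tau> l l' U \<longleftrightarrow>
     evolution_family \<tau> U \<and>
     (\<forall>f\<in>dom_A. \<forall>(t, s)\<in>time_triangle \<tau>.
        U t s f \<in> dom_A \<and>
        ((\<lambda>r. H2norm 0 1 (\<lambda>y. U r s f y - U t s f y)) \<longlongrightarrow> 0) (at t within {s..\<tau>}) \<and>
        ((\<lambda>r. L2norm 0 1 (\<lambda>y. (U r s f y - U t s f y) / complex_of_real (r - t)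
                               - op_A l l' t (U t s f) y)) \<longlongrightarrow> 0) (at t within {s..\<tau>}))"

definition solution ::
    "(real \<Rightarrow> real) \<Rightarrow> (real \<Rightarrow> real \<Rightarrow> (real \<Rightarrow> complex) \<Rightarrow> (real \<Rightarrow> complex)) \<Rightarrow>
     (real \<Rightarrow> complex) \<Rightarrow> real \<Rightarrow> real \<Rightarrow> complex" where
  "solution l U u0 x t = U t 0 u0 (x / l t)"

text \<open>The value \<open>u\<^sub>x(x,t)\<close>, \<open>x \<in> [0, l(t)]\<close>, of the solution with initial datum \<open>u0\<close> in the domain.\<close>

definition solution_x ::
    "(real \<Rightarrow> real) \<Rightarrow> (real \<Rightarrow> real \<Rightarrow> (real \<Rightarrow> complex) \<Rightarrow> (real \<Rightarrow> complex)) \<Rightarrow>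
     (real \<Rightarrow> complex) \<Rightarrow> real \<Rightarrow> real \<Rightarrow> complex" where
  "solution_x l U u0 x t =
     cont_value 0 (l t) (wderiv 0 (l t) (\<lambda>\<xi>. solution l U u0 \<xi> t)) x"

text \<open>
  \<open>g0\<close> and \<open>g1\<close> are the traces \<open>u\<^sub>x(0,\<cdot>)\<close> and \<open>u\<^sub>x(l(\<cdot>),\<cdot>)\<close> for the initial datum \<open>u0\<close> in \<open>H\<^sub>0\<^sup>1(0,1)\<close>,
  as the value at \<open>u0\<close> of the extension by density of the trace maps \<open>D \<rightarrow> L\<^sub>2(0,\<tau>)\<close>:
  they are the limits of the traces along every sequence in \<open>D\<close> that converges to \<open>u0\<close> in \<open>H\<^sub>0\<^sup>1(0,1)\<close>.
\<close>

definition boundary_traces ::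
    "real \<Rightarrow> (real \<Rightarrow> real) \<Rightarrow> (real \<Rightarrow> real \<Rightarrow> (real \<Rightarrow> complex) \<Rightarrow> (real \<Rightarrow> complex)) \<Rightarrow>
     (real \<Rightarrow> complex) \<Rightarrow> (real \<Rightarrow> complex) \<Rightarrow> (real \<Rightarrow> complex) \<Rightarrow> bool" where
  "boundary_traces \<tau> l U u0 g0 g1 \<longleftrightarrow>
     (\<forall>v. (\<forall>n::nat. v n \<in> dom_A) \<and> (\<lambda>n. H10norm 0 1 (\<lambda>y. v n y - u0 y)) \<longlonglongrightarrow> 0 \<longrightarrow>
        L2_converges 0 \<tau> (\<lambda>n t. solution_x l U (v n) 0 t) g0 \<and>
        L2_converges 0 \<tau> (\<lambda>n t. solution_x l U (v n) (l t) t) g1)"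

end

theory Submission
  imports Defs
begin

text \<open>
  After the change of variables \<open>w(y,t) = u(l(t)y,t)\<close> the equation lives on the fixed interval \<open>(0,1)\<close>:
  \<open>w\<^sub>t = (\<i>/l\<^sup>2) w\<^sub>y\<^sub>y + (l'/l) y w\<^sub>y\<close> with \<open>w = 0\<close> at both ends, and \<open>u\<^sub>x(0,t) = w\<^sub>y(0,t)/l(t)\<close>,
  \<open>u\<^sub>x(l(t),t) = w\<^sub>y(1,t)/l(t)\<close>. For data in the domain, \<open>w\<close> is continuous in time with values in
  \<open>H\<^sup>2\<close> and differentiable with values in \<open>L\<^sub>2\<close>; this is enough to differentiate quadratic functionals
  of \<open>w\<close> in time, and every estimate below comes from such a functional. Write
  \<open>E(t) = \<integral>\<bar>w\<^sub>y\<bar>\<^sup>2\<close>, so that \<open>E(0)\<close> is the squared norm of the datum.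
  
  Energy. The quantity \<open>E/l\<close> decreases exactly by the flux through the moving end:
  \<open>(E/l)' = - (l'/l\<^sup>2) \<bar>w\<^sub>y(1)\<bar>\<^sup>2\<close>. Since \<open>l\<close> increases from 1 and is bounded by some \<open>L\<close>, and \<open>l'\<close> is
  bounded by some \<open>B\<close>, this yields \<open>E(t) \<le> L E(0)\<close> and
  \<open>E(0) \<le> E(t) + B \<integral>\<bar>w\<^sub>y(1,t)\<bar>\<^sup>2 dt\<close> (\<open>energy_upper\<close>, \<open>energy_lower\<close>).
  
  Existence of the traces. The multiplier \<open>2y - 1\<close> takes opposite values at the two ends, so the
  derivative of \<open>Im \<integral> (2y-1) w\<^sub>y cnj w\<close> contains both boundary terms with the same sign; integrating in
  time bounds them by \<open>E(0)\<close> (\<open>traces_le_energy\<close>). The trace maps are therefore bounded on the domain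
  in the norm of \<open>H\<^sub>0\<^sup>1\<close>, and completeness of \<open>L\<^sub>2(0,\<tau>)\<close> (\<open>L2_complete\<close>) extends them by density.
  
  Observability. This is a Carleman estimate. Put \<open>\<psi>(y) = (1+y)\<^sup>2/2\<close>,
  \<open>\<eta>(t) = 16 (t/\<tau> - 1/2)\<^sup>2\<close> and \<open>z = exp (s (\<psi> - \<eta>)) w\<close>. The equation for \<open>z\<close> reads
  \<open>l\<^sup>2 z\<^sub>t = S z + \<i> (z\<^sub>y\<^sub>y + s\<^sup>2 \<psi>'\<^sup>2 z)\<close> plus a first-order remainder, with the symmetric operator
  \<open>S z = - \<i> (2 s \<psi>' z\<^sub>y + s z) - s l\<^sup>2 \<eta>' z\<close>. The derivative of \<open>D = \<langle>S z, z\<rangle>\<close> consists of \<open>2 \<parallel>S z\<parallel>\<^sup>2/l\<^sup>2\<close>, which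
  absorbs the remainder by completing a square, and of a commutator. As \<open>\<psi>\<close> is convex, the commutator
  controls \<open>s \<parallel>z\<^sub>y\<parallel>\<^sup>2 + s\<^sup>3 \<parallel>z\<parallel>\<^sup>2\<close>, up to a multiple of \<open>\<bar>w\<^sub>y(1)\<bar>\<^sup>2\<close>; this dominates all lower-order terms
  for large \<open>s\<close> (\<open>carleman_pointwise\<close>, \<open>carleman_fixed_time\<close>). Hence \<open>D'\<close> is at least
  \<open>exp (- 2 s \<eta>)\<close> times a positive multiple of \<open>E\<close> minus a multiple of \<open>\<bar>w\<^sub>y(1)\<bar>\<^sup>2\<close>. Now \<open>\<eta> \<le> 1\<close> on
  the middle half of \<open>[0,\<tau>]\<close> but \<open>\<eta> = 4\<close> at the end points, so for large \<open>s\<close> the boundary terms \<open>D(0)\<close> and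
  \<open>D(\<tau>)\<close> are negligible against the integral, whatever the length of \<open>[0,\<tau>]\<close>. With the energy bounds
  this gives \<open>E(0) \<le> C \<integral>\<bar>w\<^sub>y(1,t)\<bar>\<^sup>2 dt\<close> (\<open>observability\<close>), and the inequality passes to
  \<open>H\<^sub>0\<^sup>1\<close> by density.
  
  The Sobolev spaces are given by weak derivatives. Du Bois-Reymond's lemma replaces their elements by
  absolutely continuous representatives (\<open>primitive\<close>), for which the product rule and hence every
  integration by parts above is available.
\<close>

section \<open>Smooth functions and test functions\<close>

text \<open>
  A coinduction principle: a set of functions that is closed under differentiation consists of smooth
  functions, because the derivatives can be chosen successively inside the set.
\<close>

lemma smooth_funI:
  assumes "\<phi> \<in> S" and "\<And>f. f \<in> S \<Longrightarrow> \<exists>g\<in>S. \<forall>x. (f has_vector_derivative g x) (at x)"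
  shows "smooth_fun \<phi>"
proof -
  obtain D where D: "\<And>f. f \<in> S \<Longrightarrow> D f \<in> S \<and> (\<forall>x. (f has_vector_derivative D f x) (at x))"
    using assms(2) by metis
  have S: "(D ^^ n) \<phi> \<in> S" for n
    by (induction n) (use assms(1) D in auto)
  show ?thesis
    unfolding smooth_fun_def
    by (rule exI[of _ "\<lambda>n. (D ^^ n) \<phi>"]) (use S D in auto)
qed

lemma smooth_fun_has_derivative:
  assumes "smooth_fun f"
  obtains g where "smooth_fun g" "\<And>x. (f has_vector_derivative g x) (at x)"
proof -
  obtain d where d: "d 0 = f" "\<And>n x. (d n has_vector_derivative d (Suc n) x) (at x)"
    using assms unfolding smooth_fun_def by blast
  have "smooth_fun (d 1)"
    unfolding smooth_fun_def by (rule exI[of _ "\<lambda>n. d (Suc n)"]) (use d in auto)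
  moreover have "(f has_vector_derivative d 1 x) (at x)" for x
    using d(2)[of 0 x] d(1) by simp
  ultimately show ?thesis using that by blast
qed

lemma smooth_fun_primitive:
  assumes "smooth_fun g" "\<And>x. (f has_vector_derivative g x) (at x)"
  shows "smooth_fun f"
proof (rule smooth_funI[where S="insert f {g. smooth_fun g}"])
  fix h assume "h \<in> insert f {g. smooth_fun g}"
  then show "\<exists>g\<in>insert f {g. smooth_fun g}. \<forall>x. (h has_vector_derivative g x) (at x)"
    using assms by (auto elim: smooth_fun_has_derivative)
qed auto

lemma smooth_fun_add:
  assumes "smooth_fun f" "smooth_fun g"
  shows "smooth_fun (\<lambda>x. f x + g x)"
proof (rule smooth_funI[where S="{\<lambda>x. f x + g x | f g. smooth_fun f \<and> smooth_fun g}"])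
  fix h assume "h \<in> {\<lambda>x. f x + g x | f g. smooth_fun f \<and> smooth_fun g}"
  then obtain f g where h: "h = (\<lambda>x. f x + g x)" and *: "smooth_fun f" "smooth_fun g" by auto
  obtain f' where f': "smooth_fun f'" "\<And>x. (f has_vector_derivative f' x) (at x)"
    using smooth_fun_has_derivative *(1) by blast
  obtain g' where g': "smooth_fun g'" "\<And>x. (g has_vector_derivative g' x) (at x)"
    using smooth_fun_has_derivative *(2) by blast
  show "\<exists>g\<in>{\<lambda>x. f x + g x | f g. smooth_fun f \<and> smooth_fun g}. \<forall>x. (h has_vector_derivative g x) (at x)"
    by (rule bexI[of _ "\<lambda>x. f' x + g' x"]) (use f' g' h in \<open>auto intro!: derivative_eq_intros\<close>)
qed (use assms in auto)

text \<open>
  The smallest set of functions that contains the products of smooth functions and is closed under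
  sums. By the product rule it is closed under differentiation, which avoids the binomial formula for
  higher derivatives of a product.
\<close>

inductive_set product_span :: "(real \<Rightarrow> complex) set" where
  base: "smooth_fun f \<Longrightarrow> smooth_fun g \<Longrightarrow> (\<lambda>x. f x * g x) \<in> product_span"
| sum: "p \<in> product_span \<Longrightarrow> q \<in> product_span \<Longrightarrow> (\<lambda>x. p x + q x) \<in> product_span"

lemma smooth_fun_mult:
  assumes "smooth_fun f" "smooth_fun g"
  shows "smooth_fun (\<lambda>x. f x * g x)"
proof (rule smooth_funI[where S=product_span])
  fix h assume "h \<in> product_span"
  then show "\<exists>g\<in>product_span. \<forall>x. (h has_vector_derivative g x) (at x)"
  proof induction
    case (base f g)
    obtain f' where f': "smooth_fun f'" "\<And>x. (f has_vector_derivative f' x) (at x)"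
      using smooth_fun_has_derivative base(1) by blast
    obtain g' where g': "smooth_fun g'" "\<And>x. (g has_vector_derivative g' x) (at x)"
      using smooth_fun_has_derivative base(2) by blast
    show ?case
      by (rule bexI[of _ "\<lambda>x. f x * g' x + f' x * g x"])
         (use f' g' base in \<open>auto intro!: derivative_eq_intros product_span.intros\<close>)
  next
    case (sum p q)
    then obtain p' q' where "p' \<in> product_span" "\<forall>x. (p has_vector_derivative p' x) (at x)"
      "q' \<in> product_span" "\<forall>x. (q has_vector_derivative q' x) (at x)" by blast
    then show ?case
      by (intro bexI[of _ "\<lambda>x. p' x + q' x"])
         (auto intro!: derivative_eq_intros product_span.intros)
  qed
qed (use assms product_span.base in auto)

lemma smooth_fun_const: "smooth_fun (\<lambda>x. c)"
  by (rule smooth_funI[where S="range (\<lambda>c x. c)"]) (auto intro!: derivative_eq_intros)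

lemma smooth_fun_affine:
  fixes c d :: real
  assumes "smooth_fun f"
  shows "smooth_fun (\<lambda>x. f (c * x + d))"
proof (rule smooth_funI[where S="{\<lambda>x. k * g (c * x + d) | k g. smooth_fun g}"])
  show "(\<lambda>x. f (c * x + d)) \<in> {\<lambda>x. k * g (c * x + d) | k g. smooth_fun g}"
    by (rule CollectI, rule exI[of _ 1], rule exI[of _ f]) (use assms in simp)
  fix h assume "h \<in> {\<lambda>x. k * g (c * x + d) | k g. smooth_fun g}"
  then obtain k g where h: "h = (\<lambda>x. k * g (c * x + d))" and g: "smooth_fun g" by auto
  obtain g' where g': "smooth_fun g'" "\<And>x. (g has_vector_derivative g' x) (at x)"
    using smooth_fun_has_derivative g by blast
  have "((\<lambda>x. k * g (c * x + d)) has_vector_derivative (k * of_real c) * g' (c * x + d)) (at x)" for x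
  proof -
    have "((\<lambda>x. c * x + d) has_vector_derivative c) (at x)"
      by (auto intro!: derivative_eq_intros simp: has_real_derivative_iff_has_vector_derivative[symmetric])
    then have "(g \<circ> (\<lambda>x. c * x + d) has_vector_derivative c *\<^sub>R g' (c * x + d)) (at x)"
      by (rule vector_diff_chain_at) (rule g')
    then have "((\<lambda>x. k * (g \<circ> (\<lambda>x. c * x + d)) x) has_vector_derivative k * (c *\<^sub>R g' (c * x + d))) (at x)"
      by (rule has_vector_derivative_mult_right)
    then show ?thesis by (simp add: o_def scaleR_conv_of_real mult.assoc)
  qed
  then show "\<exists>g\<in>{\<lambda>x. k * g (c * x + d) | k g. smooth_fun g}. \<forall>x. (h has_vector_derivative g x) (at x)"
    using g'(1) unfolding h by (intro bexI[of _ "\<lambda>x. (k * of_real c) * g' (c * x + d)"]) auto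
qed

lemma smooth_fun_continuous: "smooth_fun f \<Longrightarrow> continuous_on A f"
  by (meson continuous_at_imp_continuous_on has_vector_derivative_continuous smooth_fun_has_derivative)

text \<open>
  The standard smooth function that vanishes to infinite order at 0. All its derivatives have the form
  \<open>p(1/x) exp(-1/x)\<close> with a polynomial \<open>p\<close>, continued by 0.
\<close>

definition flat_exp :: "real \<Rightarrow> real" where
  "flat_exp x = (if x \<le> 0 then 0 else exp (- 1 / x))"

lemma poly_exp_tendsto_0: "((\<lambda>u. poly P u * exp (- u)) \<longlongrightarrow> (0::real)) at_top"
proof -
  have "((\<lambda>u::real. \<Sum>i\<le>degree P. coeff P i * (u ^ i / exp u)) \<longlongrightarrow> (\<Sum>i\<le>degree P. coeff P i * 0)) at_top"
    by (intro tendsto_sum tendsto_mult tendsto_const tendsto_power_div_exp_0)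
  moreover have "(\<Sum>i\<le>degree P. coeff P i * (u ^ i / exp u)) = poly P u * exp (- u)" for u
    by (simp add: poly_altdef sum_distrib_right exp_minus divide_inverse mult.assoc)
  ultimately show ?thesis by simp
qed

text \<open>
  The functions \<open>p(1/x) exp(-1/x)\<close>, continued by 0, form a set that is closed under differentiation:
  the derivative belongs to the polynomial \<open>u\<^sup>2 (p - p')\<close>. At 0 the difference quotients tend to 0 because
  the exponential beats every polynomial.
\<close>

lemma smooth_fun_flat_exp: "smooth_fun (\<lambda>x. complex_of_real (flat_exp x))"
proof -
  define F where "F P x = (if x \<le> 0 then 0 else complex_of_real (poly P (1/x) * exp (- 1 / x)))"
    for P :: "real poly" and x :: real
  define R where "R P x = (if x \<le> 0 then 0 else poly P (1/x) * exp (- 1 / x))"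
    for P :: "real poly" and x :: real
  have FR: "F P = (\<lambda>x. complex_of_real (R P x))" for P
    by (auto simp: F_def R_def)
  define N where "N P = monom 1 2 * (P - pderiv P)" for P :: "real poly"
  have der: "(R P has_real_derivative R (N P) x) (at x)" for P x
  proof (cases x "0::real" rule: linorder_cases)
    case less
    have "((\<lambda>x. 0) has_real_derivative 0) (at x)" by simp
    moreover have "R (N P) x = 0" using less by (simp add: R_def)
    ultimately show ?thesis
      by (simp, elim has_field_derivative_transform_within_open[where S="{..<0}"]) (use less in \<open>auto simp: R_def\<close>)
  next
    case greater
    have "((\<lambda>x. poly P (1/x) * exp (- 1 / x)) has_real_derivative R (N P) x) (at x)"
      using greater
      by (auto intro!: derivative_eq_intros DERIV_chain2[OF poly_DERIV]
               simp: R_def N_def poly_monom field_simps power2_eq_square)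
    then show ?thesis
      by (elim has_field_derivative_transform_within_open[where S="{0<..}"]) (use greater in \<open>auto simp: R_def\<close>)
  next
    case equal
    have R0: "R Q 0 = 0" for Q by (simp add: R_def)
    have lft: "((\<lambda>y. (R P y - R P 0) / (y - 0)) \<longlongrightarrow> 0) (at_left 0)"
      by (rule Lim_transform_eventually[OF tendsto_const])
         (auto simp: R_def eventually_at_left_field intro!: exI[of _ "-1"])
    have rt: "((\<lambda>y. (R P y - R P 0) / (y - 0)) \<longlongrightarrow> 0) (at_right 0)"
    proof (rule Lim_transform_eventually)
      show "((\<lambda>y. poly (monom 1 1 * P) (inverse y) * exp (- inverse y)) \<longlongrightarrow> 0) (at_right (0::real))"
        by (rule filterlim_compose[OF poly_exp_tendsto_0 filterlim_inverse_at_top_right])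
      show "\<forall>\<^sub>F y in at_right 0. poly (monom 1 1 * P) (inverse y) * exp (- inverse y) = (R P y - R P 0) / (y - 0)"
        by (auto simp: R_def eventually_at_right_field poly_monom field_simps intro!: exI[of _ "1"])
    qed
    show ?thesis
      unfolding equal has_field_derivative_iff R0
      using filterlim_split_at[OF lft rt] by (simp add: R0)
  qed
  have "smooth_fun (F 1)"
  proof (rule smooth_funI[where S="range F"])
    fix f assume "f \<in> range F"
    then obtain P where "f = F P" by auto
    then show "\<exists>g\<in>range F. \<forall>x. (f has_vector_derivative g x) (at x)"
      using der[of P] by (auto simp: FR has_vector_derivative_of_real
          has_real_derivative_iff_has_vector_derivative intro!: exI[of _ "N P"])
  qed auto
  moreover have "F 1 = (\<lambda>x. complex_of_real (flat_exp x))"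
    by (auto simp: F_def flat_exp_def)
  ultimately show ?thesis by simp
qed

lemma flat_exp_bounds: "0 \<le> flat_exp x" "flat_exp x \<le> 1"
  by (auto simp: flat_exp_def)

text \<open>
  A smooth approximation of the indicator function of \<open>(c,d)\<close>. The shift by 1 keeps the support at
  distance \<open>1/n\<close> from the end points, so that \<open>(c,d)\<close> may be the whole interval on which test functions
  are considered.
\<close>

definition plateau :: "real \<Rightarrow> real \<Rightarrow> nat \<Rightarrow> real \<Rightarrow> real" where
  "plateau c d n x = flat_exp (real n * (x - c) - 1) * flat_exp (real n * (d - x) - 1)"

lemma plateau_bounds: "0 \<le> plateau c d n x" "plateau c d n x \<le> 1"
  by (auto simp: plateau_def flat_exp_bounds mult_le_one)

lemma flat_exp_tendsto_1: "c > 0 \<Longrightarrow> (\<lambda>n. flat_exp (real n * c - 1)) \<longlonglongrightarrow> 1"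
proof -
  assume c: "c > 0"
  have lim: "filterlim (\<lambda>n. real n * c - 1) at_top sequentially"
    using c
    by (intro filterlim_tendsto_add_at_top[OF tendsto_const[of "-1"], simplified]
          filterlim_at_top_mult_tendsto_pos[OF tendsto_const] filterlim_real_sequentially) auto
  have "((\<lambda>u::real. exp (- inverse u)) \<longlongrightarrow> exp (- 0)) at_top"
    by (intro tendsto_intros tendsto_inverse_0_at_top filterlim_ident)
  then have "((\<lambda>u::real. exp (- inverse u)) \<longlongrightarrow> 1) at_top"
    by simp
  then have "((\<lambda>u. flat_exp u) \<longlongrightarrow> 1) at_top"
    by (elim Lim_transform_eventually[where f="\<lambda>u. exp (- inverse u)" and g=flat_exp, simplified])
       (auto simp: flat_exp_def eventually_at_top_linorder inverse_eq_divide intro!: exI[of _ 1])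
  then show ?thesis
    by (rule filterlim_compose[OF _ lim])
qed

lemma plateau_tendsto: "(\<lambda>n. plateau c d n x) \<longlonglongrightarrow> indicator {c<..<d} x"
proof (cases "c < x \<and> x < d")
  case True
  then have "(\<lambda>n. plateau c d n x) \<longlonglongrightarrow> 1 * 1"
    unfolding plateau_def by (intro tendsto_mult flat_exp_tendsto_1) auto
  then show ?thesis using True by simp
next
  case False
  then have "plateau c d n x = 0" for n
    by (cases "x \<le> c") (auto simp: plateau_def flat_exp_def mult_nonneg_nonpos intro!: disjI1
        order_trans[OF mult_nonneg_nonpos])
  then show ?thesis using False by simp
qed

lemma plateau_test_function:
  assumes "a \<le> c" "c < d" "d \<le> b"
  shows "(\<lambda>x. complex_of_real (plateau c d n x)) \<in> test_functions a b"
proof -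
  have sm: "smooth_fun (\<lambda>x. complex_of_real (plateau c d n x))"
    using smooth_fun_mult[OF smooth_fun_affine[OF smooth_fun_flat_exp, of "real n" "- real n * c - 1"]
      smooth_fun_affine[OF smooth_fun_flat_exp, of "- real n" "real n * d - 1"]]
    by (simp add: plateau_def algebra_simps)
  have z: "plateau c d n x = 0" if "n = 0 \<or> x \<le> c + 1 / real n \<or> d - 1 / real n \<le> x" for x
    using that by (cases "n = 0") (auto simp: plateau_def flat_exp_def field_simps)
  have "\<exists>c' d'. a < c' \<and> c' \<le> d' \<and> d' < b \<and> (\<forall>x. x \<notin> {c'..d'} \<longrightarrow> complex_of_real (plateau c d n x) = 0)"
  proof (cases "n = 0 \<or> d - 1 / real n < c + 1 / real n")
    case True
    then have "plateau c d n x = 0" for x using z[of x] by force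
    then show ?thesis using assms by (intro exI[of _ "(c+d)/2"]) auto
  next
    case False
    have "0 < 1 / real n" using False by simp
    then have "a < c + 1 / real n" "c + 1 / real n \<le> d - 1 / real n" "d - 1 / real n < b"
      using assms False by linarith+
    moreover have "plateau c d n x = 0" if "x \<notin> {c + 1 / real n..d - 1 / real n}" for x
      using that by (intro z) auto
    ultimately show ?thesis
      by (intro exI[of _ "c + 1 / real n"] exI[of _ "d - 1 / real n"]) auto
  qed
  then show ?thesis using sm by (auto simp: test_functions_def)
qed

section \<open>The fundamental lemma of the calculus of variations\<close>

lemma borel_measurable_lebesgue_on:
  "f \<in> borel_measurable borel \<Longrightarrow> f \<in> borel_measurable (lebesgue_on S)"
  by (intro measurable_restrict_space1 measurable_completion) simp

abbreviation dx :: "real \<Rightarrow> real \<Rightarrow> real measure" where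
  "dx a b \<equiv> lebesgue_on {a<..<b}"

lemma integrable_dx_indicator:
  assumes "integrable (dx a b) f" "A \<in> sets borel"
  shows "integrable (dx a b) (\<lambda>y. indicator A y * f y :: complex)"
proof (rule Bochner_Integration.integrable_bound[OF assms(1)])
  show "(\<lambda>y. indicator A y * f y) \<in> borel_measurable (dx a b)"
    using assms by (intro borel_measurable_times borel_measurable_integrable[OF assms(1)] borel_measurable_lebesgue_on) auto
qed (auto simp: indicator_def)

text \<open>
  The hypothesis says that the finite measures with the densities \<open>max h 0\<close> and \<open>max (- h) 0\<close> agree on all
  half lines. Hence they coincide, and so do their densities almost everywhere. A Borel measurable
  representative of \<open>h\<close> is needed to speak of measures on the Borel sets.
\<close>

lemma AE_lebesgue_on_zero_of_interval_integrals_zero: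
  fixes h :: "real \<Rightarrow> real"
  assumes ab: "a < b" and int: "integrable (dx a b) h"
    and zero: "\<And>c d. a \<le> c \<Longrightarrow> c < d \<Longrightarrow> d \<le> b \<Longrightarrow>
      (LINT x|dx a b. indicator {c<..<d} x * h x) = 0"
  shows "AE x in dx a b. h x = 0"
proof -
  define h0 where "h0 = (\<lambda>x. indicator {a<..<b} x * h x)"
  have h0: "integrable lebesgue h0"
    using int by (simp add: h0_def integrable_restrict_space)
  obtain k where k: "k \<in> borel_measurable lborel" and hk: "AE x in lborel. h0 x = k x"
    using completion_ex_borel_measurable_real[of h0 lborel] h0 borel_measurable_integrable by blast
  have kb: "k \<in> borel_measurable borel" using k by simp
  have k_leb: "integrable lebesgue k"
    by (rule integrable_cong_AE_imp[OF h0])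
       (use k hk in \<open>auto intro: measurable_completion AE_completion\<close>)
  then have k_int: "integrable lborel k"
    using k integrable_completion by blast
  have tail: "(LINT y|lborel. indicator {x<..} y * k y) = 0" for x
  proof -
    have "(LINT y|lborel. indicator {x<..} y * k y) = (LINT y|lebesgue. indicator {x<..} y * k y)"
      using kb by (intro integral_completion[symmetric]) measurable
    also have "\<dots> = (LINT y|lebesgue. indicator {x<..} y * h0 y)"
    proof (rule integral_cong_AE)
      show "AE y in lebesgue. indicator {x<..} y * k y = indicator {x<..} y * h0 y"
        using AE_completion[OF hk] by eventually_elim auto
    qed (use kb borel_measurable_integrable[OF h0] in
        \<open>auto intro!: borel_measurable_times intro: measurable_completion\<close>)
    also have "\<dots> = (LINT y|dx a b. indicator {max a x<..<b} y * h y)"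
      by (subst integral_restrict_space)
         (auto simp: h0_def indicator_def intro!: Bochner_Integration.integral_cong)
    also have "\<dots> = 0"
    proof (cases "max a x < b")
      case False
      then have "{max a x<..<b} = {}" by auto
      then show ?thesis by simp
    qed (use ab in \<open>auto intro!: zero\<close>)
    finally show ?thesis .
  qed
  let ?N = "\<lambda>f. density lborel (\<lambda>x. ennreal (f x))"
  have em: "emeasure (?N f) {x<..} = (\<integral>\<^sup>+ y. ennreal (indicator {x<..} y * f y) \<partial>lborel)"
    if "f \<in> borel_measurable lborel" for f :: "real \<Rightarrow> real" and x
    using that
    by (subst emeasure_density) (auto intro!: nn_integral_cong simp: indicator_def)
  have fin: "(\<integral>\<^sup>+ y. ennreal (indicator {x<..} y * f y) \<partial>lborel) < \<infinity>"
    if "integrable lborel f" for f :: "real \<Rightarrow> real" and x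
  proof -
    have "(\<integral>\<^sup>+ y. ennreal (indicator {x<..} y * f y) \<partial>lborel) \<le> (\<integral>\<^sup>+ y. ennreal (norm (f y)) \<partial>lborel)"
      by (intro nn_integral_mono) (auto simp: indicator_def intro: ennreal_leI)
    also have "\<dots> < \<infinity>" using that by (simp add: integrable_iff_bounded)
    finally show ?thesis .
  qed
  have k_int': "integrable lborel (\<lambda>x. - k x)" using k_int by simp
  have k': "(\<lambda>x. - k x) \<in> borel_measurable lborel" using k by simp
  have "?N k = ?N (\<lambda>x. - k x)"
  proof (rule measure_eqI_lessThan)
    fix x
    show "emeasure (?N k) {x<..} < \<infinity>"
      using fin[OF k_int] by (simp only: em[OF k])
    have i: "integrable lborel (\<lambda>y. indicator {x<..} y * k y)"
      using k_int integrable_mult_indicator[of "{x<..}" lborel k] by simp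
    show "emeasure (?N k) {x<..} = emeasure (?N (\<lambda>x. - k x)) {x<..}"
      unfolding em[OF k] em[OF k']
    proof -
      have "enn2real (\<integral>\<^sup>+ y. ennreal (indicator {x<..} y * k y) \<partial>lborel) =
            enn2real (\<integral>\<^sup>+ y. ennreal (indicator {x<..} y * - k y) \<partial>lborel)"
        using real_lebesgue_integral_def[OF i] tail[of x] by simp
      moreover have "(\<integral>\<^sup>+ y. ennreal (indicator {x<..} y * k y) \<partial>lborel) < \<infinity>"
        "(\<integral>\<^sup>+ y. ennreal (indicator {x<..} y * - k y) \<partial>lborel) < \<infinity>"
        using fin[OF k_int, of x] fin[OF k_int', of x] by auto
      ultimately show "(\<integral>\<^sup>+ y. ennreal (indicator {x<..} y * k y) \<partial>lborel) =
          (\<integral>\<^sup>+ y. ennreal (indicator {x<..} y * - k y) \<partial>lborel)"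
        by (metis ennreal_enn2real infinity_ennreal_def)
    qed
  qed auto
  then have "AE x in lborel. ennreal (k x) = ennreal (- k x)"
    using sigma_finite_measure.density_unique_iff[OF sigma_finite_lborel, of "\<lambda>x. ennreal (k x)" "\<lambda>x. ennreal (- k x)"] k by auto
  then have "AE x in lborel. k x = 0"
    by eventually_elim (metis ennreal_eq_0_iff ennreal_neg le_cases neg_0_le_iff_le neg_le_0_iff_le order_antisym)
  then have "AE x in lborel. h0 x = 0"
    using hk by eventually_elim auto
  then have "AE x in lebesgue. h0 x = 0" by (rule AE_completion)
  then show ?thesis
    by (subst AE_restrict_space_iff) (auto simp: h0_def)
qed

text \<open>
  The plateau functions converge boundedly to indicator functions of intervals, so by dominated
  convergence the integrals of the function over all intervals vanish.
\<close>

lemma AE_zero_of_integrals_against_test_functions_zero: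
  fixes h :: "real \<Rightarrow> complex"
  assumes ab: "a < b" and int: "integrable (dx a b) h"
    and zero: "\<And>\<phi>. \<phi> \<in> test_functions a b \<Longrightarrow> (LINT x|dx a b. h x * \<phi> x) = 0"
  shows "AE x in dx a b. h x = 0"
proof -
  have meas: "plateau c d n \<in> borel_measurable (dx a b)" for c d n
  proof -
    have "(\<lambda>x. complex_of_real (plateau c d n x)) \<in> borel_measurable (dx a b)" if "c < d"
      by (intro continuous_imp_measurable_on_sets_lebesgue smooth_fun_continuous)
         (use plateau_test_function[of c c d d n] that in \<open>auto simp: test_functions_def\<close>)
    then have "c < d \<Longrightarrow> (\<lambda>x. Re (complex_of_real (plateau c d n x))) \<in> borel_measurable (dx a b)"
      by measurable
    moreover have "plateau c d n = (\<lambda>x. 0)" if "d \<le> c"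
    proof
      fix x
      have "real n * (x - c) - 1 \<le> 0 \<or> real n * (d - x) - 1 \<le> 0"
      proof (cases "x \<le> c")
        case True
        then have "real n * (x - c) \<le> 0" by (simp add: mult_nonneg_nonpos)
        then show ?thesis by simp
      next
        case False
        then have "real n * (d - x) \<le> 0" using that by (simp add: mult_nonneg_nonpos)
        then show ?thesis by simp
      qed
      then show "plateau c d n x = 0" by (auto simp: plateau_def flat_exp_def)
    qed
    ultimately show ?thesis by (cases "c < d") auto
  qed
  have ind: "(LINT x|dx a b. indicator {c<..<d} x * h x) = 0"
    if cd: "a \<le> c" "c < d" "d \<le> b" for c d
  proof -
    have "(\<lambda>n. LINT x|dx a b. h x * complex_of_real (plateau c d n x))
      \<longlonglongrightarrow> (LINT x|dx a b. h x * complex_of_real (indicator {c<..<d} x))"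
    proof (rule integral_dominated_convergence[where w="\<lambda>x. norm (h x)"])
      show "AE x in dx a b. norm (h x * complex_of_real (plateau c d n x)) \<le> norm (h x)" for n
        using plateau_bounds by (auto simp: norm_mult abs_of_nonneg intro!: mult_left_le)
      show "AE x in dx a b. (\<lambda>n. h x * complex_of_real (plateau c d n x))
          \<longlonglongrightarrow> h x * complex_of_real (indicator {c<..<d} x)"
        by (intro AE_I2 tendsto_intros plateau_tendsto)
      show "(\<lambda>x. h x * complex_of_real (indicator {c<..<d} x)) \<in> borel_measurable (dx a b)"
        using borel_measurable_integrable[OF int]
        by (intro borel_measurable_times) (auto intro: borel_measurable_lebesgue_on)
    qed (use int meas in \<open>auto intro!: borel_measurable_times borel_measurable_of_real\<close>)
    then have "(LINT x|dx a b. h x * complex_of_real (indicator {c<..<d} x)) = 0"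
      using zero[OF plateau_test_function[OF cd]] LIMSEQ_unique by (auto simp: LIMSEQ_const_iff)
    then show ?thesis
      by (metis (no_types, lifting) Bochner_Integration.integral_cong mult.commute of_real_indicator)
  qed
  have ii: "integrable (dx a b) (\<lambda>x. indicator {c<..<d} x * h x)" for c d
    using int by (intro integrable_dx_indicator) auto
  have Re_indicator_times: "Re (indicator S x * z) = indicator S x * Re z"
    and Im_indicator_times: "Im (indicator S x * z) = indicator S x * Im z" for S and x :: real and z
    by (auto simp: indicator_def)
  have "AE x in dx a b. Re (h x) = 0"
  proof (rule AE_lebesgue_on_zero_of_interval_integrals_zero[OF ab])
    fix c d assume cd: "a \<le> c" "c < d" "d \<le> b"
    show "(LINT x|dx a b. indicator {c<..<d} x * Re (h x)) = 0"
      using arg_cong[OF ind[OF cd], of Re] integral_Re[OF ii[of c d]]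
      by (simp only: Re_indicator_times zero_complex.sel)
  qed (use int in auto)
  moreover have "AE x in dx a b. Im (h x) = 0"
  proof (rule AE_lebesgue_on_zero_of_interval_integrals_zero[OF ab])
    fix c d assume cd: "a \<le> c" "c < d" "d \<le> b"
    show "(LINT x|dx a b. indicator {c<..<d} x * Im (h x)) = 0"
      using arg_cong[OF ind[OF cd], of Im] integral_Im[OF ii[of c d]]
      by (simp only: Im_indicator_times zero_complex.sel)
  qed (use int in auto)
  ultimately show ?thesis
    by eventually_elim (simp add: complex_eq_iff)
qed

section \<open>Absolutely continuous functions\<close>

lemma finite_measure_dx: "finite_measure (dx a b)"
  by (intro finite_measure_lebesgue_on) auto

lemma AE_dx_neq: "AE y in dx a b. y \<noteq> c"
  by (subst AE_restrict_space_iff) (auto intro!: AE_completion AE_lborel_singleton[THEN eventually_mono])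

text \<open>
  Absolute continuity of \<open>F\<close> on \<open>[a,b]\<close> with almost everywhere derivative \<open>f\<close>, expressed through the
  fundamental theorem of calculus. The indicator function keeps the measure space independent of \<open>x\<close>,
  which suits Fubini's theorem and dominated convergence.
\<close>

definition primitive :: "real \<Rightarrow> real \<Rightarrow> (real \<Rightarrow> complex) \<Rightarrow> (real \<Rightarrow> complex) \<Rightarrow> bool" where
  "primitive a b F f \<longleftrightarrow> integrable (dx a b) f \<and>
     (\<forall>x\<in>{a..b}. F x = F a + (LINT y|dx a b. indicator {..x} y * f y))"

text \<open>
  Integrate \<open>f(y) k(z)\<close> over the square and split it along the diagonal: by Fubini's theorem each of the
  two triangles yields one of the integrals on the right.
\<close>

lemma integral_times_integral_eq_triangles:
  fixes f k :: "real \<Rightarrow> complex"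
  assumes f: "integrable (dx a b) f" and k: "integrable (dx a b) k"
  shows "integrable (dx a b) (\<lambda>y. f y * (LINT z|dx a b. indicator {..y} z * k z))"
    and "integrable (dx a b) (\<lambda>z. (LINT y|dx a b. indicator {..z} y * f y) * k z)"
    and "(LINT y|dx a b. f y) * (LINT z|dx a b. k z) =
       (LINT y|dx a b. f y * (LINT z|dx a b. indicator {..y} z * k z)) +
       (LINT z|dx a b. (LINT y|dx a b. indicator {..z} y * f y) * k z)"
proof -
  interpret finite_measure "dx a b" by (rule finite_measure_dx)
  interpret P: pair_sigma_finite "dx a b" "dx a b" ..
  note [measurable] = borel_measurable_integrable[OF f] borel_measurable_integrable[OF k]
  have m1[measurable]: "(\<lambda>p. fst p) \<in> borel_measurable (dx a b \<Otimes>\<^sub>M dx a b)"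
    by (rule measurable_compose[OF measurable_fst]) (auto intro: borel_measurable_lebesgue_on)
  have m2[measurable]: "(\<lambda>p. snd p) \<in> borel_measurable (dx a b \<Otimes>\<^sub>M dx a b)"
    by (rule measurable_compose[OF measurable_snd]) (auto intro: borel_measurable_lebesgue_on)
  have fk: "integrable (dx a b \<Otimes>\<^sub>M dx a b) (\<lambda>(y, z). f y * k z)"
    by (rule P.Fubini_integrable) (use f k in \<open>auto simp: norm_mult\<close>)
  define P1 where "P1 = (\<lambda>y z. if z \<le> y then f y * k z else 0)"
  define P2 where "P2 = (\<lambda>y z. if z \<le> y then 0 else f y * k z)"
  have i1: "integrable (dx a b \<Otimes>\<^sub>M dx a b) (case_prod P1)"
    by (rule Bochner_Integration.integrable_bound[OF fk]) (auto simp: P1_def case_prod_beta)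
  have i2: "integrable (dx a b \<Otimes>\<^sub>M dx a b) (case_prod P2)"
    by (rule Bochner_Integration.integrable_bound[OF fk]) (auto simp: P2_def case_prod_beta)
  have e1: "(LINT z|dx a b. P1 y z) = f y * (LINT z|dx a b. indicator {..y} z * k z)" for y
  proof -
    have "(LINT z|dx a b. P1 y z) = (LINT z|dx a b. f y * (indicator {..y} z * k z))"
      by (rule Bochner_Integration.integral_cong) (auto simp: P1_def indicator_def)
    then show ?thesis by (simp only: Bochner_Integration.integral_mult_right_zero)
  qed
  have e2: "(LINT y|dx a b. P2 y z) = (LINT y|dx a b. indicator {..z} y * f y) * k z" for z
  proof -
    have "(LINT y|dx a b. P2 y z) = (LINT y|dx a b. (indicator {..z} y * f y) * k z)"
    proof (rule integral_cong_AE)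
      show "AE y in dx a b. P2 y z = (indicator {..z} y * f y) * k z"
        using AE_dx_neq[of z] by eventually_elim (auto simp: P2_def indicator_def)
      show "(\<lambda>y. P2 y z) \<in> borel_measurable (dx a b)"
      proof -
        have "(\<lambda>y. P2 y z) = (\<lambda>y. (indicator {..<z} y * f y) * k z)"
          by (auto simp: P2_def indicator_def)
        then show ?thesis
          using borel_measurable_integrable[OF integrable_dx_indicator[OF f, of "{..<z}"]] by auto
      qed
      show "(\<lambda>y. (indicator {..z} y * f y) * k z) \<in> borel_measurable (dx a b)"
        using borel_measurable_integrable[OF integrable_dx_indicator[OF f, of "{..z}"]] by auto
    qed
    then show ?thesis by simp
  qed
  show "integrable (dx a b) (\<lambda>y. f y * (LINT z|dx a b. indicator {..y} z * k z))"
    using P.integrable_fst[OF i1] by (simp add: e1)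
  show "integrable (dx a b) (\<lambda>z. (LINT y|dx a b. indicator {..z} y * f y) * k z)"
    using P.integrable_snd[OF i2] by (simp add: e2)
  have "(LINT y|dx a b. f y) * (LINT z|dx a b. k z) = (LINT y|dx a b. LINT z|dx a b. f y * k z)"
    by simp
  also have "\<dots> = (LINT p|(dx a b \<Otimes>\<^sub>M dx a b). (case p of (y, z) \<Rightarrow> f y * k z))"
    using P.integral_fst[OF fk] by simp
  also have "\<dots> = (LINT p|(dx a b \<Otimes>\<^sub>M dx a b). (case_prod P1 p + case_prod P2 p))"
    by (rule Bochner_Integration.integral_cong) (auto simp: P1_def P2_def)
  also have "\<dots> = (LINT p|(dx a b \<Otimes>\<^sub>M dx a b). case_prod P1 p) + (LINT p|(dx a b \<Otimes>\<^sub>M dx a b). case_prod P2 p)"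
    using i1 i2 by simp
  also have "(LINT p|(dx a b \<Otimes>\<^sub>M dx a b). case_prod P1 p) =
      (LINT y|dx a b. f y * (LINT z|dx a b. indicator {..y} z * k z))"
    using P.integral_fst[OF i1] by (simp add: e1)
  also have "(LINT p|(dx a b \<Otimes>\<^sub>M dx a b). case_prod P2 p) =
      (LINT z|dx a b. (LINT y|dx a b. indicator {..z} y * f y) * k z)"
    using P.integral_snd[OF i2] by (simp add: e2)
  finally show "(LINT y|dx a b. f y) * (LINT z|dx a b. k z) =
       (LINT y|dx a b. f y * (LINT z|dx a b. indicator {..y} z * k z)) +
       (LINT z|dx a b. (LINT y|dx a b. indicator {..z} y * f y) * k z)" .
qed

lemma integral_indicator_atMost_left:
  "(LINT y|dx a b. indicator {..a} y * f y :: complex) = 0"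
proof -
  have "(LINT y|dx a b. indicator {..a} y * f y) = (LINT y|dx a b. 0)"
    by (rule Bochner_Integration.integral_cong) (auto simp: indicator_def)
  then show ?thesis by simp
qed

lemma primitive_integrable: "primitive a b F f \<Longrightarrow> integrable (dx a b) f"
  by (simp add: primitive_def)

lemma primitive_eq:
  "primitive a b F f \<Longrightarrow> x \<in> {a..b} \<Longrightarrow> F x = F a + (LINT y|dx a b. indicator {..x} y * f y)"
  unfolding primitive_def by blast

lemma primitive_const: "primitive a b (\<lambda>x. c) (\<lambda>x. 0)"
  by (simp add: primitive_def)

lemma primitive_add:
  assumes "primitive a b F f" "primitive a b K k"
  shows "primitive a b (\<lambda>x. F x + K x) (\<lambda>x. f x + k x)"
proof -
  have f: "integrable (dx a b) (\<lambda>y. indicator {..x} y * f y)" and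
       k: "integrable (dx a b) (\<lambda>y. indicator {..x} y * k y)" for x
    using assms by (auto simp: primitive_def intro!: integrable_dx_indicator)
  show ?thesis
    unfolding primitive_def
  proof (intro conjI ballI)
    show "integrable (dx a b) (\<lambda>x. f x + k x)"
      using assms by (intro Bochner_Integration.integrable_add primitive_integrable)
    fix x assume x: "x \<in> {a..b}"
    have "F x = F a + (LINT y|dx a b. indicator {..x} y * f y)"
      "K x = K a + (LINT y|dx a b. indicator {..x} y * k y)"
      by (rule primitive_eq[OF assms(1) x], rule primitive_eq[OF assms(2) x])
    then show "F x + K x = F a + K a + (LINT y|dx a b. indicator {..x} y * (f y + k y))"
      using f k by (simp add: distrib_left)
  qed
qed

text \<open>
  The product rule, and with it integration by parts, for absolutely continuous functions: apply the
  triangle decomposition on \<open>(a,x)\<close> and add the contributions of the values at \<open>a\<close>.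
\<close>

lemma primitive_mult:
  assumes F: "primitive a b F f" and K: "primitive a b K k"
  shows "primitive a b (\<lambda>x. F x * K x) (\<lambda>x. f x * K x + F x * k x)"
proof -
  define T where "T g x = (LINT y|dx a b. indicator {..x} y * g y)" for g :: "real \<Rightarrow> complex" and x
  have f: "integrable (dx a b) f" and k: "integrable (dx a b) k"
    using F K by (auto simp: primitive_def)
  have Fx: "F x = F a + T f x" if "x \<in> {a..b}" for x
    unfolding T_def by (rule primitive_eq[OF F that])
  have Kx: "K x = K a + T k x" if "x \<in> {a..b}" for x
    unfolding T_def by (rule primitive_eq[OF K that])
  have i1: "integrable (dx a b) (\<lambda>x. f x * T k x)" and i2: "integrable (dx a b) (\<lambda>x. T f x * k x)"
    unfolding T_def by (rule integral_times_integral_eq_triangles[OF f k])+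
  have tri: "T f x * T k x = T (\<lambda>x. f x * T k x) x + T (\<lambda>x. T f x * k x) x" for x
  proof -
    have split: "T f x * T k x = (LINT y|dx a b. (indicator {..x} y * f y) * T (\<lambda>z. indicator {..x} z * k z) y) +
       (LINT z|dx a b. T (\<lambda>y. indicator {..x} y * f y) z * (indicator {..x} z * k z))"
      unfolding T_def
      by (rule integral_times_integral_eq_triangles(3)[OF integrable_dx_indicator[OF f] integrable_dx_indicator[OF k]]) auto
    have e1: "(indicator {..x} y * f y) * T (\<lambda>z. indicator {..x} z * k z) y
        = indicator {..x} y * (f y * T k y)" for y
    proof (cases "y \<le> x")
      case True
      then have "T (\<lambda>z. indicator {..x} z * k z) y = T k y"
        unfolding T_def by (intro Bochner_Integration.integral_cong) (auto simp: indicator_def)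
      then show ?thesis by simp
    qed simp
    have e2: "T (\<lambda>y. indicator {..x} y * f y) z * (indicator {..x} z * k z)
        = indicator {..x} z * (T f z * k z)" for z
    proof (cases "z \<le> x")
      case True
      then have "T (\<lambda>z. indicator {..x} z * f z) z = T f z"
        unfolding T_def by (intro Bochner_Integration.integral_cong) (auto simp: indicator_def)
      then show ?thesis by simp
    qed simp
    show ?thesis
      using split unfolding e1 e2 T_def[of "\<lambda>x. f x * T k x" x] T_def[of "\<lambda>x. T f x * k x" x] .
  qed
  have Tadd: "T (\<lambda>x. p x + q x) x = T p x + T q x"
    if "integrable (dx a b) p" "integrable (dx a b) q" for p q x
    using that integrable_dx_indicator[of a b p "{..x}"] integrable_dx_indicator[of a b q "{..x}"]
    by (simp add: T_def distrib_left)
  have Tmul: "T (\<lambda>x. c * p x) x = c * T p x" for c p x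
    by (simp add: T_def mult.left_commute)
  have eq: "f y * K y + F y * k y = (K a * f y + f y * T k y) + (F a * k y + T f y * k y)"
    if "y \<in> {a<..<b}" for y
    using Fx[of y] Kx[of y] that by (simp add: algebra_simps)
  have I: "integrable (dx a b) (\<lambda>y. (K a * f y + f y * T k y) + (F a * k y + T f y * k y))"
    using f k i1 i2 by auto
  show ?thesis
    unfolding primitive_def
  proof (intro conjI ballI)
    show "integrable (dx a b) (\<lambda>x. f x * K x + F x * k x)"
      by (subst Bochner_Integration.integrable_cong[OF refl eq]) (use I in auto)
    fix x assume x: "x \<in> {a..b}"
    have "(LINT y|dx a b. indicator {..x} y * (f y * K y + F y * k y))
        = T (\<lambda>y. (K a * f y + f y * T k y) + (F a * k y + T f y * k y)) x"
      unfolding T_def by (intro Bochner_Integration.integral_cong) (use eq in \<open>auto simp: T_def\<close>)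
    also have "\<dots> = (K a * T f x + T (\<lambda>y. f y * T k y) x) + (F a * T k x + T (\<lambda>y. T f y * k y) x)"
      using f k i1 i2 by (simp add: Tadd Tmul)
    finally show "F x * K x = F a * K a + (LINT y|dx a b. indicator {..x} y * (f y * K y + F y * k y))"
      using tri[of x] by (simp add: Fx[OF x] Kx[OF x] algebra_simps)
  qed
qed

lemma primitive_cmult:
  "primitive a b F f \<Longrightarrow> primitive a b (\<lambda>x. c * F x) (\<lambda>x. c * f x)"
  using primitive_mult[OF primitive_const] by fastforce

lemma primitive_uminus: "primitive a b F f \<Longrightarrow> primitive a b (\<lambda>x. - F x) (\<lambda>x. - f x)"
  using primitive_cmult[of a b F f "-1"] by simp

lemma primitive_diff:
  "primitive a b F f \<Longrightarrow> primitive a b K k \<Longrightarrow> primitive a b (\<lambda>x. F x - K x) (\<lambda>x. f x - k x)"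
  using primitive_add[OF _ primitive_uminus] by fastforce

lemma primitive_cnj:
  assumes "primitive a b F f"
  shows "primitive a b (\<lambda>x. cnj (F x)) (\<lambda>x. cnj (f x))"
  unfolding primitive_def
proof (intro conjI ballI)
  show "integrable (dx a b) (\<lambda>x. cnj (f x))"
    using assms by (simp add: primitive_def)
  fix x assume x: "x \<in> {a..b}"
  have "cnj (F x) = cnj (F a) + cnj (LINT y|dx a b. indicator {..x} y * f y)"
    by (subst primitive_eq[OF assms x]) simp
  also have "cnj (LINT y|dx a b. indicator {..x} y * f y) = (LINT y|dx a b. indicator {..x} y * cnj (f y))"
    by (subst Bochner_Integration.integral_cnj[symmetric]) (auto simp: indicator_def intro!: Bochner_Integration.integral_cong)
  finally show "cnj (F x) = cnj (F a) + (LINT y|dx a b. indicator {..x} y * cnj (f y))" .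
qed

lemma primitive_FTC:
  assumes "primitive a b F f" "a \<le> b"
  shows "(LINT y|dx a b. f y) = F b - F a"
proof -
  have "F b = F a + (LINT y|dx a b. indicator {..b} y * f y)"
    by (rule primitive_eq[OF assms(1)]) (use assms(2) in auto)
  also have "(LINT y|dx a b. indicator {..b} y * f y) = (LINT y|dx a b. f y)"
    by (rule Bochner_Integration.integral_cong) (auto simp: indicator_def)
  finally show ?thesis by simp
qed

lemma primitive_continuous:
  assumes "primitive a b F f"
  shows "continuous_on {a..b} F"
proof (rule continuous_on_sequentiallyI)
  fix u c assume u: "\<forall>n. u n \<in> {a..b}" and c: "c \<in> {a..b}" and lim: "u \<longlonglongrightarrow> c"
  have f: "integrable (dx a b) f" using assms by (simp add: primitive_def)
  have "(\<lambda>n. LINT y|dx a b. indicator {..u n} y * f y) \<longlonglongrightarrow> (LINT y|dx a b. indicator {..c} y * f y)"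
  proof (rule integral_dominated_convergence[where w="\<lambda>x. norm (f x)"])
    show "AE y in dx a b. (\<lambda>n. indicator {..u n} y * f y) \<longlonglongrightarrow> indicator {..c} y * f y"
      using AE_dx_neq[of c]
    proof eventually_elim
      case (elim y)
      have "\<forall>\<^sub>F n in sequentially. indicator {..u n} y * f y = indicator {..c} y * f y"
      proof (cases "y < c")
        case True
        then have "\<forall>\<^sub>F n in sequentially. y < u n" using lim order_tendstoD(1) by blast
        then show ?thesis by eventually_elim (use True in \<open>auto simp: indicator_def\<close>)
      next
        case False
        then have "c < y" using elim by auto
        then have "\<forall>\<^sub>F n in sequentially. u n < y" using lim order_tendstoD(2) by blast
        then show ?thesis by eventually_elim (use \<open>c < y\<close> in \<open>auto simp: indicator_def\<close>)
      qed
      then show ?case by (rule tendsto_eventually)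
    qed
    show "AE y in dx a b. norm (indicator {..u n} y * f y) \<le> norm (f y)" for n
      by (auto simp: indicator_def)
  qed (use f integrable_dx_indicator[OF f] in \<open>auto intro!: borel_measurable_integrable\<close>)
  then have "(\<lambda>n. F a + (LINT y|dx a b. indicator {..u n} y * f y)) \<longlonglongrightarrow> F a + (LINT y|dx a b. indicator {..c} y * f y)"
    by (intro tendsto_intros)
  moreover have "F x = F a + (LINT y|dx a b. indicator {..x} y * f y)" if "x \<in> {a..b}" for x
    by (rule primitive_eq[OF assms that])
  ultimately show "(\<lambda>n. F (u n)) \<longlonglongrightarrow> F c"
    using u c by (metis (no_types, lifting) ext)
qed

lemma primitive_C1:
  assumes ab: "a \<le> b" and der: "\<And>x. x \<in> {a..b} \<Longrightarrow> (F has_vector_derivative f x) (at x within {a..b})"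
    and cont: "continuous_on {a..b} f"
  shows "primitive a b F f"
proof -
  have int: "integrable (lebesgue_on {a..b}) f"
    using cont by (rule continuous_imp_integrable_real)
  have sub: "integrable (lebesgue_on {a..x}) f" if "x \<in> {a..b}" for x
    by (rule integrable_subinterval[OF int]) (use that in auto)
  have int_dx: "integrable (dx a b) f"
  proof -
    have "f absolutely_integrable_on {a..b}"
      using cont by (rule absolutely_integrable_continuous_real)
    then have "set_integrable lebesgue {a<..<b} f"
      by (rule set_integrable_subset) auto
    then show ?thesis
      by (simp add: set_integrable_def integrable_restrict_space)
  qed
  show ?thesis
    unfolding primitive_def
  proof (intro conjI ballI)
    show "integrable (dx a b) f" by (rule int_dx)
    fix x assume x: "x \<in> {a..b}"
    have "F x - F a = integral {a..x} f"
    proof (rule integral_unique[symmetric], rule fundamental_theorem_of_calculus)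
      show "(F has_vector_derivative f y) (at y within {a..x})" if "y \<in> {a..x}" for y
        by (rule has_vector_derivative_within_subset[OF der]) (use that x in auto)
    qed (use x in auto)
    also have "\<dots> = (LINT y|lebesgue_on {a..x}. f y)"
      using sub[OF x] by (simp add: lebesgue_integral_eq_integral)
    also have "\<dots> = (LINT y|lebesgue. indicator {a..x} y *\<^sub>R f y)"
      by (rule integral_restrict_space) auto
    also have "\<dots> = (LINT y|lebesgue. indicator {a<..<b} y *\<^sub>R (indicator {..x} y * f y))"
    proof (rule integral_cong_AE)
      show "(\<lambda>y. indicator {a..x} y *\<^sub>R f y) \<in> borel_measurable lebesgue"
        using sub[OF x] by (subst (asm) integrable_restrict_space) auto
      have "integrable (dx a b) (\<lambda>y. indicator {..x} y * f y)"
        by (intro integrable_dx_indicator int_dx) auto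
      then show "(\<lambda>y. indicator {a<..<b} y *\<^sub>R (indicator {..x} y * f y)) \<in> borel_measurable lebesgue"
        by (subst (asm) integrable_restrict_space) auto
      have "AE y in lebesgue. y \<noteq> a \<and> y \<noteq> b"
        by (intro AE_completion AE_conjI AE_lborel_singleton)
      then show "AE y in lebesgue. indicator {a..x} y *\<^sub>R f y = indicator {a<..<b} y *\<^sub>R (indicator {..x} y * f y)"
        by eventually_elim (use x in \<open>auto simp: indicator_def\<close>)
    qed
    also have "\<dots> = (LINT y|dx a b. indicator {..x} y * f y)"
      by (rule integral_restrict_space[symmetric]) auto
    finally show "F x = F a + (LINT y|dx a b. indicator {..x} y * f y)"
      by (simp add: algebra_simps)
  qed
qed

lemma primitive_cong_AE:
  assumes "primitive a b F f" "AE x in dx a b. f x = g x" "g \<in> borel_measurable (dx a b)"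
  shows "primitive a b F g"
proof -
  have g: "integrable (dx a b) g"
    using assms integrable_cong_AE_imp primitive_integrable by blast
  have "(LINT y|dx a b. indicator {..x} y * f y) = (LINT y|dx a b. indicator {..x} y * g y)" for x
    by (rule integral_cong_AE)
       (use assms(2) borel_measurable_integrable[OF integrable_dx_indicator[OF primitive_integrable[OF assms(1)]]]
         borel_measurable_integrable[OF integrable_dx_indicator[OF g]] in auto)
  then show ?thesis
    unfolding primitive_def using g primitive_eq[OF assms(1)] by metis
qed

section \<open>Square-integrable functions\<close>

lemma L2_measurable: "f \<in> L2 a b \<Longrightarrow> f \<in> borel_measurable (dx a b)"
  and L2_square_integrable: "f \<in> L2 a b \<Longrightarrow> integrable (dx a b) (\<lambda>x. (cmod (f x))\<^sup>2)"
  by (auto simp: L2_def)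

lemma L2norm_nonneg [simp]: "0 \<le> L2norm a b f"
  by (simp add: L2norm_def)

lemma L2norm_power2: "(L2norm a b f)\<^sup>2 = (LINT x|dx a b. (cmod (f x))\<^sup>2)"
  by (simp add: L2norm_def)

lemma L2norm_cong_AE:
  assumes "AE x in dx a b. f x = g x" "f \<in> borel_measurable (dx a b)" "g \<in> borel_measurable (dx a b)"
  shows "L2norm a b f = L2norm a b g"
  unfolding L2norm_def
  by (rule arg_cong[of _ _ sqrt], rule integral_cong_AE) (use assms in auto)

lemma L2_dominated:
  assumes "f \<in> borel_measurable (dx a b)" "u \<in> L2 a b" "\<And>x. x \<in> {a<..<b} \<Longrightarrow> cmod (f x) \<le> C * cmod (u x)"
  shows "f \<in> L2 a b"
proof -
  have "integrable (dx a b) (\<lambda>x. C\<^sup>2 * (cmod (u x))\<^sup>2)"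
    using assms(2) by (auto simp: L2_def)
  then have "integrable (dx a b) (\<lambda>x. (cmod (f x))\<^sup>2)"
  proof (rule Bochner_Integration.integrable_bound)
    show "AE x in dx a b. norm ((cmod (f x))\<^sup>2) \<le> norm (C\<^sup>2 * (cmod (u x))\<^sup>2)"
    proof (rule AE_I2)
      fix x assume "x \<in> space (dx a b)"
      then have "(cmod (f x))\<^sup>2 \<le> (C * cmod (u x))\<^sup>2"
        by (intro power_mono assms(3)) auto
      then show "norm ((cmod (f x))\<^sup>2) \<le> norm (C\<^sup>2 * (cmod (u x))\<^sup>2)"
        by (simp add: power_mult_distrib)
    qed
  qed (use assms in auto)
  then show ?thesis using assms(1) by (auto simp: L2_def)
qed

lemma L2norm_dominated:
  assumes "f \<in> borel_measurable (dx a b)" "u \<in> L2 a b" "\<And>x. x \<in> {a<..<b} \<Longrightarrow> cmod (f x) \<le> C * cmod (u x)" "0 \<le> C"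
  shows "L2norm a b f \<le> C * L2norm a b u"
proof -
  have f: "f \<in> L2 a b" by (rule L2_dominated[OF assms(1-3)])
  have "(L2norm a b f)\<^sup>2 \<le> (LINT x|dx a b. C\<^sup>2 * (cmod (u x))\<^sup>2)"
    unfolding L2norm_power2
  proof (rule integral_mono)
    fix x assume "x \<in> space (dx a b)"
    then have "(cmod (f x))\<^sup>2 \<le> (C * cmod (u x))\<^sup>2"
      by (intro power_mono assms(3)) auto
    then show "(cmod (f x))\<^sup>2 \<le> C\<^sup>2 * (cmod (u x))\<^sup>2"
      by (simp add: power_mult_distrib)
  qed (use f assms in \<open>auto simp: L2_def\<close>)
  also have "\<dots> = (C * L2norm a b u)\<^sup>2"
    by (simp add: power_mult_distrib L2norm_power2)
  finally show ?thesis
    using assms(4) by (simp add: power2_le_iff_abs_le)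
qed

lemma L2_mult_integrable:
  assumes "f \<in> L2 a b" "g \<in> L2 a b"
  shows "integrable (dx a b) (\<lambda>x. f x * g x)"
proof (rule Bochner_Integration.integrable_bound)
  show "integrable (dx a b) (\<lambda>x. (cmod (f x))\<^sup>2 + (cmod (g x))\<^sup>2)"
    using assms by (auto simp: L2_def)
  have "2 * (cmod (f x) * cmod (g x)) \<le> (cmod (f x))\<^sup>2 + (cmod (g x))\<^sup>2" for x
    using sum_squares_bound[of "cmod (f x)" "cmod (g x)"] by simp
  then have "cmod (f x) * cmod (g x) \<le> (cmod (f x))\<^sup>2 + (cmod (g x))\<^sup>2" for x
    by (smt (verit) mult_nonneg_nonneg norm_ge_zero)
  then show "AE x in dx a b. norm (f x * g x) \<le> norm ((cmod (f x))\<^sup>2 + (cmod (g x))\<^sup>2)"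
    by (auto simp: norm_mult)
qed (use assms in \<open>auto simp: L2_def\<close>)

lemma L2_const: "(\<lambda>x. c) \<in> L2 a b"
proof -
  interpret finite_measure "dx a b" by (rule finite_measure_dx)
  show ?thesis by (auto simp: L2_def)
qed

lemma L2_integrable: "f \<in> L2 a b \<Longrightarrow> integrable (dx a b) f"
  using L2_mult_integrable[OF _ L2_const[of 1], of f a b] by simp

lemma L2_cmult: "f \<in> L2 a b \<Longrightarrow> (\<lambda>x. c * f x) \<in> L2 a b"
  by (rule L2_dominated[where C="cmod c" and u=f])
     (auto simp: norm_mult intro: borel_measurable_times L2_measurable)

lemma L2_cnj: "f \<in> L2 a b \<Longrightarrow> (\<lambda>x. cnj (f x)) \<in> L2 a b"
  unfolding L2_def
  by (auto intro: measurable_compose[OF _ borel_measurable_continuous_onI[OF continuous_on_cnj[OF continuous_on_id]]])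

lemma L2_add:
  assumes "f \<in> L2 a b" "g \<in> L2 a b"
  shows "(\<lambda>x. f x + g x) \<in> L2 a b"
proof -
  have "integrable (dx a b) (\<lambda>x. 2 * (cmod (f x))\<^sup>2 + 2 * (cmod (g x))\<^sup>2)"
    using assms by (auto simp: L2_def)
  moreover have "(cmod (f x + g x))\<^sup>2 \<le> 2 * (cmod (f x))\<^sup>2 + 2 * (cmod (g x))\<^sup>2" for x
  proof -
    have "(cmod (f x + g x))\<^sup>2 \<le> (cmod (f x) + cmod (g x))\<^sup>2"
      by (intro power_mono norm_triangle_ineq) auto
    also have "\<dots> \<le> 2 * (cmod (f x))\<^sup>2 + 2 * (cmod (g x))\<^sup>2"
      using sum_squares_bound[of "cmod (f x)" "cmod (g x)"] by (simp add: power2_sum)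
    finally show ?thesis .
  qed
  ultimately have "integrable (dx a b) (\<lambda>x. (cmod (f x + g x))\<^sup>2)"
    by (elim Bochner_Integration.integrable_bound) (use assms in \<open>auto simp: L2_def\<close>)
  then show ?thesis using assms by (auto simp: L2_def)
qed

lemma L2_diff: "f \<in> L2 a b \<Longrightarrow> g \<in> L2 a b \<Longrightarrow> (\<lambda>x. f x - g x) \<in> L2 a b"
  using L2_add[of f a b "\<lambda>x. -1 * g x"] L2_cmult[of g a b "-1"] by simp

lemma continuous_bounded_Icc:
  fixes f :: "real \<Rightarrow> complex"
  assumes "continuous_on {a..b} f"
  obtains C where "0 \<le> C" "\<And>x. x \<in> {a..b} \<Longrightarrow> cmod (f x) \<le> C"
proof -
  have "bounded (f ` {a..b})"
    by (intro compact_imp_bounded compact_continuous_image assms) auto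
  then obtain C where "\<forall>x\<in>f ` {a..b}. cmod x \<le> C" unfolding bounded_iff by blast
  then show ?thesis by (intro that[of "max C 0"]) (auto simp: le_max_iff_disj)
qed

lemma continuous_measurable_dx:
  fixes f :: "real \<Rightarrow> complex"
  assumes "continuous_on {a..b} f"
  shows "f \<in> borel_measurable (dx a b)"
  by (intro continuous_imp_measurable_on_sets_lebesgue continuous_on_subset[OF assms]) auto

lemma L2_continuous_mult:
  assumes m: "continuous_on {a..b} m" and f: "f \<in> L2 a b"
  shows "(\<lambda>x. m x * f x) \<in> L2 a b"
proof -
  obtain C where C: "0 \<le> C" "\<And>x. x \<in> {a..b} \<Longrightarrow> cmod (m x) \<le> C"
    using continuous_bounded_Icc[OF m] by blast
  show ?thesis
  proof (rule L2_dominated[OF _ f])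
    show "(\<lambda>x. m x * f x) \<in> borel_measurable (dx a b)"
      by (intro borel_measurable_times continuous_measurable_dx m L2_measurable f)
    show "cmod (m x * f x) \<le> C * cmod (f x)" if "x \<in> {a<..<b}" for x
      unfolding norm_mult by (intro mult_right_mono C(2)) (use that in auto)
  qed
qed

lemma L2_continuous: "continuous_on {a..b} f \<Longrightarrow> f \<in> L2 a b"
  using L2_continuous_mult[of a b f "\<lambda>x. 1"] L2_const[of 1] by simp

lemma integral_mult_norm_le_L2norm:
  assumes f: "f \<in> L2 a b" and g: "g \<in> L2 a b"
  shows "(LINT x|dx a b. cmod (f x) * cmod (g x)) \<le> L2norm a b f * L2norm a b g"
proof -
  have meas: "f \<in> borel_measurable (dx a b)" "g \<in> borel_measurable (dx a b)"
    using f g by (auto simp: L2_def)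
  have fg: "integrable (dx a b) (\<lambda>x. cmod (f x) * cmod (g x))"
    using integrable_norm[OF L2_mult_integrable[OF f g]] by (simp add: norm_mult)
  have "(\<integral>\<^sup>+ x. ennreal (cmod (f x)) * ennreal (cmod (g x)) \<partial>dx a b)\<^sup>2
     \<le> (\<integral>\<^sup>+ x. (ennreal (cmod (f x)))\<^sup>2 \<partial>dx a b) * (\<integral>\<^sup>+ x. (ennreal (cmod (g x)))\<^sup>2 \<partial>dx a b)"
    by (rule Cauchy_Schwarz_nn_integral) (use meas in auto)
  moreover have "(\<integral>\<^sup>+ x. ennreal (cmod (f x)) * ennreal (cmod (g x)) \<partial>dx a b) =
      ennreal (LINT x|dx a b. cmod (f x) * cmod (g x))"
    using nn_integral_eq_integral[OF fg] by (simp add: ennreal_mult[symmetric])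
  moreover have "(\<integral>\<^sup>+ x. (ennreal (cmod (h x)))\<^sup>2 \<partial>dx a b) = ennreal ((L2norm a b h)\<^sup>2)" if "h \<in> L2 a b" for h
    using nn_integral_eq_integral[OF L2_square_integrable[OF that]] unfolding L2norm_power2 by (simp add: ennreal_power)
  ultimately have "ennreal ((LINT x|dx a b. cmod (f x) * cmod (g x))\<^sup>2)
      \<le> ennreal ((L2norm a b f)\<^sup>2 * (L2norm a b g)\<^sup>2)"
    using f g by (simp add: ennreal_power ennreal_mult)
  then have "(LINT x|dx a b. cmod (f x) * cmod (g x))\<^sup>2 \<le> (L2norm a b f * L2norm a b g)\<^sup>2"
    by (simp add: power_mult_distrib)
  then show ?thesis by (rule power2_le_imp_le) simp
qed

lemma norm_integral_mult_le_L2norm: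
  assumes f: "f \<in> L2 a b" and g: "g \<in> L2 a b"
  shows "cmod (LINT x|dx a b. f x * g x) \<le> L2norm a b f * L2norm a b g"
proof -
  have "cmod (LINT x|dx a b. f x * g x) \<le> (LINT x|dx a b. cmod (f x) * cmod (g x))"
    using integral_norm_bound[of "dx a b" "\<lambda>x. f x * g x"] by (simp add: norm_mult)
  then show ?thesis using integral_mult_norm_le_L2norm[OF f g] by simp
qed

lemma L2norm_triangle:
  assumes f: "f \<in> L2 a b" and g: "g \<in> L2 a b"
  shows "L2norm a b (\<lambda>x. f x + g x) \<le> L2norm a b f + L2norm a b g"
proof -
  have fg: "integrable (dx a b) (\<lambda>x. cmod (f x) * cmod (g x))"
    using integrable_norm[OF L2_mult_integrable[OF f g]] by (simp add: norm_mult)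
  have "(L2norm a b (\<lambda>x. f x + g x))\<^sup>2 \<le>
      (LINT x|dx a b. (cmod (f x))\<^sup>2 + 2 * (cmod (f x) * cmod (g x)) + (cmod (g x))\<^sup>2)"
    unfolding L2norm_power2
  proof (rule integral_mono)
    fix x
    have "(cmod (f x + g x))\<^sup>2 \<le> (cmod (f x) + cmod (g x))\<^sup>2"
      by (intro power_mono norm_triangle_ineq) auto
    then show "(cmod (f x + g x))\<^sup>2 \<le> (cmod (f x))\<^sup>2 + 2 * (cmod (f x) * cmod (g x)) + (cmod (g x))\<^sup>2"
      by (simp add: power2_sum)
  qed (use L2_add[OF f g] f g fg in \<open>auto simp: L2_def\<close>)
  also have "\<dots> = (L2norm a b f)\<^sup>2 + 2 * (LINT x|dx a b. cmod (f x) * cmod (g x)) + (L2norm a b g)\<^sup>2"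
    using f g fg by (simp add: L2_def L2norm_power2)
  also have "\<dots> \<le> (L2norm a b f + L2norm a b g)\<^sup>2"
    using integral_mult_norm_le_L2norm[OF f g] by (simp add: power2_sum)
  finally show ?thesis by (rule power2_le_imp_le) simp
qed

lemma L2norm_cmult: "L2norm a b (\<lambda>x. c * f x) = cmod c * L2norm a b f"
  by (simp add: L2norm_def norm_mult power_mult_distrib real_sqrt_mult)

lemma L2norm_minus_commute: "L2norm a b (\<lambda>x. f x - g x) = L2norm a b (\<lambda>x. g x - f x)"
  by (simp add: L2norm_def norm_minus_commute)

lemma L2norm_diff_triangle:
  assumes "f \<in> L2 a b" "g \<in> L2 a b" "h \<in> L2 a b"
  shows "L2norm a b (\<lambda>x. f x - h x) \<le> L2norm a b (\<lambda>x. f x - g x) + L2norm a b (\<lambda>x. g x - h x)"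
  using L2norm_triangle[OF L2_diff[OF assms(1,2)] L2_diff[OF assms(2,3)]] by simp

lemma L2norm_reverse_triangle:
  assumes "f \<in> L2 a b" "g \<in> L2 a b"
  shows "\<bar>L2norm a b f - L2norm a b g\<bar> \<le> L2norm a b (\<lambda>x. f x - g x)"
  using L2norm_triangle[OF L2_diff[OF assms] assms(2)] L2norm_triangle[OF L2_diff[OF assms(2,1)] assms(1)]
    L2norm_minus_commute[of a b f g] by simp

lemma tendsto_L2norm:
  assumes "(\<lambda>r. L2norm a b (\<lambda>x. f r x - g x)) \<longlonglongrightarrow> 0" "\<And>r. f r \<in> L2 a b" "g \<in> L2 a b"
  shows "(\<lambda>r. L2norm a b (f r)) \<longlonglongrightarrow> L2norm a b g"
proof (rule LIM_zero_cancel, rule tendsto_0_le[OF assms(1), where K=1])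
  show "\<forall>\<^sub>F r in sequentially. norm (L2norm a b (f r) - L2norm a b g) \<le> norm (L2norm a b (\<lambda>x. f r x - g x)) * 1"
    using L2norm_reverse_triangle[OF assms(2,3)] by simp
qed

text \<open>
  Expand the product around the limits and apply the Cauchy-Schwarz inequality to each of the three
  error terms.
\<close>

lemma tendsto_integral_mult_L2:
  assumes f: "((\<lambda>r. L2norm a b (\<lambda>x. f r x - f0 x)) \<longlongrightarrow> 0) net"
    and g: "((\<lambda>r. L2norm a b (\<lambda>x. g r x - g0 x)) \<longlongrightarrow> 0) net"
    and L2: "\<forall>\<^sub>F r in net. f r \<in> L2 a b" "\<forall>\<^sub>F r in net. g r \<in> L2 a b" "f0 \<in> L2 a b" "g0 \<in> L2 a b"
  shows "((\<lambda>r. LINT x|dx a b. f r x * g r x) \<longlongrightarrow> (LINT x|dx a b. f0 x * g0 x)) net"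
proof (rule Lim_null[THEN iffD2], rule tendsto_0_le[where K=1])
  let ?df = "\<lambda>r x. f r x - f0 x" and ?dg = "\<lambda>r x. g r x - g0 x"
  let ?e = "\<lambda>r. L2norm a b (?df r) * L2norm a b (?dg r) + L2norm a b (?df r) * L2norm a b g0
             + L2norm a b f0 * L2norm a b (?dg r)"
  have "(?e \<longlongrightarrow> 0 * 0 + 0 * L2norm a b g0 + L2norm a b f0 * 0) net"
    by (intro tendsto_intros f g)
  then show "(?e \<longlongrightarrow> 0) net" by simp
  show "\<forall>\<^sub>F r in net. norm ((LINT x|dx a b. f r x * g r x) - (LINT x|dx a b. f0 x * g0 x)) \<le> norm (?e r) * 1"
    using L2(1,2)
  proof eventually_elim
    case (elim r)
    note D = L2_diff[OF elim(1) L2(3)] L2_diff[OF elim(2) L2(4)]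
    have eq: "f r x * g r x = ?df r x * ?dg r x + ?df r x * g0 x + f0 x * ?dg r x + f0 x * g0 x" for x
      by (simp add: algebra_simps)
    have "(LINT x|dx a b. f r x * g r x) = (LINT x|dx a b. ?df r x * ?dg r x) +
       (LINT x|dx a b. ?df r x * g0 x) + (LINT x|dx a b. f0 x * ?dg r x) + (LINT x|dx a b. f0 x * g0 x)"
      unfolding eq using L2_mult_integrable[OF D] L2_mult_integrable[OF D(1) L2(4)]
        L2_mult_integrable[OF L2(3) D(2)] L2_mult_integrable[OF L2(3,4)] by simp
    then have "norm ((LINT x|dx a b. f r x * g r x) - (LINT x|dx a b. f0 x * g0 x)) =
       norm ((LINT x|dx a b. ?df r x * ?dg r x) +
       (LINT x|dx a b. ?df r x * g0 x) + (LINT x|dx a b. f0 x * ?dg r x))"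
      by simp
    also have "\<dots> \<le> ?e r"
      by (intro order_trans[OF norm_triangle_ineq] add_mono norm_integral_mult_le_L2norm D L2)
    also have "\<dots> \<le> norm (?e r) * 1" by simp
    finally show ?case .
  qed
qed

section \<open>Completeness of the space of square-integrable functions\<close>

text \<open>
  Riesz-Fischer. Along a subsequence whose successive distances are bounded by \<open>2\<^sup>-\<^sup>n\<close> the increments
  are summable almost everywhere, because the interval has finite length and so the mean-square norm
  controls the integral of the modulus. Fatou's lemma turns pointwise into mean-square convergence.
\<close>

lemma L2_complete:
  assumes f: "\<And>n. f n \<in> L2 a b"
    and Cauchy: "\<And>e. 0 < e \<Longrightarrow> \<exists>N. \<forall>m\<ge>N. \<forall>n\<ge>N. L2norm a b (\<lambda>x. f m x - f n x) < e"
  obtains g where "g \<in> L2 a b" "(\<lambda>n. L2norm a b (\<lambda>x. f n x - g x)) \<longlonglongrightarrow> 0"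
proof -
  have "\<forall>n. \<exists>N. \<forall>p\<ge>N. \<forall>q\<ge>N. L2norm a b (\<lambda>x. f p x - f q x) < (1/2) ^ n"
    by (auto intro: Cauchy)
  then obtain N where N: "\<And>n p q. N n \<le> p \<Longrightarrow> N n \<le> q \<Longrightarrow> L2norm a b (\<lambda>x. f p x - f q x) < (1/2) ^ n"
    by metis
  \<comment> \<open>A summatory index sequence dominates \<open>N\<close> and is monotone, and \<open>n\<close> is added to make it unbounded.\<close>
  define r where "r n = (\<Sum>i\<le>n. N i) + n" for n
  have rN: "N n \<le> r n" "N n \<le> r (Suc n)" "n \<le> r n" for n
    using member_le_sum[of n "{..n}" N] by (auto simp: r_def)
  define h where "h n = f (r n)" for n
  have h: "h n \<in> L2 a b" for n by (simp add: h_def f)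
  have hm: "h n \<in> borel_measurable (dx a b)" for n by (rule L2_measurable[OF h])
  define u where "u n x = cmod (h (Suc n) x - h n x)" for n x
  define K where "K = L2norm a b (\<lambda>x. 1)"
  have um: "u n \<in> borel_measurable (dx a b)" for n
    unfolding u_def by (rule measurable_compose[OF borel_measurable_diff[OF hm hm] borel_measurable_norm])
  have ui: "integrable (dx a b) (u n)" for n
    unfolding u_def by (intro integrable_norm L2_integrable L2_diff h)
  have u_le: "(LINT x|dx a b. u n x) \<le> (1/2) ^ n * K" for n
  proof -
    have "(LINT x|dx a b. u n x) \<le> L2norm a b (\<lambda>x. h (Suc n) x - h n x) * K"
      using integral_mult_norm_le_L2norm[OF L2_diff[OF h h] L2_const[of 1], of "Suc n" n] by (simp add: u_def K_def)
    also have "\<dots> \<le> (1/2) ^ n * K"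
      unfolding h_def by (rule mult_right_mono[OF less_imp_le[OF N[OF rN(2) rN(1)]]]) (simp add: K_def)
    finally show ?thesis .
  qed
  have "(\<integral>\<^sup>+ x. (\<Sum>n. ennreal (u n x)) \<partial>dx a b) = (\<Sum>n. \<integral>\<^sup>+ x. ennreal (u n x) \<partial>dx a b)"
    by (rule nn_integral_suminf) (use um in auto)
  also have "\<dots> = (\<Sum>n. ennreal (LINT x|dx a b. u n x))"
    by (intro suminf_cong nn_integral_eq_integral ui) (simp add: u_def)
  also have "\<dots> \<le> (\<Sum>n. ennreal ((1/2) ^ n * K))"
    by (intro suminf_le ennreal_leI u_le) auto
  also have "\<dots> < \<infinity>"
  proof -
    have "summable (\<lambda>n. (1/2) ^ n * K :: real)" by (intro summable_mult2 summable_geometric) simp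
    then show ?thesis by (subst suminf_ennreal2) (auto simp: K_def)
  qed
  finally have "(\<integral>\<^sup>+ x. (\<Sum>n. ennreal (u n x)) \<partial>dx a b) \<noteq> \<infinity>" by simp
  then have "AE x in dx a b. (\<Sum>n. ennreal (u n x)) \<noteq> \<infinity>"
    by (intro nn_integral_PInf_AE) (use um in auto)
  then have conv: "AE x in dx a b. convergent (\<lambda>n. h n x)"
  proof eventually_elim
    case (elim x)
    then have "summable (\<lambda>n. u n x)"
      by (intro summable_suminf_not_top) (auto simp: u_def)
    then have "summable (\<lambda>n. h (Suc n) x - h n x)"
      unfolding u_def by (rule summable_norm_cancel)
    then have "convergent (\<lambda>n. \<Sum>i<n. h (Suc i) x - h i x)"
      by (simp add: summable_iff_convergent)
    then have "convergent (\<lambda>n. h n x - h 0 x)"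
      using sum_lessThan_telescope[of "\<lambda>n. h n x"] by simp
    then have "convergent (\<lambda>n. (h n x - h 0 x) + h 0 x)"
      by (intro convergent_add convergent_const)
    then show ?case by simp
  qed
  define g where "g x = lim (\<lambda>n. h n x)" for x
  have gm: "g \<in> borel_measurable (dx a b)"
    unfolding g_def by (rule borel_measurable_lim_metric) (rule hm)
  have lim: "AE x in dx a b. (\<lambda>n. h n x) \<longlonglongrightarrow> g x"
    using conv by eventually_elim (simp add: g_def convergent_LIMSEQ_iff)
  have key: "(\<integral>\<^sup>+ x. ennreal ((cmod (f k x - g x))\<^sup>2) \<partial>dx a b) \<le> ennreal (e\<^sup>2)"
    if e: "0 < e" and M: "\<forall>m\<ge>M. \<forall>n\<ge>M. L2norm a b (\<lambda>x. f m x - f n x) < e" and k: "M \<le> k" for e M k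
  proof -
    have "(\<integral>\<^sup>+ x. ennreal ((cmod (f k x - g x))\<^sup>2) \<partial>dx a b) =
        (\<integral>\<^sup>+ x. liminf (\<lambda>n. ennreal ((cmod (f k x - h n x))\<^sup>2)) \<partial>dx a b)"
    proof (rule nn_integral_cong_AE)
      show "AE x in dx a b. ennreal ((cmod (f k x - g x))\<^sup>2) = liminf (\<lambda>n. ennreal ((cmod (f k x - h n x))\<^sup>2))"
        using lim
      proof eventually_elim
        case (elim x)
        have "(\<lambda>n. ennreal ((cmod (f k x - h n x))\<^sup>2)) \<longlonglongrightarrow> ennreal ((cmod (f k x - g x))\<^sup>2)"
          by (intro tendsto_ennrealI tendsto_intros elim)
        then show ?case using lim_imp_Liminf[OF sequentially_bot] by metis
      qed
    qed
    also have "\<dots> \<le> liminf (\<lambda>n. \<integral>\<^sup>+ x. ennreal ((cmod (f k x - h n x))\<^sup>2) \<partial>dx a b)"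
      by (rule nn_integral_liminf) (use hm L2_measurable[OF f] in auto)
    also have "\<dots> \<le> ennreal (e\<^sup>2)"
    proof (rule Liminf_le)
      have "(\<integral>\<^sup>+ x. ennreal ((cmod (f k x - h n x))\<^sup>2) \<partial>dx a b) \<le> ennreal (e\<^sup>2)" if "M \<le> n" for n
      proof -
        have "(\<integral>\<^sup>+ x. ennreal ((cmod (f k x - h n x))\<^sup>2) \<partial>dx a b) = ennreal ((L2norm a b (\<lambda>x. f k x - h n x))\<^sup>2)"
          unfolding L2norm_power2 by (intro nn_integral_eq_integral L2_square_integrable L2_diff f h) simp
        also have "\<dots> \<le> ennreal (e\<^sup>2)"
          using M k that rN(3)[of n] e unfolding h_def
          by (intro ennreal_leI power_mono less_imp_le[of "L2norm a b _"]) auto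
        finally show ?thesis .
      qed
      then show "\<forall>\<^sub>F n in sequentially. (\<integral>\<^sup>+ x. ennreal ((cmod (f k x - h n x))\<^sup>2) \<partial>dx a b) \<le> ennreal (e\<^sup>2)"
        by (auto simp: eventually_sequentially)
    qed simp
    finally show ?thesis .
  qed
  have L2: "(\<lambda>x. f k x - g x) \<in> L2 a b \<and> L2norm a b (\<lambda>x. f k x - g x) \<le> e"
    if e: "0 < e" and M: "\<forall>m\<ge>M. \<forall>n\<ge>M. L2norm a b (\<lambda>x. f m x - f n x) < e" and k: "M \<le> k" for e M k
  proof -
    have m: "(\<lambda>x. f k x - g x) \<in> borel_measurable (dx a b)"
      by (intro borel_measurable_diff L2_measurable f gm)
    have i: "integrable (dx a b) (\<lambda>x. (cmod (f k x - g x))\<^sup>2)"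
    proof (rule integrableI_bounded)
      show "(\<lambda>x. (cmod (f k x - g x))\<^sup>2) \<in> borel_measurable (dx a b)" using m by auto
      have "ennreal (norm ((cmod (f k x - g x))\<^sup>2)) = ennreal ((cmod (f k x - g x))\<^sup>2)" for x by simp
      then show "(\<integral>\<^sup>+ x. ennreal (norm ((cmod (f k x - g x))\<^sup>2)) \<partial>dx a b) < \<infinity>"
        using le_less_trans[OF key[OF that] ennreal_less_top] by simp
    qed
    have "ennreal (LINT x|dx a b. (cmod (f k x - g x))\<^sup>2) \<le> ennreal (e\<^sup>2)"
      using key[OF that] nn_integral_eq_integral[OF i] by simp
    then have "(L2norm a b (\<lambda>x. f k x - g x))\<^sup>2 \<le> e\<^sup>2"
      unfolding L2norm_power2 by simp
    then have "L2norm a b (\<lambda>x. f k x - g x) \<le> e"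
      by (rule power2_le_imp_le) (use e in simp)
    then show ?thesis using m i by (simp add: L2_def)
  qed
  show ?thesis
  proof (rule that)
    obtain M where "\<forall>m\<ge>M. \<forall>n\<ge>M. L2norm a b (\<lambda>x. f m x - f n x) < 1" using Cauchy[of 1] by auto
    then have "(\<lambda>x. f M x - g x) \<in> L2 a b" using L2[of 1 M M] by auto
    then have "(\<lambda>x. f M x - (f M x - g x)) \<in> L2 a b" by (rule L2_diff[OF f])
    also have "(\<lambda>x. f M x - (f M x - g x)) = g" by (rule ext) simp
    finally show "g \<in> L2 a b" .
    show "(\<lambda>n. L2norm a b (\<lambda>x. f n x - g x)) \<longlonglongrightarrow> 0"
    proof (rule LIMSEQ_I)
      fix e :: real assume "0 < e"
      then obtain M where "\<forall>m\<ge>M. \<forall>n\<ge>M. L2norm a b (\<lambda>x. f m x - f n x) < e/2" using Cauchy[of "e/2"] by auto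
      then have "L2norm a b (\<lambda>x. f n x - g x) \<le> e/2" if "M \<le> n" for n
        using L2[of "e/2" M n] \<open>0 < e\<close> that by auto
      then have "norm (L2norm a b (\<lambda>x. f n x - g x) - 0) < e" if "M \<le> n" for n
        using \<open>0 < e\<close> that by fastforce
      then show "\<exists>no. \<forall>n\<ge>no. norm (L2norm a b (\<lambda>x. f n x - g x) - 0) < e"
        by blast
    qed
  qed
qed

section \<open>Weak derivatives\<close>

lemma test_function_derivative:
  assumes "\<phi> \<in> test_functions a b"
  shows "(\<lambda>x. vector_derivative \<phi> (at x)) \<in> test_functions a b"
    and "(\<phi> has_vector_derivative vector_derivative \<phi> (at x)) (at x)"
proof -
  obtain g where g: "smooth_fun g" "\<And>x. (\<phi> has_vector_derivative g x) (at x)"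
    using assms smooth_fun_has_derivative unfolding test_functions_def by blast
  have eq: "(\<lambda>x. vector_derivative \<phi> (at x)) = g"
    using g(2) by (auto intro: vector_derivative_at)
  obtain c d where cd: "a < c" "c \<le> d" "d < b" "\<And>x. x \<notin> {c..d} \<Longrightarrow> \<phi> x = 0"
    using assms unfolding test_functions_def by blast
  have "g x = 0" if "x \<notin> {c..d}" for x
  proof -
    have "((\<lambda>x. 0) has_vector_derivative g x) (at x)"
      by (rule has_vector_derivative_transform_within_open[OF g(2), of "- {c..d}"]) (use that cd(4) in auto)
    then show ?thesis using vector_derivative_unique_at[OF _ has_vector_derivative_const] by blast
  qed
  then show "(\<lambda>x. vector_derivative \<phi> (at x)) \<in> test_functions a b"
    unfolding eq test_functions_def using g(1) cd by blast
  show "(\<phi> has_vector_derivative vector_derivative \<phi> (at x)) (at x)"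
    using g(2) eq by metis
qed

lemma test_function_continuous: "\<phi> \<in> test_functions a b \<Longrightarrow> continuous_on A \<phi>"
  by (simp add: test_functions_def smooth_fun_continuous)

lemma test_function_vanishes:
  assumes "\<phi> \<in> test_functions a b"
  shows "\<phi> a = 0" "\<phi> b = 0"
  using assms by (auto simp: test_functions_def)

lemma test_function_L2: "\<phi> \<in> test_functions a b \<Longrightarrow> \<phi> \<in> L2 a' b'"
  by (intro L2_continuous test_function_continuous)

lemma test_function_primitive:
  assumes "\<phi> \<in> test_functions a b" "a \<le> b"
  shows "primitive a b \<phi> (\<lambda>x. vector_derivative \<phi> (at x))"
  by (rule primitive_C1[OF assms(2) has_vector_derivative_at_within[OF test_function_derivative(2)[OF assms(1)]]
        test_function_continuous[OF test_function_derivative(1)[OF assms(1)]]])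

lemma has_weak_deriv_primitive:
  assumes F: "primitive a b F f" and f: "f \<in> L2 a b" and ab: "a \<le> b"
  shows "has_weak_deriv a b F f"
  unfolding has_weak_deriv_def
proof (intro conjI ballI f L2_continuous primitive_continuous[OF F])
  fix \<phi> assume \<phi>: "\<phi> \<in> test_functions a b"
  let ?\<phi>' = "\<lambda>x. vector_derivative \<phi> (at x)"
  have "(LINT x|dx a b. f x * \<phi> x + F x * ?\<phi>' x) = 0"
    using primitive_FTC[OF primitive_mult[OF F test_function_primitive[OF \<phi> ab]] ab]
    by (simp add: test_function_vanishes[OF \<phi>])
  moreover have "integrable (dx a b) (\<lambda>x. f x * \<phi> x)"
    by (intro L2_mult_integrable f test_function_L2[OF \<phi>])
  moreover have "integrable (dx a b) (\<lambda>x. F x * ?\<phi>' x)"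
    by (intro L2_mult_integrable test_function_L2[OF test_function_derivative(1)[OF \<phi>]]
        L2_continuous primitive_continuous[OF F])
  ultimately show "(LINT x|dx a b. F x * ?\<phi>' x) = - (LINT x|dx a b. f x * \<phi> x)"
    by (simp add: add_eq_0_iff)
qed

lemma has_weak_deriv_diff:
  assumes "has_weak_deriv a b f f'" "has_weak_deriv a b g g'"
  shows "has_weak_deriv a b (\<lambda>x. f x - g x) (\<lambda>x. f' x - g' x)"
  unfolding has_weak_deriv_def
proof (intro conjI ballI)
  note L = assms[unfolded has_weak_deriv_def]
  show "(\<lambda>x. f x - g x) \<in> L2 a b" "(\<lambda>x. f' x - g' x) \<in> L2 a b"
    using L by (auto intro: L2_diff)
  fix \<phi> assume \<phi>: "\<phi> \<in> test_functions a b"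
  let ?\<phi>' = "\<lambda>x. vector_derivative \<phi> (at x)"
  note \<phi>' = test_function_L2[OF test_function_derivative(1)[OF \<phi>]]
  have "(LINT x|dx a b. (f x - g x) * ?\<phi>' x) = (LINT x|dx a b. f x * ?\<phi>' x) - (LINT x|dx a b. g x * ?\<phi>' x)"
    unfolding left_diff_distrib
    by (intro Bochner_Integration.integral_diff L2_mult_integrable \<phi>') (use L in auto)
  moreover have "(LINT x|dx a b. (f' x - g' x) * \<phi> x) = (LINT x|dx a b. f' x * \<phi> x) - (LINT x|dx a b. g' x * \<phi> x)"
    unfolding left_diff_distrib
    by (intro Bochner_Integration.integral_diff L2_mult_integrable test_function_L2[OF \<phi>]) (use L in auto)
  ultimately show "(LINT x|dx a b. (f x - g x) * ?\<phi>' x) = - (LINT x|dx a b. (f' x - g' x) * \<phi> x)"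
    using L \<phi> by simp
qed

lemma has_weak_deriv_cong_AE:
  assumes "has_weak_deriv a b f f'" "AE x in dx a b. f x = g x" "g \<in> L2 a b"
    "AE x in dx a b. f' x = g' x" "g' \<in> L2 a b"
  shows "has_weak_deriv a b g g'"
  unfolding has_weak_deriv_def
proof (intro conjI ballI assms)
  note L = assms(1)[unfolded has_weak_deriv_def]
  fix \<phi> assume \<phi>: "\<phi> \<in> test_functions a b"
  let ?\<phi>' = "\<lambda>x. vector_derivative \<phi> (at x)"
  have \<phi>': "?\<phi>' \<in> borel_measurable (dx a b)" "\<phi> \<in> borel_measurable (dx a b)"
    using test_function_L2[OF test_function_derivative(1)[OF \<phi>]] test_function_L2[OF \<phi>]
    by (auto intro: L2_measurable)
  have m: "f \<in> borel_measurable (dx a b)" "f' \<in> borel_measurable (dx a b)"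
    "g \<in> borel_measurable (dx a b)" "g' \<in> borel_measurable (dx a b)"
    using L assms by (auto intro: L2_measurable)
  have "(LINT x|dx a b. g x * ?\<phi>' x) = (LINT x|dx a b. f x * ?\<phi>' x)"
    by (rule integral_cong_AE)
       (use assms m \<phi>' in auto)
  moreover have "(LINT x|dx a b. g' x * \<phi> x) = (LINT x|dx a b. f' x * \<phi> x)"
    by (rule integral_cong_AE)
       (use assms m \<phi>' in auto)
  ultimately show "(LINT x|dx a b. g x * ?\<phi>' x) = - (LINT x|dx a b. g' x * \<phi> x)"
    using L \<phi> by simp
qed

lemma has_weak_deriv_unique:
  assumes ab: "a < b" and f: "has_weak_deriv a b f f'" and g: "has_weak_deriv a b g g'"
    and eq: "AE x in dx a b. f x = g x"
  shows "AE x in dx a b. f' x = g' x"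
proof -
  note L = f[unfolded has_weak_deriv_def] g[unfolded has_weak_deriv_def]
  have "has_weak_deriv a b g f'"
    by (rule has_weak_deriv_cong_AE[OF f eq]) (use L in auto)
  then have d: "has_weak_deriv a b (\<lambda>x. g x - g x) (\<lambda>x. f' x - g' x)"
    by (rule has_weak_deriv_diff) (rule g)
  have "AE x in dx a b. f' x - g' x = 0"
  proof (rule AE_zero_of_integrals_against_test_functions_zero[OF ab])
    show "integrable (dx a b) (\<lambda>x. f' x - g' x)"
      using d by (intro L2_integrable) (auto simp: has_weak_deriv_def)
    show "(LINT x|dx a b. (f' x - g' x) * \<phi> x) = 0" if "\<phi> \<in> test_functions a b" for \<phi>
      using d that by (simp add: has_weak_deriv_def)
  qed
  then show ?thesis by eventually_elim simp
qed

text \<open>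
  Fix a test function \<open>\<xi>\<close> of integral 1. For any test function \<open>\<phi>\<close> with integral \<open>m\<close>, the difference
  \<open>\<phi> - m \<xi>\<close> has integral 0 and is therefore the derivative of a test function. So \<open>h\<close> integrates to 0
  against it, which means that \<open>h\<close> minus the constant \<open>c = \<integral> h \<xi>\<close> integrates to 0 against \<open>\<phi>\<close>.
\<close>

lemma has_weak_deriv_zero_imp_const:
  assumes ab: "a < b" and h: "has_weak_deriv a b h (\<lambda>x. 0)"
  shows "\<exists>c. AE x in dx a b. h x = c"
proof -
  \<comment> \<open>Otherwise the constant 1 would vanish almost everywhere, by the fundamental lemma itself.\<close>
  have "\<exists>\<rho>\<in>test_functions a b. (LINT x|dx a b. \<rho> x) \<noteq> 0"
  proof (rule ccontr)
    assume "\<not> ?thesis"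
    then have "AE x in dx a b. (1::complex) = 0"
      by (intro AE_zero_of_integrals_against_test_functions_zero[OF ab] L2_integrable L2_const) auto
    then have "AE x in lebesgue. x \<notin> {a<..<b}"
      by (subst (asm) AE_restrict_space_iff) auto
    then have "negligible {a<..<b}"
      by (auto simp only: eventually_ae_filter_negligible intro: negligible_subset)
    then show False using ab open_not_negligible[of "{a<..<b}"] by auto
  qed
  then obtain \<rho> where \<rho>: "\<rho> \<in> test_functions a b" and \<rho>0: "(LINT x|dx a b. \<rho> x) \<noteq> 0"
    by blast
  define \<xi> where "\<xi> = (\<lambda>x. \<rho> x / (LINT x|dx a b. \<rho> x))"
  have \<xi>1: "(LINT x|dx a b. \<xi> x) = 1" using \<rho>0 by (simp add: \<xi>_def)
  have \<xi>: "\<xi> \<in> test_functions a b"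
    using \<rho> smooth_fun_mult[OF smooth_fun_const[of "1 / (LINT x|dx a b. \<rho> x)"], of \<rho>]
    by (auto simp: test_functions_def \<xi>_def)
  have hL: "h \<in> L2 a b" using h by (simp add: has_weak_deriv_def)
  define c where "c = (LINT x|dx a b. h x * \<xi> x)"
  have "AE x in dx a b. h x - c = 0"
  proof (rule AE_zero_of_integrals_against_test_functions_zero[OF ab])
    show "integrable (dx a b) (\<lambda>x. h x - c)"
      by (intro L2_integrable L2_diff hL L2_const)
    fix \<phi> assume \<phi>: "\<phi> \<in> test_functions a b"
    define m where "m = (LINT x|dx a b. \<phi> x)"
    define \<theta> where "\<theta> x = \<phi> x - m * \<xi> x" for x
    have \<theta>_smooth: "smooth_fun \<theta>"
      using smooth_fun_add[of \<phi> "\<lambda>x. - m * \<xi> x"] smooth_fun_mult[OF smooth_fun_const[of "-m"], of \<xi>] \<phi> \<xi>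
      by (simp add: test_functions_def \<theta>_def[abs_def])
    have \<theta>_int: "(LINT x|dx a b. \<theta> x) = 0"
      using L2_integrable[OF test_function_L2[OF \<phi>]] L2_integrable[OF test_function_L2[OF \<xi>]]
      by (simp add: \<theta>_def m_def \<xi>1)
    obtain p q where pq: "a < p" "p \<le> q" "q < b" "\<And>x. x \<notin> {p..q} \<Longrightarrow> \<theta> x = 0"
    proof -
      obtain p q where 1: "a < p" "p \<le> q" "q < b" "\<And>x. x \<notin> {p..q} \<Longrightarrow> \<phi> x = 0"
        using \<phi> unfolding test_functions_def by blast
      obtain p' q' where 2: "a < p'" "p' \<le> q'" "q' < b" "\<And>x. x \<notin> {p'..q'} \<Longrightarrow> \<xi> x = 0"
        using \<xi> unfolding test_functions_def by blast
      show ?thesis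
      proof (rule that[of "min p p'" "max q q'"])
        fix x assume "x \<notin> {min p p'..max q q'}"
        then have "x \<notin> {p..q}" "x \<notin> {p'..q'}" by auto
        then show "\<theta> x = 0" by (simp add: \<theta>_def 1(4) 2(4))
      qed (use 1 2 in auto)
    qed
    define \<Theta> where "\<Theta> x = integral {p - 1..x} \<theta>" for x
    have \<Theta>_left: "\<Theta> x = 0" if "x < p" for x
    proof -
      have "\<Theta> x = integral {p - 1..x} (\<lambda>x. 0)"
        unfolding \<Theta>_def by (rule Henstock_Kurzweil_Integration.integral_cong) (use that pq(4) in auto)
      then show ?thesis by simp
    qed
    have \<Theta>_der: "(\<Theta> has_vector_derivative \<theta> x) (at x)" for x
    proof (cases "x < p")
      case True
      have "((\<lambda>x. 0) has_vector_derivative \<theta> x) (at x)"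
        using pq(4)[of x] True by simp
      then show ?thesis
        by (rule has_vector_derivative_transform_within_open[where S="{..<p}"]) (use True \<Theta>_left in auto)
    next
      case False
      have "(\<Theta> has_vector_derivative \<theta> x) (at x within {p - 1..x + 1})"
        unfolding \<Theta>_def
        by (rule integral_has_vector_derivative[OF smooth_fun_continuous[OF \<theta>_smooth]]) (use False in auto)
      then show ?thesis
        by (subst (asm) at_within_interior) (use False in auto)
    qed
    have \<Theta>a: "\<Theta> a = 0" using \<Theta>_left pq(1) by simp
    have prim: "primitive a b \<Theta> \<theta>"
      using ab \<Theta>_der smooth_fun_continuous[OF \<theta>_smooth]
      by (intro primitive_C1) (auto intro: has_vector_derivative_at_within)
    have \<Theta>b: "\<Theta> b = 0"
      using primitive_FTC[OF prim] ab \<theta>_int \<Theta>a by simp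
    have "\<Theta> x = 0" if "x \<notin> {p..q}" for x
    proof (cases "x < p")
      case False
      obtain c where "\<And>z. z \<in> {q<..} \<Longrightarrow> \<Theta> z = c"
      proof (rule has_vector_derivative_zero_constant[of "{q<..}" \<Theta>])
        show "(\<Theta> has_vector_derivative 0) (at z within {q<..})" if "z \<in> {q<..}" for z
          using has_vector_derivative_at_within[OF \<Theta>_der[of z]] pq(4)[of z] that by auto
      qed auto
      moreover have "q < x" using False that by auto
      ultimately show ?thesis using \<Theta>b pq(3) by simp
    qed (rule \<Theta>_left)
    then have "\<Theta> \<in> test_functions a b"
      using smooth_fun_primitive[OF \<theta>_smooth \<Theta>_der] pq by (auto simp: test_functions_def)
    moreover have "vector_derivative \<Theta> (at x) = \<theta> x" for x
      by (rule vector_derivative_at[OF \<Theta>_der])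
    ultimately have z: "(LINT x|dx a b. h x * \<theta> x) = 0"
      using h by (auto simp: has_weak_deriv_def)
    have "(LINT x|dx a b. h x * \<theta> x) = (LINT x|dx a b. h x * \<phi> x - m * (h x * \<xi> x))"
      by (simp add: \<theta>_def algebra_simps)
    also have "\<dots> = (LINT x|dx a b. h x * \<phi> x) - m * c"
      using L2_mult_integrable[OF hL test_function_L2[OF \<phi>]] L2_mult_integrable[OF hL test_function_L2[OF \<xi>]]
      by (simp add: c_def)
    finally have "(LINT x|dx a b. h x * \<phi> x) = m * c" using z by simp
    then show "(LINT x|dx a b. (h x - c) * \<phi> x) = 0"
      using L2_mult_integrable[OF hL test_function_L2[OF \<phi>]] L2_integrable[OF test_function_L2[OF \<phi>]]
      by (simp add: left_diff_distrib m_def)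
  qed
  then show ?thesis by (intro exI[of _ c]) auto
qed

lemma primitive_of_integrable:
  assumes "integrable (dx a b) f"
  shows "primitive a b (\<lambda>x. c + (LINT y|dx a b. indicator {..x} y * f y)) f"
  unfolding primitive_def using assms by (simp only: integral_indicator_atMost_left) simp

text \<open>
  Du Bois-Reymond's lemma: subtracting an indefinite integral of the weak derivative leaves a function
  with vanishing weak derivative.
\<close>

lemma has_weak_deriv_imp_primitive:
  assumes ab: "a < b" and f: "has_weak_deriv a b f f'"
  obtains F where "primitive a b F f'" "AE x in dx a b. f x = F x"
proof -
  define F where "F = (\<lambda>x. 0 + (LINT y|dx a b. indicator {..x} y * f' y))"
  have f': "f' \<in> L2 a b" using f by (simp add: has_weak_deriv_def)
  have F: "primitive a b F f'"
    unfolding F_def by (rule primitive_of_integrable) (rule L2_integrable[OF f'])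
  have "has_weak_deriv a b (\<lambda>x. f x - F x) (\<lambda>x. f' x - f' x)"
    using ab by (intro has_weak_deriv_diff f has_weak_deriv_primitive F f') simp
  then obtain c where c: "AE x in dx a b. f x - F x = c"
    using has_weak_deriv_zero_imp_const[OF ab] by auto
  show ?thesis
  proof (rule that)
    show "primitive a b (\<lambda>x. c + F x) f'"
      using primitive_add[OF primitive_const F, of c] by simp
    show "AE x in dx a b. f x = c + F x"
      using c by eventually_elim (simp add: algebra_simps)
  qed
qed

lemma wderiv_has_weak_deriv: "has_weak_deriv a b f g \<Longrightarrow> has_weak_deriv a b f (wderiv a b f)"
  unfolding wderiv_def by (rule someI[of "has_weak_deriv a b f"])

lemma wderiv_AE_eq:
  assumes "a < b" "has_weak_deriv a b f g"
  shows "AE x in dx a b. wderiv a b f x = g x"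
  by (rule has_weak_deriv_unique[OF assms(1) wderiv_has_weak_deriv[OF assms(2)] assms(2)]) simp

lemma continuous_AE_eq_imp_eq:
  fixes f g :: "real \<Rightarrow> complex"
  assumes ab: "a < b" and cont: "continuous_on {a..b} f" "continuous_on {a..b} g"
    and eq: "AE x in dx a b. f x = g x" and x: "x \<in> {a..b}"
  shows "f x = g x"
proof -
  let ?S = "{x \<in> {a<..<b}. f x - g x \<in> - {0}}"
  have c: "continuous_on {a..b} (\<lambda>x. f x - g x)" by (intro continuous_intros cont)
  have c': "continuous_on {a<..<b} (\<lambda>x. f x - g x)"
    by (rule continuous_on_subset[OF c]) auto
  have "open ({a<..<b} \<inter> (\<lambda>x. f x - g x) -` (- {0}))"
    by (rule continuous_open_preimage[OF c']) (simp_all add: open_Compl)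
  also have "{a<..<b} \<inter> (\<lambda>x. f x - g x) -` (- {0}) = ?S" by blast
  finally have "open ?S" .
  moreover have "negligible ?S"
  proof -
    have "AE x in lebesgue. x \<in> {a<..<b} \<longrightarrow> f x = g x"
      using eq by (subst (asm) AE_restrict_space_iff) auto
    then have "\<exists>N. negligible N \<and> {x. \<not> (x \<in> {a<..<b} \<longrightarrow> f x = g x)} \<subseteq> N"
      by (simp only: eventually_ae_filter_negligible)
    then obtain N where N: "negligible N" "{x. \<not> (x \<in> {a<..<b} \<longrightarrow> f x = g x)} \<subseteq> N"
      by (elim exE conjE)
    have "?S \<subseteq> N" using N(2) by force
    then show ?thesis by (rule negligible_subset[OF N(1)])
  qed
  ultimately have "?S = {}" using open_not_negligible by blast
  then have z: "f y - g y = 0" if "y \<in> {a<..<b}" for y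
    using that by blast
  have "f x - g x = 0"
    by (rule continuous_constant_on_closure[of "{a<..<b}" "\<lambda>x. f x - g x"])
       (use ab x c z in simp_all)
  then show ?thesis by simp
qed

lemma cont_value_eq:
  assumes "a < b" "continuous_on {a..b} h" "AE x in dx a b. f x = h x" "x \<in> {a..b}"
  shows "cont_value a b f x = h x"
proof -
  let ?k = "SOME h. continuous_on {a..b} h \<and> L2_eq a b h f"
  have h: "continuous_on {a..b} h \<and> L2_eq a b h f"
    using assms by (auto simp: L2_eq_def)
  have k: "continuous_on {a..b} ?k \<and> L2_eq a b ?k f"
    by (rule someI[of _ h], rule h)
  have "AE x in dx a b. ?k x = h x"
    using conjunct2[OF k] assms(3) unfolding L2_eq_def by eventually_elim simp
  then have "?k x = h x"
    using assms(1,2,4) k by (intro continuous_AE_eq_imp_eq[of a b]) auto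
  then show ?thesis by (simp add: cont_value_def)
qed

section \<open>Sobolev spaces on the unit interval\<close>

lemma H1_has_weak_deriv: "f \<in> H1 a b \<Longrightarrow> has_weak_deriv a b f (wderiv a b f)"
  by (auto simp: H1_def intro: wderiv_has_weak_deriv)

lemma has_weak_deriv_L2:
  assumes "has_weak_deriv a b f g" shows "f \<in> L2 a b" "g \<in> L2 a b"
  using assms by (auto simp: has_weak_deriv_def)

lemma L2norm_wderiv:
  assumes "a < b" "has_weak_deriv a b f g"
  shows "L2norm a b (wderiv a b f) = L2norm a b g"
  using has_weak_deriv_L2[OF assms(2)] has_weak_deriv_L2[OF wderiv_has_weak_deriv[OF assms(2)]]
  by (intro L2norm_cong_AE wderiv_AE_eq[OF assms]) (auto intro: L2_measurable)

lemma primitive_diff_bound: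
  assumes D: "primitive 0 1 D d" and d: "d \<in> L2 0 1" and xy: "x \<in> {0..1}" "y \<in> {0..1}"
  shows "cmod (D x - D y) \<le> L2norm 0 1 d"
proof -
  have i: "integrable (dx 0 1) (\<lambda>z. indicator {..x} z * d z)" "integrable (dx 0 1) (\<lambda>z. indicator {..y} z * d z)"
    by (auto intro!: integrable_dx_indicator primitive_integrable[OF D])
  have "D x - D y = (LINT z|dx 0 1. indicator {..x} z * d z) - (LINT z|dx 0 1. indicator {..y} z * d z)"
    using primitive_eq[OF D xy(1)] primitive_eq[OF D xy(2)] by simp
  also have "\<dots> = (LINT z|dx 0 1. indicator {..x} z * d z - indicator {..y} z * d z)"
    using i by simp
  finally have "cmod (D x - D y) \<le> (LINT z|dx 0 1. cmod (indicator {..x} z * d z - indicator {..y} z * d z))"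
    using integral_norm_bound by metis
  also have "\<dots> \<le> (LINT z|dx 0 1. cmod (d z) * cmod 1)"
    using i L2_integrable[OF d]
    by (intro integral_mono Bochner_Integration.integrable_norm Bochner_Integration.integrable_diff)
       (auto simp: indicator_def)
  also have "\<dots> \<le> L2norm 0 1 d * L2norm 0 1 (\<lambda>z. 1)"
    by (rule integral_mult_norm_le_L2norm[OF d L2_const])
  also have "L2norm 0 1 (\<lambda>z. 1) = 1"
    by (simp add: L2norm_def measure_restrict_space)
  finally show ?thesis by simp
qed

lemma integral_norm_le_L2norm:
  assumes "D \<in> L2 0 1"
  shows "(LINT y|dx 0 1. cmod (D y)) \<le> L2norm 0 1 D"
proof -
  have "L2norm 0 1 (\<lambda>z. 1) = 1"
    by (simp add: L2norm_def measure_restrict_space)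
  then show ?thesis
    using integral_mult_norm_le_L2norm[OF assms L2_const[of 1]] by simp
qed

text \<open>
  The continuous embedding of \<open>H\<^sup>1\<close> into the continuous functions: compare the value at \<open>x\<close> with the value at
  \<open>y\<close> and average over \<open>y\<close>.
\<close>

lemma primitive_trace_bound:
  assumes D: "primitive 0 1 D d" and d: "d \<in> L2 0 1" and x: "x \<in> {0..1}"
  shows "cmod (D x) \<le> L2norm 0 1 D + L2norm 0 1 d"
proof -
  interpret finite_measure "dx 0 1" by (rule finite_measure_dx)
  have DL: "D \<in> L2 0 1" by (intro L2_continuous primitive_continuous[OF D])
  have 1: "(LINT y|dx 0 1. c) = c" for c :: real
    by (simp add: measure_restrict_space)
  have "cmod (D x) = (LINT y|dx 0 1. cmod (D x))" by (rule 1[symmetric])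
  also have "\<dots> \<le> (LINT y|dx 0 1. cmod (D y) + L2norm 0 1 d)"
  proof (rule integral_mono)
    fix y assume "y \<in> space (dx 0 1)"
    then have "cmod (D x - D y) \<le> L2norm 0 1 d"
      by (intro primitive_diff_bound[OF D d x]) auto
    then show "cmod (D x) \<le> cmod (D y) + L2norm 0 1 d"
      using norm_triangle_sub[of "D x" "D y"] by simp
  qed (use L2_integrable[OF DL] in auto)
  also have "\<dots> = (LINT y|dx 0 1. cmod (D y)) + L2norm 0 1 d"
    using L2_integrable[OF DL] 1 by simp
  also have "\<dots> \<le> L2norm 0 1 D + L2norm 0 1 d"
    using integral_norm_le_L2norm[OF DL] by simp
  finally show ?thesis .
qed

lemma Poincare_zero_left:
  assumes F: "primitive 0 1 F f" and f: "f \<in> L2 0 1" and F0: "F 0 = 0"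
  shows "L2norm 0 1 F \<le> L2norm 0 1 f"
proof -
  have FL: "F \<in> L2 0 1" by (intro L2_continuous primitive_continuous[OF F])
  have "L2norm 0 1 F \<le> L2norm 0 1 f * L2norm 0 1 (\<lambda>z. 1)"
  proof (rule L2norm_dominated[OF L2_measurable[OF FL] L2_const])
    show "cmod (F x) \<le> L2norm 0 1 f * cmod 1" if "x \<in> {0<..<1}" for x
      using primitive_diff_bound[OF F f, of x 0] that F0 by simp
  qed auto
  also have "L2norm 0 1 (\<lambda>z. 1) = 1"
    by (simp add: L2norm_def measure_restrict_space)
  finally show ?thesis by simp
qed

lemma L2norm_le_H1norm:
  "L2norm a b f \<le> H1norm a b f" "L2norm a b (wderiv a b f) \<le> H1norm a b f"
  by (auto simp: H1norm_def intro!: real_le_rsqrt)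

lemma H1norm_tendsto_0:
  assumes "(\<lambda>n. L2norm a b (f n)) \<longlonglongrightarrow> 0" "(\<lambda>n. L2norm a b (wderiv a b (f n))) \<longlonglongrightarrow> 0"
  shows "(\<lambda>n. H1norm a b (f n)) \<longlonglongrightarrow> 0"
  unfolding H1norm_def
  using tendsto_real_sqrt[OF tendsto_add[OF tendsto_power[OF assms(1), of 2] tendsto_power[OF assms(2), of 2]]]
  by simp

lemma test_function_has_weak_deriv:
  assumes "\<phi> \<in> test_functions a b" "a \<le> b"
  shows "has_weak_deriv a b \<phi> (\<lambda>x. vector_derivative \<phi> (at x))"
  by (rule has_weak_deriv_primitive[OF test_function_primitive[OF assms]
        test_function_L2[OF test_function_derivative(1)[OF assms(1)]] assms(2)])

text \<open>
  Evaluation at an end point is continuous in the norm of \<open>H\<^sup>1\<close> and vanishes on test functions, hence it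
  vanishes on their closure.
\<close>

lemma H10_boundary_values:
  assumes f: "f \<in> H10 0 1" and F: "primitive 0 1 F g" and g: "g \<in> L2 0 1" and fF: "AE x in dx 0 1. f x = F x"
  shows "F 0 = 0" "F 1 = 0"
proof -
  have fL: "f \<in> L2 0 1" using f by (auto simp: H10_def H1_def has_weak_deriv_def)
  obtain \<phi> where \<phi>: "\<And>n. \<phi> n \<in> test_functions 0 1"
    and lim: "(\<lambda>n. H1norm 0 1 (\<lambda>x. \<phi> n x - f x)) \<longlonglongrightarrow> 0"
    using f by (auto simp: H10_def)
  have wF: "has_weak_deriv 0 1 F g" by (rule has_weak_deriv_primitive[OF F g]) simp
  have wf: "has_weak_deriv 0 1 f g"
    by (rule has_weak_deriv_cong_AE[OF wF]) (use fF fL g in auto)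
  have bound: "cmod (F x) \<le> 2 * H1norm 0 1 (\<lambda>x. \<phi> n x - f x)" if x: "x = 0 \<or> x = 1" for n x
  proof -
    let ?\<phi>' = "\<lambda>x. vector_derivative (\<phi> n) (at x)"
    have prim: "primitive 0 1 (\<lambda>x. \<phi> n x - F x) (\<lambda>x. ?\<phi>' x - g x)"
      by (intro primitive_diff test_function_primitive \<phi> F) simp
    have L: "(\<lambda>x. ?\<phi>' x - g x) \<in> L2 0 1"
      by (intro L2_diff g test_function_L2[OF test_function_derivative(1)[OF \<phi>]])
    have w: "has_weak_deriv 0 1 (\<lambda>x. \<phi> n x - f x) (\<lambda>x. ?\<phi>' x - g x)"
      by (intro has_weak_deriv_diff wf test_function_has_weak_deriv \<phi>) simp
    have "cmod (F x) = cmod (\<phi> n x - F x)"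
      using test_function_vanishes[OF \<phi>, of n] x by auto
    also have "\<dots> \<le> L2norm 0 1 (\<lambda>x. \<phi> n x - F x) + L2norm 0 1 (\<lambda>x. ?\<phi>' x - g x)"
      by (rule primitive_trace_bound[OF prim L]) (use x in auto)
    also have "L2norm 0 1 (\<lambda>x. \<phi> n x - F x) = L2norm 0 1 (\<lambda>x. \<phi> n x - f x)"
      using fF by (intro L2norm_cong_AE L2_measurable L2_diff test_function_L2[OF \<phi>] fL has_weak_deriv_L2(1)[OF wF]) auto
    also have "\<dots> \<le> H1norm 0 1 (\<lambda>x. \<phi> n x - f x)" by (rule L2norm_le_H1norm)
    also have "L2norm 0 1 (\<lambda>x. ?\<phi>' x - g x) \<le> H1norm 0 1 (\<lambda>x. \<phi> n x - f x)"
      using L2norm_wderiv[OF _ w] L2norm_le_H1norm(2)[of 0 1 "\<lambda>x. \<phi> n x - f x"] by simp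
    finally show ?thesis by simp
  qed
  have "cmod (F x) \<le> 0" if "x = 0 \<or> x = 1" for x
  proof (rule LIMSEQ_le_const)
    show "(\<lambda>n. 2 * H1norm 0 1 (\<lambda>x. \<phi> n x - f x)) \<longlonglongrightarrow> 0"
      using tendsto_mult_left[OF lim, of 2] by simp
  qed (use bound[OF that] in auto)
  then show "F 0 = 0" "F 1 = 0" by auto
qed

lemma test_functions_diff:
  assumes "\<phi> \<in> test_functions a b" "\<psi> \<in> test_functions a b"
  shows "(\<lambda>x. \<phi> x - \<psi> x) \<in> test_functions a b"
proof -
  have "smooth_fun (\<lambda>x. \<phi> x - \<psi> x)"
    using smooth_fun_add[of \<phi> "\<lambda>x. -1 * \<psi> x"] smooth_fun_mult[OF smooth_fun_const[of "-1"], of \<psi>] assms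
    by (simp add: test_functions_def)
  moreover obtain p q where 1: "a < p" "p \<le> q" "q < b" "\<And>x. x \<notin> {p..q} \<Longrightarrow> \<phi> x = 0"
    using assms(1) unfolding test_functions_def by blast
  moreover obtain p' q' where 2: "a < p'" "p' \<le> q'" "q' < b" "\<And>x. x \<notin> {p'..q'} \<Longrightarrow> \<psi> x = 0"
    using assms(2) unfolding test_functions_def by blast
  moreover have "\<phi> x - \<psi> x = 0" if "x \<notin> {min p p'..max q q'}" for x
  proof -
    have "x \<notin> {p..q}" "x \<notin> {p'..q'}" using that by auto
    then show ?thesis by (simp add: 1(4) 2(4))
  qed
  ultimately show ?thesis
    unfolding test_functions_def
    by (intro CollectI conjI exI[of _ "min p p'"] exI[of _ "max q q'"]) auto
qed

lemma H1_diff: "f \<in> H1 a b \<Longrightarrow> g \<in> H1 a b \<Longrightarrow> (\<lambda>x. f x - g x) \<in> H1 a b"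
  by (auto simp: H1_def intro: has_weak_deriv_diff)

lemma wderiv_diff:
  assumes "a < b" "f \<in> H1 a b" "g \<in> H1 a b"
  shows "AE x in dx a b. wderiv a b (\<lambda>x. f x - g x) x = wderiv a b f x - wderiv a b g x"
  by (rule wderiv_AE_eq[OF assms(1) has_weak_deriv_diff]) (auto intro: H1_has_weak_deriv assms)

lemma H1_L2: "f \<in> H1 a b \<Longrightarrow> f \<in> L2 a b" "f \<in> H1 a b \<Longrightarrow> wderiv a b f \<in> L2 a b"
  using has_weak_deriv_L2[OF H1_has_weak_deriv] by auto

lemma H1_cong_AE:
  assumes "f \<in> H1 a b" "AE x in dx a b. f x = g x" "g \<in> L2 a b"
  shows "g \<in> H1 a b"
  using has_weak_deriv_cong_AE[OF H1_has_weak_deriv[OF assms(1)] assms(2,3)] H1_L2(2)[OF assms(1)]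
  by (auto simp: H1_def)

lemma H2_diff:
  assumes ab: "a < b" and f: "f \<in> H2 a b" and g: "g \<in> H2 a b"
  shows "(\<lambda>x. f x - g x) \<in> H2 a b"
    and "AE x in dx a b. wderiv a b (wderiv a b (\<lambda>x. f x - g x)) x
           = wderiv a b (wderiv a b f) x - wderiv a b (wderiv a b g) x"
proof -
  have H: "f \<in> H1 a b" "g \<in> H1 a b" "wderiv a b f \<in> H1 a b" "wderiv a b g \<in> H1 a b"
    using f g by (auto simp: H2_def)
  have eq: "AE x in dx a b. wderiv a b f x - wderiv a b g x = wderiv a b (\<lambda>x. f x - g x) x"
    using wderiv_diff[OF ab H(1,2)] by eventually_elim simp
  have L: "wderiv a b (\<lambda>x. f x - g x) \<in> L2 a b"
    by (intro H1_L2 H1_diff H)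
  have "wderiv a b (\<lambda>x. f x - g x) \<in> H1 a b"
    by (rule H1_cong_AE[OF H1_diff[OF H(3,4)] eq L])
  then show "(\<lambda>x. f x - g x) \<in> H2 a b"
    using H1_diff[OF H(1,2)] by (simp add: H2_def)
  have "AE x in dx a b. wderiv a b (\<lambda>x. f x - g x) x = wderiv a b f x - wderiv a b g x"
    by (rule wderiv_diff[OF ab H(1,2)])
  from has_weak_deriv_unique[OF ab H1_has_weak_deriv[OF \<open>wderiv a b (\<lambda>x. f x - g x) \<in> H1 a b\<close>]
     has_weak_deriv_diff[OF H1_has_weak_deriv[OF H(3)] H1_has_weak_deriv[OF H(4)]] this]
  show "AE x in dx a b. wderiv a b (wderiv a b (\<lambda>x. f x - g x)) x
           = wderiv a b (wderiv a b f) x - wderiv a b (wderiv a b g) x" .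
qed

lemma H10_diff:
  assumes ab: "a < b" and f: "f \<in> H10 a b" and g: "g \<in> H10 a b"
  shows "(\<lambda>x. f x - g x) \<in> H10 a b"
proof -
  have H: "f \<in> H1 a b" "g \<in> H1 a b" using f g by (auto simp: H10_def)
  obtain \<phi> where \<phi>: "\<And>n. \<phi> n \<in> test_functions a b"
    and lim: "(\<lambda>n. H1norm a b (\<lambda>x. \<phi> n x - f x)) \<longlonglongrightarrow> 0"
    using f by (auto simp: H10_def)
  obtain \<psi> where \<psi>: "\<And>n. \<psi> n \<in> test_functions a b"
    and lim': "(\<lambda>n. H1norm a b (\<lambda>x. \<psi> n x - g x)) \<longlonglongrightarrow> 0"
    using g by (auto simp: H10_def)
  have T: "\<phi> n \<in> H1 a b" "\<psi> n \<in> H1 a b" for n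
    using test_function_has_weak_deriv[OF \<phi>] test_function_has_weak_deriv[OF \<psi>] ab by (auto simp: H1_def)
  let ?h = "\<lambda>n x. (\<phi> n x - \<psi> n x) - (f x - g x)"
  let ?H = "\<lambda>n. H1norm a b (\<lambda>x. \<phi> n x - f x) + H1norm a b (\<lambda>x. \<psi> n x - g x)"
  have H0: "?H \<longlonglongrightarrow> 0" using tendsto_add[OF lim lim'] by simp
  have b1: "L2norm a b (?h n) \<le> ?H n" for n
  proof -
    have "L2norm a b (\<lambda>x. (\<phi> n x - f x) + -1 * (\<psi> n x - g x)) \<le>
      L2norm a b (\<lambda>x. \<phi> n x - f x) + L2norm a b (\<lambda>x. -1 * (\<psi> n x - g x))"
      by (intro L2norm_triangle L2_cmult H1_L2 H1_diff T H)
    also have "(\<lambda>x. (\<phi> n x - f x) + -1 * (\<psi> n x - g x)) = ?h n" by auto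
    also have "L2norm a b (\<lambda>x. -1 * (\<psi> n x - g x)) = L2norm a b (\<lambda>x. \<psi> n x - g x)"
      by (subst L2norm_cmult) simp
    finally show ?thesis using L2norm_le_H1norm(1) by (smt (verit))
  qed
  have b2: "L2norm a b (wderiv a b (?h n)) \<le> ?H n" for n
  proof -
    let ?p = "wderiv a b (\<lambda>x. \<phi> n x - f x)" and ?q = "wderiv a b (\<lambda>x. \<psi> n x - g x)"
    have "has_weak_deriv a b (\<lambda>x. (\<phi> n x - f x) - (\<psi> n x - g x)) (\<lambda>x. ?p x - ?q x)"
      by (intro has_weak_deriv_diff H1_has_weak_deriv H1_diff T H)
    moreover have "(\<lambda>x. (\<phi> n x - f x) - (\<psi> n x - g x)) = ?h n" by auto
    ultimately have "L2norm a b (wderiv a b (?h n)) = L2norm a b (\<lambda>x. ?p x - ?q x)"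
      using L2norm_wderiv[OF ab] by metis
    also have "\<dots> = L2norm a b (\<lambda>x. ?p x + -1 * ?q x)" by simp
    also have "\<dots> \<le> L2norm a b ?p + L2norm a b (\<lambda>x. -1 * ?q x)"
      by (intro L2norm_triangle L2_cmult H1_L2 H1_diff T H)
    also have "L2norm a b (\<lambda>x. -1 * ?q x) = L2norm a b ?q"
      by (subst L2norm_cmult) simp
    finally show ?thesis using L2norm_le_H1norm(2) by (smt (verit))
  qed
  have "(\<lambda>n. H1norm a b (?h n)) \<longlonglongrightarrow> 0"
    by (rule H1norm_tendsto_0; rule tendsto_sandwich[OF _ _ tendsto_const H0]) (use b1 b2 in auto)
  then show ?thesis
    unfolding H10_def using H1_diff[OF H] test_functions_diff[OF \<phi> \<psi>]
    by (intro CollectI conjI exI[of _ "\<lambda>n x. \<phi> n x - \<psi> n x"]) auto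
qed

lemma dom_A_diff: "f \<in> dom_A \<Longrightarrow> g \<in> dom_A \<Longrightarrow> (\<lambda>x. f x - g x) \<in> dom_A"
  by (auto simp: dom_A_def intro: H2_diff H10_diff)

lemma H1norm_zero: "a < b \<Longrightarrow> H1norm a b (\<lambda>x. 0) = 0"
  using L2norm_wderiv[OF _ has_weak_deriv_primitive[OF primitive_const L2_const], of a b 0]
  by (simp add: H1norm_def L2norm_def)

lemma test_function_dom_A:
  assumes \<phi>: "\<phi> \<in> test_functions 0 1"
  shows "\<phi> \<in> dom_A"
proof -
  let ?\<phi>' = "\<lambda>x. vector_derivative \<phi> (at x)"
  note \<phi>' = test_function_derivative(1)[OF \<phi>]
  have w: "has_weak_deriv 0 1 \<phi> ?\<phi>'" by (rule test_function_has_weak_deriv[OF \<phi>]) simp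
  then have H1: "\<phi> \<in> H1 0 1" by (auto simp: H1_def)
  have "?\<phi>' \<in> H1 0 1" using test_function_has_weak_deriv[OF \<phi>'] by (auto simp: H1_def)
  moreover have "AE x in dx 0 1. ?\<phi>' x = wderiv 0 1 \<phi> x"
    using wderiv_AE_eq[OF _ w] by auto
  ultimately have "wderiv 0 1 \<phi> \<in> H1 0 1"
    using H1_cong_AE H1_L2(2)[OF H1] by blast
  moreover have "\<phi> \<in> H10 0 1"
    unfolding H10_def using H1 \<phi>
    by (intro CollectI conjI exI[of _ "\<lambda>n. \<phi>"]) (auto simp: H1norm_zero)
  ultimately show ?thesis using H1 by (simp add: dom_A_def H2_def)
qed

text \<open>
  An element of the domain has a continuously differentiable representative \<open>F\<close> that vanishes at both
  ends and whose derivative \<open>G\<close> is absolutely continuous. All later computations use \<open>F\<close> and \<open>G\<close> together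
  with a second weak derivative.
\<close>

lemma dom_A_representative:
  assumes f: "f \<in> dom_A"
  obtains F G where "primitive 0 1 F G" "primitive 0 1 G (wderiv 0 1 (wderiv 0 1 f))"
    "wderiv 0 1 (wderiv 0 1 f) \<in> L2 0 1" "F 0 = 0" "F 1 = 0"
    "AE x in dx 0 1. f x = F x" "AE x in dx 0 1. wderiv 0 1 f x = G x"
proof -
  have H: "f \<in> H1 0 1" "wderiv 0 1 f \<in> H1 0 1" "f \<in> H10 0 1"
    using f by (auto simp: dom_A_def H2_def)
  obtain F where F: "primitive 0 1 F (wderiv 0 1 f)" "AE x in dx 0 1. f x = F x"
    using has_weak_deriv_imp_primitive[OF _ H1_has_weak_deriv[OF H(1)]] by auto
  obtain G where G: "primitive 0 1 G (wderiv 0 1 (wderiv 0 1 f))" "AE x in dx 0 1. wderiv 0 1 f x = G x"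
    using has_weak_deriv_imp_primitive[OF _ H1_has_weak_deriv[OF H(2)]] by auto
  have "G \<in> borel_measurable (dx 0 1)"
    by (intro continuous_measurable_dx primitive_continuous[OF G(1)])
  then have FG: "primitive 0 1 F G"
    by (rule primitive_cong_AE[OF F(1) G(2)])
  show ?thesis
    by (rule that[OF FG G(1) H1_L2(2)[OF H(2)] _ _ F(2) G(2)])
       (use H10_boundary_values[OF H(3) F(1) H1_L2(2)[OF H(1)] F(2)] in auto)
qed

section \<open>Limits in mean square along filters\<close>

text \<open>
  Convergence in \<open>L2 0 1\<close> along a filter. Membership is required eventually only, since the filters in
  question live on a time interval.
\<close>

definition L2_lim :: "('i \<Rightarrow> real \<Rightarrow> complex) \<Rightarrow> (real \<Rightarrow> complex) \<Rightarrow> 'i filter \<Rightarrow> bool" where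
  "L2_lim f f0 net \<longleftrightarrow> (\<forall>\<^sub>F r in net. f r \<in> L2 0 1) \<and> f0 \<in> L2 0 1 \<and>
     ((\<lambda>r. L2norm 0 1 (\<lambda>y. f r y - f0 y)) \<longlongrightarrow> 0) net"

lemma L2_lim_const: "f \<in> L2 0 1 \<Longrightarrow> L2_lim (\<lambda>_. f) f net"
  by (simp add: L2_lim_def L2norm_def)

lemma L2_lim_dominated:
  assumes f: "L2_lim f f0 net" and g0: "g0 \<in> L2 0 1" and g: "\<forall>\<^sub>F r in net. g r \<in> L2 0 1"
    and le: "\<And>r y. y \<in> {0<..<1} \<Longrightarrow> cmod (g r y - g0 y) \<le> C * cmod (f r y - f0 y)" and C: "0 \<le> C"
  shows "L2_lim g g0 net"
  unfolding L2_lim_def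
proof (intro conjI g g0)
  have lim: "((\<lambda>r. L2norm 0 1 (\<lambda>y. f r y - f0 y)) \<longlongrightarrow> 0) net" and f0: "f0 \<in> L2 0 1"
    and ev: "\<forall>\<^sub>F r in net. f r \<in> L2 0 1"
    using f by (auto simp: L2_lim_def)
  show "((\<lambda>r. L2norm 0 1 (\<lambda>y. g r y - g0 y)) \<longlongrightarrow> 0) net"
  proof (rule tendsto_0_le[OF lim, where K=C])
    show "\<forall>\<^sub>F r in net. norm (L2norm 0 1 (\<lambda>y. g r y - g0 y)) \<le> norm (L2norm 0 1 (\<lambda>y. f r y - f0 y)) * C"
      using ev g
    proof eventually_elim
      case (elim r)
      have "L2norm 0 1 (\<lambda>y. g r y - g0 y) \<le> C * L2norm 0 1 (\<lambda>y. f r y - f0 y)"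
        by (rule L2norm_dominated[OF L2_measurable[OF L2_diff[OF elim(2) g0]] L2_diff[OF elim(1) f0] le C])
      then show ?case by (simp add: mult.commute)
    qed
  qed
qed

lemma L2_lim_cnj:
  assumes "L2_lim f f0 net"
  shows "L2_lim (\<lambda>r y. cnj (f r y)) (\<lambda>y. cnj (f0 y)) net"
proof (rule L2_lim_dominated[OF assms, where C=1])
  show "\<forall>\<^sub>F r in net. (\<lambda>y. cnj (f r y)) \<in> L2 0 1"
    using assms by (auto simp: L2_lim_def elim!: eventually_mono intro: L2_cnj)
qed (use assms in \<open>auto simp: L2_lim_def simp flip: complex_cnj_diff intro: L2_cnj\<close>)

lemma L2_lim_continuous_mult:
  assumes m: "continuous_on {0..1} m" and f: "L2_lim f f0 net"
  shows "L2_lim (\<lambda>r y. m y * f r y) (\<lambda>y. m y * f0 y) net"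
proof -
  obtain C where C: "0 \<le> C" "\<And>x. x \<in> {0..1} \<Longrightarrow> cmod (m x) \<le> C"
    using continuous_bounded_Icc[OF m] by blast
  show ?thesis
  proof (rule L2_lim_dominated[OF f])
    show "\<forall>\<^sub>F r in net. (\<lambda>y. m y * f r y) \<in> L2 0 1"
      using f by (auto simp: L2_lim_def elim!: eventually_mono intro: L2_continuous_mult[OF m])
    show "(\<lambda>y. m y * f0 y) \<in> L2 0 1" using f by (auto simp: L2_lim_def intro: L2_continuous_mult[OF m])
    show "cmod (m y * f r y - m y * f0 y) \<le> C * cmod (f r y - f0 y)" if "y \<in> {0<..<1}" for r y
      unfolding right_diff_distrib[symmetric] norm_mult by (intro mult_right_mono C(2)) (use that in auto)
  qed (rule C(1))
qed

lemma L2_lim_add: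
  assumes f: "L2_lim f f0 net" and g: "L2_lim g g0 net"
  shows "L2_lim (\<lambda>r y. f r y + g r y) (\<lambda>y. f0 y + g0 y) net"
  unfolding L2_lim_def
proof (intro conjI)
  note fg = f[unfolded L2_lim_def] g[unfolded L2_lim_def]
  show "\<forall>\<^sub>F r in net. (\<lambda>y. f r y + g r y) \<in> L2 0 1"
    using conjunct1[OF fg(1)] conjunct1[OF fg(2)] by eventually_elim (rule L2_add)
  show "(\<lambda>y. f0 y + g0 y) \<in> L2 0 1" using fg by (auto intro: L2_add)
  have lim: "((\<lambda>r. L2norm 0 1 (\<lambda>y. f r y - f0 y) + L2norm 0 1 (\<lambda>y. g r y - g0 y)) \<longlongrightarrow> 0) net"
    using tendsto_add[of _ 0 net _ 0] fg by auto
  show "((\<lambda>r. L2norm 0 1 (\<lambda>y. f r y + g r y - (f0 y + g0 y))) \<longlongrightarrow> 0) net"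
  proof (rule tendsto_0_le[OF lim, where K=1])
    show "\<forall>\<^sub>F r in net. norm (L2norm 0 1 (\<lambda>y. f r y + g r y - (f0 y + g0 y)))
        \<le> norm (L2norm 0 1 (\<lambda>y. f r y - f0 y) + L2norm 0 1 (\<lambda>y. g r y - g0 y)) * 1"
      using conjunct1[OF fg(1)] conjunct1[OF fg(2)]
    proof eventually_elim
      case (elim r)
      have "L2norm 0 1 (\<lambda>y. (f r y - f0 y) + (g r y - g0 y)) \<le> L2norm 0 1 (\<lambda>y. f r y - f0 y) + L2norm 0 1 (\<lambda>y. g r y - g0 y)"
        by (intro L2norm_triangle L2_diff elim) (use fg in auto)
      then show ?case by (simp add: algebra_simps)
    qed
  qed
qed

lemma L2_lim_integral:
  assumes "L2_lim f f0 net" "L2_lim g g0 net"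
  shows "((\<lambda>r. LINT y|dx 0 1. f r y * g r y) \<longlongrightarrow> (LINT y|dx 0 1. f0 y * g0 y)) net"
  by (rule tendsto_integral_mult_L2) (use assms in \<open>auto simp: L2_lim_def\<close>)

lemma has_real_derivative_bounded_linear_of_quotient:
  fixes C :: "real \<Rightarrow> complex" and h :: "complex \<Rightarrow> real"
  assumes h: "bounded_linear h"
    and lim: "((\<lambda>r. (C r - C t) / of_real (r - t)) \<longlongrightarrow> D) (at t within S)"
  shows "((\<lambda>r. h (C r)) has_real_derivative h D) (at t within S)"
proof -
  have "((\<lambda>r. h ((C r - C t) / of_real (r - t))) \<longlongrightarrow> h D) (at t within S)"
    by (rule bounded_linear.tendsto[OF h lim])
  moreover have "h ((C r - C t) / of_real (r - t)) = (h (C r) - h (C t)) / (r - t)" for r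
  proof -
    have "h ((C r - C t) / of_real (r - t)) = h ((1 / (r - t)) *\<^sub>R (C r - C t))"
      by (simp add: scaleR_conv_of_real divide_inverse mult.commute)
    also have "\<dots> = (1 / (r - t)) * (h (C r) - h (C t))"
      using h by (simp add: bounded_linear.linear linear_scale linear_diff diff_divide_distrib)
    finally show ?thesis by simp
  qed
  ultimately show ?thesis by (simp add: has_field_derivative_iff)
qed

section \<open>Classical solutions in fixed coordinates\<close>

text \<open>
  The bounds on the length and its derivative on which the constants depend.
\<close>

locale length_function =
  fixes \<tau> L B :: real and l l' :: "real \<Rightarrow> real"
  assumes tau: "0 < \<tau>"
    and l_bounds: "\<And>t. t \<in> {0..\<tau>} \<Longrightarrow> 1 \<le> l t" "\<And>t. t \<in> {0..\<tau>} \<Longrightarrow> l t \<le> L"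
    and l'_bounds: "\<And>t. t \<in> {0..\<tau>} \<Longrightarrow> 0 \<le> l' t" "\<And>t. t \<in> {0..\<tau>} \<Longrightarrow> l' t \<le> B"
    and l_deriv: "\<And>t. t \<in> {0..\<tau>} \<Longrightarrow> (l has_real_derivative l' t) (at t within {0..\<tau>})"
    and l_0: "l 0 = 1"
begin

lemma B_nonneg: "0 \<le> B" using l'_bounds[of 0] tau by auto

lemma L_ge_1: "1 \<le> L" using l_bounds[of 0] tau by auto

end

text \<open>
  Integration by parts in the form in which it is used: two integrands that differ by the derivative of
  an absolutely continuous function with equal end values have the same integral.
\<close>

lemma integral_eq_of_exact:
  assumes D: "primitive 0 1 P D" and u: "integrable (dx 0 1) u" and P: "P 0 = P 1"
    and v: "\<And>y. y \<in> {0<..<1} \<Longrightarrow> v y = D y + u y"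
  shows "(LINT y|dx 0 1. v y) = (LINT y|dx 0 1. u y)"
proof -
  have "(LINT y|dx 0 1. v y) = (LINT y|dx 0 1. D y + u y)"
    by (rule Bochner_Integration.integral_cong) (simp_all add: v)
  then show ?thesis using primitive_FTC[OF D] primitive_integrable[OF D] u P by simp
qed

text \<open>
  A classical solution in the coordinates of the fixed interval: \<open>F t\<close>, \<open>G t\<close>, \<open>H t\<close> are the solution
  at time \<open>t\<close> and its first two space derivatives, and \<open>W t\<close> is the time derivative, taken in \<open>L2 0 1\<close>.
\<close>

locale moving_interval_solution = length_function \<tau> L B l l'
  for \<tau> L B :: real and l l' :: "real \<Rightarrow> real" +
  fixes F G H W :: "real \<Rightarrow> real \<Rightarrow> complex"
  assumes FG: "\<And>t. t \<in> {0..\<tau>} \<Longrightarrow> primitive 0 1 (F t) (G t)"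
    and GH: "\<And>t. t \<in> {0..\<tau>} \<Longrightarrow> primitive 0 1 (G t) (H t)"
    and F_0: "\<And>t. t \<in> {0..\<tau>} \<Longrightarrow> F t 0 = 0" and F_1: "\<And>t. t \<in> {0..\<tau>} \<Longrightarrow> F t 1 = 0"
    and F_lim: "\<And>t. t \<in> {0..\<tau>} \<Longrightarrow> L2_lim F (F t) (at t within {0..\<tau>})"
    and G_lim: "\<And>t. t \<in> {0..\<tau>} \<Longrightarrow> L2_lim G (G t) (at t within {0..\<tau>})"
    and H_L2: "\<And>t. t \<in> {0..\<tau>} \<Longrightarrow> H t \<in> L2 0 1"
    and H_lim: "\<And>t. t \<in> {0..\<tau>} \<Longrightarrow> L2_lim H (H t) (at t within {0..\<tau>})"
    and W_lim: "\<And>t. t \<in> {0..\<tau>} \<Longrightarrow>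
      L2_lim (\<lambda>r y. (F r y - F t y) / of_real (r - t)) (W t) (at t within {0..\<tau>})"
    and W_eq: "\<And>t y. t \<in> {0..\<tau>} \<Longrightarrow> y \<in> {0<..<1} \<Longrightarrow>
      W t y = \<i> * of_real (1 / (l t)\<^sup>2) * H t y + of_real (l' t / l t * y) * G t y"
begin

lemma F_L2: "t \<in> {0..\<tau>} \<Longrightarrow> F t \<in> L2 0 1"
  by (intro L2_continuous primitive_continuous[OF FG])

lemma G_L2: "t \<in> {0..\<tau>} \<Longrightarrow> G t \<in> L2 0 1"
  by (intro L2_continuous primitive_continuous[OF GH])

lemma W_L2: "t \<in> {0..\<tau>} \<Longrightarrow> W t \<in> L2 0 1"
  using W_lim by (auto simp: L2_lim_def)

text \<open>
  The differential calculus for quadratic functionals: as soon as an increment of the functional is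
  written through the increment of \<open>F\<close> alone, without its space derivatives, the difference quotients
  converge, because those of \<open>F\<close> converge in mean square.
\<close>

lemma difference_quotient_tendsto:
  assumes t: "t \<in> {0..\<tau>}" and p: "L2_lim p (p t) (at t within {0..\<tau>})" and q: "q \<in> L2 0 1"
    and C: "\<And>r. r \<in> {0..\<tau>} \<Longrightarrow> C r - C t =
      (LINT y|dx 0 1. p r y * (F r y - F t y) + q y * cnj (F r y - F t y))"
  shows "((\<lambda>r. (C r - C t) / of_real (r - t))
    \<longlongrightarrow> (LINT y|dx 0 1. p t y * W t y + q y * cnj (W t y))) (at t within {0..\<tau>})"
proof (rule Lim_transform_eventually)
  let ?d = "\<lambda>r y. (F r y - F t y) / of_real (r - t)"
  let ?Q = "\<lambda>r. (LINT y|dx 0 1. p r y * ?d r y) + (LINT y|dx 0 1. q y * cnj (?d r y))"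
  have pL: "p t \<in> L2 0 1" "\<forall>\<^sub>F r in at t within {0..\<tau>}. p r \<in> L2 0 1"
    using p by (auto simp: L2_lim_def)
  have "(LINT y|dx 0 1. p t y * W t y + q y * cnj (W t y)) =
      (LINT y|dx 0 1. p t y * W t y) + (LINT y|dx 0 1. q y * cnj (W t y))"
    by (intro Bochner_Integration.integral_add L2_mult_integrable pL q L2_cnj W_L2 t)
  moreover have "(?Q \<longlongrightarrow> (LINT y|dx 0 1. p t y * W t y) + (LINT y|dx 0 1. q y * cnj (W t y))) (at t within {0..\<tau>})"
    by (intro tendsto_add L2_lim_integral p L2_lim_const q L2_lim_cnj W_lim t)
  ultimately show "(?Q \<longlongrightarrow> (LINT y|dx 0 1. p t y * W t y + q y * cnj (W t y))) (at t within {0..\<tau>})"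
    by simp
  have "\<forall>\<^sub>F r in at t within {0..\<tau>}. r \<in> {0..\<tau>}"
    by (auto simp: eventually_at_filter)
  then show "\<forall>\<^sub>F r in at t within {0..\<tau>}. ?Q r = (C r - C t) / of_real (r - t)"
    using pL(2)
  proof eventually_elim
    case (elim r)
    have \<delta>: "(\<lambda>y. F r y - F t y) \<in> L2 0 1" by (intro L2_diff F_L2 elim t)
    have "C r - C t = (LINT y|dx 0 1. p r y * (F r y - F t y)) + (LINT y|dx 0 1. q y * cnj (F r y - F t y))"
      unfolding C[OF elim(1)]
      by (intro Bochner_Integration.integral_add L2_mult_integrable elim q L2_cnj \<delta>)
    then show ?case
      by (simp only: complex_cnj_divide complex_cnj_complex_of_real times_divide_eq_right
          integral_divide_zero add_divide_distrib)
  qed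
qed

text \<open>
  The increment contains the increment of \<open>G\<close>; integrating by parts moves the space derivative to the
  other factors. No boundary terms appear since the increment of \<open>F\<close> vanishes at both ends.
\<close>

lemma current_derivative:
  assumes t: "t \<in> {0..\<tau>}" and a: "\<And>y. y \<in> {0..1} \<Longrightarrow> (a has_vector_derivative a' y) (at y within {0..1})"
    and a': "continuous_on {0..1} a'"
  shows "((\<lambda>r. Im (LINT y|dx 0 1. a y * (G r y * cnj (F r y)))) has_real_derivative
     Im (LINT y|dx 0 1. a y * (G t y * cnj (W t y) - cnj (G t y) * W t y) - a' y * (cnj (F t y) * W t y)))
     (at t within {0..\<tau>})"
proof -
  have ca: "continuous_on {0..1} a"
    using a by (meson continuous_on_eq_continuous_within has_vector_derivative_continuous)
  have pa: "primitive 0 1 a a'" by (rule primitive_C1[OF _ a a']) auto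
  note cc = ca continuous_on_minus[OF a'] continuous_on_minus[OF ca]
  let ?p = "\<lambda>r y. (- a' y) * cnj (F r y) + (- a y) * cnj (G r y)" and ?q = "\<lambda>y. a y * G t y"
  have int: "integrable (dx 0 1) (\<lambda>y. a y * (G r y * cnj (F r y)))" if "r \<in> {0..\<tau>}" for r
    unfolding mult.assoc[symmetric] by (intro L2_mult_integrable L2_continuous_mult ca L2_cnj G_L2 F_L2 that)
  have "((\<lambda>r. ((LINT y|dx 0 1. a y * (G r y * cnj (F r y))) - (LINT y|dx 0 1. a y * (G t y * cnj (F t y)))) / of_real (r - t))
      \<longlongrightarrow> (LINT y|dx 0 1. ?p t y * W t y + ?q y * cnj (W t y))) (at t within {0..\<tau>})"
  proof (rule difference_quotient_tendsto[OF t])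
    show "L2_lim ?p (?p t) (at t within {0..\<tau>})"
      by (intro L2_lim_add L2_lim_continuous_mult cc L2_lim_cnj F_lim G_lim t)
    show "?q \<in> L2 0 1" by (intro L2_continuous_mult ca G_L2 t)
    fix r assume r: "r \<in> {0..\<tau>}"
    let ?\<delta> = "\<lambda>y. F r y - F t y"
    have P: "primitive 0 1 (\<lambda>y. a y * (?\<delta> y * cnj (F r y)))
      (\<lambda>y. a' y * (?\<delta> y * cnj (F r y)) + a y * ((G r y - G t y) * cnj (F r y) + ?\<delta> y * cnj (G r y)))"
      by (intro primitive_mult primitive_diff primitive_cnj pa FG r t)
    have "(LINT y|dx 0 1. a y * (G r y * cnj (F r y)) - a y * (G t y * cnj (F t y)))
        = (LINT y|dx 0 1. ?p r y * ?\<delta> y + ?q y * cnj (?\<delta> y))"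
    proof (rule integral_eq_of_exact[OF P])
      show "integrable (dx 0 1) (\<lambda>y. ?p r y * ?\<delta> y + ?q y * cnj (?\<delta> y))"
        by (intro Bochner_Integration.integrable_add L2_mult_integrable L2_add L2_continuous_mult cc
            L2_cnj L2_diff F_L2 G_L2 r t)
    qed (use F_0[OF r] F_0[OF t] F_1[OF r] F_1[OF t] in \<open>simp_all add: algebra_simps\<close>)
    then show "(LINT y|dx 0 1. a y * (G r y * cnj (F r y))) - (LINT y|dx 0 1. a y * (G t y * cnj (F t y)))
        = (LINT y|dx 0 1. ?p r y * ?\<delta> y + ?q y * cnj (?\<delta> y))"
      using int[OF r] int[OF t] by simp
  qed
  also have "(LINT y|dx 0 1. ?p t y * W t y + ?q y * cnj (W t y)) =
      (LINT y|dx 0 1. a y * (G t y * cnj (W t y) - cnj (G t y) * W t y) - a' y * (cnj (F t y) * W t y))"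
    by (rule Bochner_Integration.integral_cong) (simp_all add: algebra_simps)
  finally show ?thesis
    by (rule has_real_derivative_bounded_linear_of_quotient[OF bounded_linear_Im])
qed

lemma mass_derivative:
  assumes t: "t \<in> {0..\<tau>}" and c: "continuous_on {0..1} c"
  shows "((\<lambda>r. Re (LINT y|dx 0 1. c y * (F r y * cnj (F r y)))) has_real_derivative
     Re (LINT y|dx 0 1. c y * (W t y * cnj (F t y) + F t y * cnj (W t y)))) (at t within {0..\<tau>})"
proof -
  let ?p = "\<lambda>r y. c y * cnj (F r y)" and ?q = "\<lambda>y. c y * F t y"
  have int: "integrable (dx 0 1) (\<lambda>y. c y * (F r y * cnj (F r y)))" if "r \<in> {0..\<tau>}" for r
    unfolding mult.assoc[symmetric] by (intro L2_mult_integrable L2_continuous_mult c L2_cnj F_L2 that)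
  have "((\<lambda>r. ((LINT y|dx 0 1. c y * (F r y * cnj (F r y))) - (LINT y|dx 0 1. c y * (F t y * cnj (F t y)))) / of_real (r - t))
      \<longlongrightarrow> (LINT y|dx 0 1. ?p t y * W t y + ?q y * cnj (W t y))) (at t within {0..\<tau>})"
  proof (rule difference_quotient_tendsto[OF t])
    show "L2_lim ?p (?p t) (at t within {0..\<tau>})"
      by (intro L2_lim_continuous_mult c L2_lim_cnj F_lim t)
    show "?q \<in> L2 0 1" by (intro L2_continuous_mult c F_L2 t)
    fix r assume r: "r \<in> {0..\<tau>}"
    have "(LINT y|dx 0 1. c y * (F r y * cnj (F r y))) - (LINT y|dx 0 1. c y * (F t y * cnj (F t y)))
        = (LINT y|dx 0 1. c y * (F r y * cnj (F r y)) - c y * (F t y * cnj (F t y)))"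
      using int[OF r] int[OF t] by simp
    also have "\<dots> = (LINT y|dx 0 1. ?p r y * (F r y - F t y) + ?q y * cnj (F r y - F t y))"
      by (rule Bochner_Integration.integral_cong) (simp_all add: algebra_simps)
    finally show "(LINT y|dx 0 1. c y * (F r y * cnj (F r y))) - (LINT y|dx 0 1. c y * (F t y * cnj (F t y)))
        = (LINT y|dx 0 1. ?p r y * (F r y - F t y) + ?q y * cnj (F r y - F t y))" .
  qed
  also have "(LINT y|dx 0 1. ?p t y * W t y + ?q y * cnj (W t y)) =
      (LINT y|dx 0 1. c y * (W t y * cnj (F t y) + F t y * cnj (W t y)))"
    by (rule Bochner_Integration.integral_cong) (simp_all add: algebra_simps)
  finally show ?thesis
    by (rule has_real_derivative_bounded_linear_of_quotient[OF bounded_linear_Re])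
qed

text \<open>
  As for the current, the increments of \<open>G\<close> are traded for increments of \<open>F\<close> by integrating by parts; this
  is where the continuity of \<open>H\<close> in mean square enters.
\<close>

lemma gradient_derivative:
  assumes t: "t \<in> {0..\<tau>}"
  shows "((\<lambda>r. Re (LINT y|dx 0 1. G r y * cnj (G r y))) has_real_derivative
      - Re (LINT y|dx 0 1. W t y * cnj (H t y) + H t y * cnj (W t y))) (at t within {0..\<tau>})"
proof -
  let ?p = "\<lambda>r y. -1 * cnj (H r y)" and ?q = "\<lambda>y. -1 * H t y"
  have int: "integrable (dx 0 1) (\<lambda>y. G r y * cnj (G r y))" if "r \<in> {0..\<tau>}" for r
    by (intro L2_mult_integrable L2_cnj G_L2 that)
  have "((\<lambda>r. ((LINT y|dx 0 1. G r y * cnj (G r y)) - (LINT y|dx 0 1. G t y * cnj (G t y))) / of_real (r - t))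
      \<longlongrightarrow> (LINT y|dx 0 1. ?p t y * W t y + ?q y * cnj (W t y))) (at t within {0..\<tau>})"
  proof (rule difference_quotient_tendsto[OF t])
    show "L2_lim ?p (?p t) (at t within {0..\<tau>})"
      by (intro L2_lim_continuous_mult continuous_on_const L2_lim_cnj H_lim t)
    show "?q \<in> L2 0 1" by (intro L2_cmult H_L2 t)
    fix r assume r: "r \<in> {0..\<tau>}"
    let ?\<delta> = "\<lambda>y. F r y - F t y"
    have P: "primitive 0 1 (\<lambda>y. ?\<delta> y * cnj (G r y) + G t y * cnj (?\<delta> y))
        (\<lambda>y. ((G r y - G t y) * cnj (G r y) + ?\<delta> y * cnj (H r y)) + (H t y * cnj (?\<delta> y) + G t y * cnj (G r y - G t y)))"
      by (intro primitive_add primitive_mult primitive_diff primitive_cnj FG GH r t)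
    have "(LINT y|dx 0 1. G r y * cnj (G r y) - G t y * cnj (G t y))
        = (LINT y|dx 0 1. ?p r y * ?\<delta> y + ?q y * cnj (?\<delta> y))"
    proof (rule integral_eq_of_exact[OF P])
      show "integrable (dx 0 1) (\<lambda>y. ?p r y * ?\<delta> y + ?q y * cnj (?\<delta> y))"
        by (intro Bochner_Integration.integrable_add L2_mult_integrable L2_cmult L2_cnj L2_diff F_L2 H_L2 r t)
    qed (use F_0[OF r] F_0[OF t] F_1[OF r] F_1[OF t] in \<open>simp_all add: algebra_simps\<close>)
    then show "(LINT y|dx 0 1. G r y * cnj (G r y)) - (LINT y|dx 0 1. G t y * cnj (G t y))
        = (LINT y|dx 0 1. ?p r y * ?\<delta> y + ?q y * cnj (?\<delta> y))"
      using int[OF r] int[OF t] by simp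
  qed
  also have "(LINT y|dx 0 1. ?p t y * W t y + ?q y * cnj (W t y)) =
      (LINT y|dx 0 1. - (W t y * cnj (H t y) + H t y * cnj (W t y)))"
    by (rule Bochner_Integration.integral_cong) (simp_all add: algebra_simps)
  finally have "((\<lambda>r. Re (LINT y|dx 0 1. G r y * cnj (G r y))) has_real_derivative
      Re (LINT y|dx 0 1. - (W t y * cnj (H t y) + H t y * cnj (W t y)))) (at t within {0..\<tau>})"
    by (rule has_real_derivative_bounded_linear_of_quotient[OF bounded_linear_Re])
  then show ?thesis by (simp only: Bochner_Integration.integral_minus uminus_complex.sel)
qed


section \<open>Energy and the virial identity\<close>

definition energy :: "real \<Rightarrow> real" where "energy t = (L2norm 0 1 (G t))\<^sup>2"

lemma energy_nonneg: "0 \<le> energy t" by (simp add: energy_def)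

lemma of_real_energy: "complex_of_real (energy t) = (LINT y|dx 0 1. G t y * cnj (G t y))"
  unfolding energy_def L2norm_power2 complex_norm_square[symmetric]
  by (rule integral_complex_of_real[symmetric])

lemma energy_eq_Re: "energy t = Re (LINT y|dx 0 1. G t y * cnj (G t y))"
  using of_real_energy[of t] by (metis Re_complex_of_real)

lemma GG_integrable: "t \<in> {0..\<tau>} \<Longrightarrow> integrable (dx 0 1) (\<lambda>y. G t y * cnj (G t y))"
  by (intro L2_mult_integrable L2_cnj G_L2)

lemma primitive_of_real_id: "primitive 0 1 (\<lambda>y. of_real y) (\<lambda>y. 1)"
  by (rule primitive_C1) (auto intro!: derivative_eq_intros continuous_intros)

lemma G_trace_continuous:
  assumes x: "x \<in> {0..1}"
  shows "continuous_on {0..\<tau>} (\<lambda>t. G t x)"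
  unfolding continuous_on_def
proof
  fix t assume t: "t \<in> {0..\<tau>}"
  have lim: "((\<lambda>r. L2norm 0 1 (\<lambda>y. G r y - G t y) + L2norm 0 1 (\<lambda>y. H r y - H t y)) \<longlongrightarrow> 0) (at t within {0..\<tau>})"
    using tendsto_add[of _ 0 _ _ 0] G_lim[OF t] H_lim[OF t] by (auto simp: L2_lim_def)
  show "((\<lambda>r. G r x) \<longlongrightarrow> G t x) (at t within {0..\<tau>})"
  proof (rule Lim_null[THEN iffD2], rule tendsto_0_le[OF lim, where K=1])
    have "cmod (G r x - G t x) \<le> L2norm 0 1 (\<lambda>y. G r y - G t y) + L2norm 0 1 (\<lambda>y. H r y - H t y)"
      if "r \<in> {0..\<tau>}" for r
      by (rule primitive_trace_bound[OF primitive_diff[OF GH GH] L2_diff[OF H_L2 H_L2] x]) (use that t in auto)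
    then show "\<forall>\<^sub>F r in at t within {0..\<tau>}. norm (G r x - G t x) \<le>
        norm (L2norm 0 1 (\<lambda>y. G r y - G t y) + L2norm 0 1 (\<lambda>y. H r y - H t y)) * 1"
      by (auto simp: eventually_at_filter)
  qed
qed

lemma trace_power2_continuous: "x \<in> {0..1} \<Longrightarrow> continuous_on {0..\<tau>} (\<lambda>t. (cmod (G t x))\<^sup>2)"
  by (intro continuous_intros G_trace_continuous)

text \<open>
  The Schroedinger part of \<open>W\<close> is \<open>H\<close> times an imaginary number and drops out of the real part of
  \<open>W cnj H\<close>. What remains is \<open>(l'/l) y\<close> times the derivative of \<open>\<bar>G\<bar>\<^sup>2\<close>.
\<close>

lemma energy_derivative:
  assumes t: "t \<in> {0..\<tau>}"
  shows "(energy has_real_derivative l' t / l t * (energy t - (cmod (G t 1))\<^sup>2)) (at t within {0..\<tau>})"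
proof -
  let ?b = "complex_of_real (l' t / l t)"
  let ?D = "\<lambda>y. of_real y * (H t y * cnj (G t y) + G t y * cnj (H t y))"
  have p: "primitive 0 1 (\<lambda>y. of_real y * (G t y * cnj (G t y))) (\<lambda>y. 1 * (G t y * cnj (G t y)) + ?D y)"
    by (intro primitive_mult primitive_cnj primitive_of_real_id GH t)
  have iD: "integrable (dx 0 1) ?D"
    using Bochner_Integration.integrable_diff[OF primitive_integrable[OF p] GG_integrable[OF t]] by simp
  have "of_real (energy t) + (LINT y|dx 0 1. ?D y) = (LINT y|dx 0 1. 1 * (G t y * cnj (G t y)) + ?D y)"
    unfolding of_real_energy mult_1_left by (rule Bochner_Integration.integral_add[symmetric, OF GG_integrable[OF t] iD])
  also have "\<dots> = of_real ((cmod (G t 1))\<^sup>2)"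
    using primitive_FTC[OF p] unfolding complex_norm_square by simp
  finally have D: "(LINT y|dx 0 1. ?D y) = of_real ((cmod (G t 1))\<^sup>2 - energy t)"
    by (simp add: algebra_simps eq_diff_eq)
  have "(LINT y|dx 0 1. W t y * cnj (H t y) + H t y * cnj (W t y)) = (LINT y|dx 0 1. ?b * ?D y)"
    by (rule Bochner_Integration.integral_cong) (use t in \<open>auto simp: W_eq algebra_simps\<close>)
  also have "\<dots> = ?b * of_real ((cmod (G t 1))\<^sup>2 - energy t)"
    unfolding integral_mult_right_zero D ..
  finally have W: "(LINT y|dx 0 1. W t y * cnj (H t y) + H t y * cnj (W t y))
      = of_real (l' t / l t * ((cmod (G t 1))\<^sup>2 - energy t))" by simp
  show ?thesis
    using gradient_derivative[OF t] unfolding W energy_eq_Re[symmetric] Re_complex_of_real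
    by (simp add: algebra_simps)
qed

text \<open>
  The factor \<open>1/l\<close> cancels the growth that the change of coordinates produces: \<open>energy t / l t\<close> is
  the energy \<open>\<integral>\<bar>u\<^sub>x\<bar>\<^sup>2\<close> on the moving interval.
\<close>

lemma energy_over_length_derivative:
  assumes t: "t \<in> {0..\<tau>}"
  shows "((\<lambda>t. energy t / l t) has_real_derivative - (l' t / (l t)\<^sup>2 * (cmod (G t 1))\<^sup>2)) (at t within {0..\<tau>})"
proof -
  have l: "l t \<noteq> 0" using l_bounds(1)[OF t] by auto
  show ?thesis
    by (rule DERIV_cong[OF DERIV_divide[OF energy_derivative[OF t] l_deriv[OF t] l]])
       (use l in \<open>simp add: field_simps power2_eq_square\<close>)
qed

lemma energy_dissipation:
  assumes t: "t \<in> {0..\<tau>}"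
  shows "((\<lambda>r. - (l' r / (l r)\<^sup>2 * (cmod (G r 1))\<^sup>2)) has_integral (energy t / l t - energy 0)) {0..t}"
proof -
  have "((\<lambda>r. - (l' r / (l r)\<^sup>2 * (cmod (G r 1))\<^sup>2)) has_integral (energy t / l t - energy 0 / l 0)) {0..t}"
  proof (rule fundamental_theorem_of_calculus)
    fix r assume r: "r \<in> {0..t}"
    then have "r \<in> {0..\<tau>}" using t by auto
    from energy_over_length_derivative[OF this]
    show "((\<lambda>t. energy t / l t) has_vector_derivative - (l' r / (l r)\<^sup>2 * (cmod (G r 1))\<^sup>2)) (at r within {0..t})"
      unfolding has_real_derivative_iff_has_vector_derivative
      by (rule has_vector_derivative_within_subset) (use t in auto)
  qed (use t in auto)
  then show ?thesis by (simp add: l_0)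
qed

lemma energy_upper:
  assumes t: "t \<in> {0..\<tau>}"
  shows "energy t \<le> L * energy 0"
proof -
  have "energy t / l t - energy 0 \<le> 0"
    by (rule has_integral_le[OF energy_dissipation[OF t] has_integral_0])
       (use l'_bounds l_bounds t in \<open>auto intro!: mult_nonneg_nonneg divide_nonneg_nonneg\<close>)
  then have "energy t \<le> l t * energy 0"
    using l_bounds[OF t] by (simp add: field_simps)
  also have "\<dots> \<le> L * energy 0"
    by (intro mult_right_mono l_bounds t energy_nonneg)
  finally show ?thesis .
qed

lemma energy_lower:
  assumes t: "t \<in> {0..\<tau>}"
  shows "energy 0 - B * integral {0..\<tau>} (\<lambda>r. (cmod (G r 1))\<^sup>2) \<le> energy t"
proof -
  let ?p = "\<lambda>r. (cmod (G r 1))\<^sup>2"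
  have pi: "?p integrable_on {0..s}" if "s \<in> {0..\<tau>}" for s
    by (intro integrable_continuous_real continuous_on_subset[OF trace_power2_continuous]) (use that in auto)
  have "((\<lambda>r. - (B * ?p r)) has_integral - (B * integral {0..t} ?p)) {0..t}"
    by (intro has_integral_neg has_integral_mult_right integrable_integral pi t)
  then have "- (B * integral {0..t} ?p) \<le> energy t / l t - energy 0"
  proof (rule has_integral_le[OF _ energy_dissipation[OF t]])
    fix r assume "r \<in> {0..t}"
    then have r: "r \<in> {0..\<tau>}" using t by auto
    have "l' r / (l r)\<^sup>2 \<le> B / 1"
      by (intro frac_le l'_bounds r) (use l_bounds[OF r] B_nonneg in auto)
    then have "(l' r / (l r)\<^sup>2) * ?p r \<le> B / 1 * ?p r"
      by (rule mult_right_mono) simp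
    then show "- (B * ?p r) \<le> - (l' r / (l r)\<^sup>2 * ?p r)"
      by simp
  qed
  moreover have "integral {0..t} ?p \<le> integral {0..\<tau>} ?p"
    by (rule integral_subset_le) (use pi t tau in auto)
  then have "B * integral {0..t} ?p \<le> B * integral {0..\<tau>} ?p"
    by (rule mult_left_mono[OF _ B_nonneg])
  moreover have "energy t / l t \<le> energy t / 1"
    by (rule divide_left_mono) (use l_bounds[OF t] energy_nonneg in auto)
  ultimately show ?thesis by simp
qed

lemma F_norm_le_G_norm: "t \<in> {0..\<tau>} \<Longrightarrow> L2norm 0 1 (F t) \<le> L2norm 0 1 (G t)"
  by (rule Poincare_zero_left[OF FG G_L2 F_0])

lemma weighted_pairing_bound:
  assumes t: "t \<in> {0..\<tau>}" and a: "continuous_on {0..1} a" "\<And>y. y \<in> {0..1} \<Longrightarrow> cmod (a y) \<le> C"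
    and f: "f \<in> L2 0 1" "L2norm 0 1 f \<le> L2norm 0 1 (G t)"
  shows "cmod (LINT y|dx 0 1. a y * (f y * cnj (F t y))) \<le> C * energy t"
proof -
  have C: "0 \<le> C" using order_trans[OF norm_ge_zero a(2)[of 0]] by simp
  have L: "(\<lambda>y. a y * f y) \<in> L2 0 1" by (intro L2_continuous_mult a f)
  have "cmod (LINT y|dx 0 1. (a y * f y) * cnj (F t y)) \<le> L2norm 0 1 (\<lambda>y. a y * f y) * L2norm 0 1 (\<lambda>y. cnj (F t y))"
    by (rule norm_integral_mult_le_L2norm[OF L L2_cnj[OF F_L2[OF t]]])
  also have "\<dots> \<le> (C * L2norm 0 1 f) * L2norm 0 1 (F t)"
  proof (rule mult_mono)
    show "L2norm 0 1 (\<lambda>y. a y * f y) \<le> C * L2norm 0 1 f"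
      by (rule L2norm_dominated[OF L2_measurable[OF L] f(1) _ C])
         (auto simp: norm_mult intro!: mult_right_mono a)
  qed (auto simp: L2norm_def C)
  also have "\<dots> \<le> (C * L2norm 0 1 (G t)) * L2norm 0 1 (G t)"
    by (intro mult_mono order_refl mult_left_mono mult_nonneg_nonneg L2norm_nonneg C)
       (use F_norm_le_G_norm[OF t] f(2) in simp_all)
  finally show ?thesis
    by (simp add: energy_def power2_eq_square mult.assoc)
qed

lemmas current_bound = weighted_pairing_bound[OF _ _ _ G_L2 order_refl]
lemmas mass_bound = weighted_pairing_bound[OF _ _ _ F_L2 F_norm_le_G_norm]


text \<open>
  The virial identity for the multiplier \<open>2y - 1\<close>, which is 1 at the right end and -1 at the left end, so
  that both boundary terms enter with the same sign.
\<close>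

lemma virial_identity:
  assumes t: "t \<in> {0..\<tau>}"
  shows "Im (LINT y|dx 0 1. of_real (2 * y - 1) * (G t y * cnj (W t y) - cnj (G t y) * W t y) - 2 * (cnj (F t y) * W t y))
    = 1 / (l t)\<^sup>2 * (4 * energy t - (cmod (G t 0))\<^sup>2 - (cmod (G t 1))\<^sup>2)
      - 2 * (l' t / l t) * Im (LINT y|dx 0 1. of_real y * (G t y * cnj (F t y)))"
proof -
  define mr where "mr = 1 / (l t)\<^sup>2"
  define br where "br = l' t / l t"
  define m b where "m = complex_of_real mr" and "b = complex_of_real br"
  have cnj_mb: "cnj m = m" "cnj b = b" by (simp_all add: m_def b_def)
  have W: "W t y = \<i> * m * H t y + b * of_real y * G t y" if "y \<in> {0<..<1}" for y
    unfolding m_def b_def mr_def br_def using W_eq[OF t that] by simp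
  let ?D1 = "\<lambda>y. 2 * (G t y * cnj (G t y)) + of_real (2 * y - 1) * (H t y * cnj (G t y) + G t y * cnj (H t y))"
  let ?D2 = "\<lambda>y. G t y * cnj (G t y) + H t y * cnj (F t y)"
  have pa: "primitive 0 1 (\<lambda>y. of_real (2 * y - 1)) (\<lambda>y. 2)"
    by (rule primitive_C1) (auto intro!: derivative_eq_intros)
  have p1: "primitive 0 1 (\<lambda>y. of_real (2 * y - 1) * (G t y * cnj (G t y))) ?D1"
    by (intro primitive_mult primitive_cnj GH t pa)
  have "primitive 0 1 (\<lambda>y. G t y * cnj (F t y)) (\<lambda>y. H t y * cnj (F t y) + G t y * cnj (G t y))"
    by (intro primitive_mult primitive_cnj FG GH t)
  then have p2: "primitive 0 1 (\<lambda>y. G t y * cnj (F t y)) ?D2"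
    by (simp add: add.commute)
  have I1: "(LINT y|dx 0 1. ?D1 y) = of_real ((cmod (G t 0))\<^sup>2 + (cmod (G t 1))\<^sup>2)"
    using primitive_FTC[OF p1] unfolding of_real_add complex_norm_square by simp
  have I2: "(LINT y|dx 0 1. ?D2 y) = 0"
    using primitive_FTC[OF p2] F_0[OF t] F_1[OF t] by simp
  have i3: "integrable (dx 0 1) (\<lambda>y. of_real y * (G t y * cnj (F t y)))"
  proof -
    have "integrable (dx 0 1) (\<lambda>y. (of_real y * G t y) * cnj (F t y))"
      by (intro L2_mult_integrable L2_continuous_mult L2_cnj F_L2 G_L2 t continuous_intros)
    then show ?thesis by (simp add: mult.assoc)
  qed
  have "(LINT y|dx 0 1. of_real (2 * y - 1) * (G t y * cnj (W t y) - cnj (G t y) * W t y) - 2 * (cnj (F t y) * W t y))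
    = (LINT y|dx 0 1. (((4 * \<i> * m) * (G t y * cnj (G t y)) - (\<i> * m) * ?D1 y) - (2 * \<i> * m) * ?D2 y)
         - (2 * b) * (of_real y * (G t y * cnj (F t y))))"
    by (rule Bochner_Integration.integral_cong) (auto simp: W cnj_mb algebra_simps)
  also have "\<dots> = (4 * \<i> * m) * (LINT y|dx 0 1. G t y * cnj (G t y)) - (\<i> * m) * (LINT y|dx 0 1. ?D1 y)
      - (2 * \<i> * m) * (LINT y|dx 0 1. ?D2 y) - (2 * b) * (LINT y|dx 0 1. of_real y * (G t y * cnj (F t y)))"
    by (simp only: Bochner_Integration.integral_diff Bochner_Integration.integrable_diff integrable_mult_right
        integral_mult_right_zero GG_integrable[OF t] primitive_integrable[OF p1] primitive_integrable[OF p2] i3)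
  also have "\<dots> = (4 * \<i> * m) * of_real (energy t) - (\<i> * m) * of_real ((cmod (G t 0))\<^sup>2 + (cmod (G t 1))\<^sup>2)
      - (2 * b) * (LINT y|dx 0 1. of_real y * (G t y * cnj (F t y)))"
    unfolding I1 I2 of_real_energy by simp
  finally have eq: "(LINT y|dx 0 1. of_real (2 * y - 1) * (G t y * cnj (W t y) - cnj (G t y) * W t y) - 2 * (cnj (F t y) * W t y))
    = (4 * \<i> * m) * of_real (energy t) - (\<i> * m) * of_real ((cmod (G t 0))\<^sup>2 + (cmod (G t 1))\<^sup>2)
      - (2 * b) * (LINT y|dx 0 1. of_real y * (G t y * cnj (F t y)))" .
  show ?thesis
    unfolding eq mr_def[symmetric] br_def[symmetric] m_def b_def
    by (simp add: algebra_simps del: of_real_power)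
qed

text \<open>
  Integrate the virial identity in time; the current and all volume terms are bounded by the energy.
\<close>

lemma traces_le_energy:
  "integral {0..\<tau>} (\<lambda>t. (cmod (G t 0))\<^sup>2 + (cmod (G t 1))\<^sup>2)
     \<le> L\<^sup>2 * ((4 + 2 * B) * L * \<tau> + L + 1) * energy 0"
proof -
  define N where "N r = Im (LINT y|dx 0 1. of_real (2 * y - 1) * (G r y * cnj (F r y)))" for r
  define N' where "N' t = 1 / (l t)\<^sup>2 * (4 * energy t - (cmod (G t 0))\<^sup>2 - (cmod (G t 1))\<^sup>2)
      - 2 * (l' t / l t) * Im (LINT y|dx 0 1. of_real y * (G t y * cnj (F t y)))" for t
  define K where "K = (4 + 2 * B) * (L * energy 0)"
  let ?p = "\<lambda>t. (cmod (G t 0))\<^sup>2 + (cmod (G t 1))\<^sup>2"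
  have "(N has_real_derivative N' t) (at t within {0..\<tau>})" if t: "t \<in> {0..\<tau>}" for t
    unfolding N_def N'_def virial_identity[OF t, symmetric]
    by (rule current_derivative[OF t]) (auto intro!: derivative_eq_intros)
  then have "(N' has_integral (N \<tau> - N 0)) {0..\<tau>}"
    using tau by (intro fundamental_theorem_of_calculus)
      (auto simp: has_real_derivative_iff_has_vector_derivative)
  then have 1: "((\<lambda>t. K - N' t) has_integral (K * \<tau> - (N \<tau> - N 0))) {0..\<tau>}"
    using has_integral_diff[OF has_integral_const_real[of K 0 \<tau>]] tau by (simp add: mult.commute)
  have "?p integrable_on {0..\<tau>}"
    by (intro integrable_continuous_real continuous_intros G_trace_continuous) auto
  then have 2: "((\<lambda>t. 1 / L\<^sup>2 * ?p t) has_integral (1 / L\<^sup>2 * integral {0..\<tau>} ?p)) {0..\<tau>}"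
    by (intro has_integral_mult_right integrable_integral)
  have N: "\<bar>N t\<bar> \<le> energy t" if t: "t \<in> {0..\<tau>}" for t
  proof -
    have "cmod (LINT y|dx 0 1. of_real (2 * y - 1) * (G t y * cnj (F t y))) \<le> 1 * energy t"
      by (rule current_bound[OF t _ _ t]) (auto intro!: continuous_intros simp del: of_real_diff of_real_mult)
    then show ?thesis unfolding N_def using abs_Im_le_cmod order_trans by fastforce
  qed
  have "1 / L\<^sup>2 * integral {0..\<tau>} ?p \<le> K * \<tau> - (N \<tau> - N 0)"
  proof (rule has_integral_le[OF 2 1])
    fix t assume t: "t \<in> {0..\<tau>}"
    have l: "1 \<le> l t" "l t \<le> L" using l_bounds[OF t] by auto
    have m: "1 / L\<^sup>2 \<le> 1 / (l t)\<^sup>2" "1 / (l t)\<^sup>2 \<le> 1"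
      using l by (auto intro!: frac_le power_mono)
    have b: "0 \<le> l' t / l t" "l' t / l t \<le> B / 1"
      using l l'_bounds[OF t] B_nonneg by (auto intro!: frac_le simp del: div_by_1)
    have "cmod (LINT y|dx 0 1. of_real y * (G t y * cnj (F t y))) \<le> 1 * energy t"
      by (rule current_bound[OF t _ _ t]) (auto intro!: continuous_intros)
    then have Y: "\<bar>Im (LINT y|dx 0 1. of_real y * (G t y * cnj (F t y)))\<bar> \<le> energy t"
      using abs_Im_le_cmod order_trans by fastforce
    have "1 / L\<^sup>2 * ?p t \<le> 1 / (l t)\<^sup>2 * ?p t"
      by (intro mult_right_mono m) auto
    moreover have "1 / (l t)\<^sup>2 * (4 * energy t) \<le> 1 * (4 * energy t)"
      by (intro mult_right_mono m) (simp add: energy_nonneg)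
    moreover have "l' t / l t * (- Im (LINT y|dx 0 1. of_real y * (G t y * cnj (F t y)))) \<le> B / 1 * energy t"
      by (rule order_trans[OF mult_left_mono[OF abs_ge_minus_self b(1)] mult_mono[OF b(2) Y]])
         (use B_nonneg in auto)
    moreover have "(4 + 2 * B) * energy t \<le> K"
      unfolding K_def by (intro mult_left_mono energy_upper t) (use B_nonneg in auto)
    ultimately show "1 / L\<^sup>2 * ?p t \<le> K - N' t"
      unfolding N'_def by (simp add: algebra_simps)
  qed
  also have "\<dots> \<le> K * \<tau> + energy \<tau> + energy 0"
    using N[of 0] N[of \<tau>] tau by auto
  also have "\<dots> \<le> ((4 + 2 * B) * L * \<tau> + L + 1) * energy 0"
    using energy_upper[of \<tau>] tau by (simp add: K_def algebra_simps)
  finally show ?thesis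
    using L_ge_1 by (simp add: field_simps)
qed

end

section \<open>The Carleman estimate\<close>

text \<open>
  In this lemma and in those up to \<open>carleman_pointwise\<close>, the complex numbers stand for the values at
  one point of the solution (\<open>F\<close>) and of its derivatives, \<open>q\<close> for \<open>1 + y\<close>, \<open>m\<close> for \<open>1/l\<^sup>2\<close> and \<open>k\<close> for the
  coefficient \<open>s l\<^sup>2 \<eta>'\<close>, \<open>e1\<close> for \<open>k m = s \<eta>'\<close>. After division by the exponential weight, \<open>z\<close> and \<open>z\<^sub>y\<close> become \<open>F\<close> and
  \<open>V = G + s q F\<close>. The left-hand side is the integrand of the time derivative of the weighted current and
  mass; the right-hand side exhibits it as twice the real part of \<open>\<langle>S z, z\<^sub>t\<rangle>\<close>.
\<close>

lemma carleman_time_derivative_form: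
  fixes F G W :: complex and q s k e1 :: real
  defines "V \<equiv> G + of_real (s * q) * F"
  defines "S \<equiv> - \<i> * (of_real (2 * s * q) * V + of_real s * F) - of_real k * F"
  shows "Re (- of_real (2 * e1) * (- \<i> * of_real (2 * s * q) * (G * cnj F) - of_real k * (F * cnj F))
             - \<i> * of_real (2 * s) * (of_real q * (G * cnj W - cnj G * W) - of_real (1 + 2 * s * q\<^sup>2) * (cnj F * W))
             - of_real k * (W * cnj F + F * cnj W))
         = 2 * Re (cnj S * (W - of_real e1 * F))"
  unfolding V_def S_def by (simp add: algebra_simps power2_eq_square)

text \<open>
  The equation for \<open>z\<close>: a skew part \<open>\<i> X\<close> with \<open>X = z\<^sub>y\<^sub>y + s\<^sup>2 q\<^sup>2 z\<close>, the symmetric part \<open>S\<close>, and the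
  transport term that stems from the change of coordinates.
\<close>

lemma conjugated_equation_splitting:
  fixes F G H :: complex and q s k m br :: real
  defines "V \<equiv> G + of_real (s * q) * F"
  defines "S \<equiv> - \<i> * (of_real (2 * s * q) * V + of_real s * F) - of_real k * F"
  defines "X \<equiv> H + of_real (2 * s * q) * G + of_real (2 * s\<^sup>2 * q\<^sup>2 + s) * F"
  shows "(\<i> * of_real m * H + of_real br * G) - of_real (k * m) * F = of_real m * (\<i> * X + S) + of_real br * G"
  unfolding V_def S_def X_def by (simp add: complex_eq_iff algebra_simps power2_eq_square)

lemma square_completion_bound:
  fixes S Z R :: complex and m :: real
  assumes "m > 0"
  shows "m * (2 * Re (cnj S * Z)) - (cmod R)\<^sup>2 / (2 * m) \<le> 2 * Re (cnj S * (of_real m * (Z + S) + R))"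
proof -
  have "0 \<le> (cmod (of_real (2 * m) * S + R))\<^sup>2 / (2 * m)"
    using assms by simp
  also have "\<dots> = 2 * m * (cmod S)\<^sup>2 + 2 * Re (cnj S * R) + (cmod R)\<^sup>2 / (2 * m)"
    using assms unfolding cmod_power2 by (simp add: field_simps power2_eq_square)
  finally show ?thesis
    unfolding cmod_power2 by (simp add: algebra_simps power2_eq_square)
qed

text \<open>
  Up to the space derivative of the weighted expression \<open>P\<close>, the product of the symmetric and the skew part is a
  sum of squares. The positive signs are due to the convexity of \<open>(1+y)\<^sup>2/2\<close>.
\<close>

lemma carleman_commutator_identity:
  fixes F G H :: complex and q s k :: real
  defines "V \<equiv> G + of_real (s * q) * F"
  defines "V' \<equiv> H + (of_real s * F + of_real (s * q) * G)"
  defines "S \<equiv> - \<i> * (of_real (2 * s * q) * V + of_real s * F) - of_real k * F"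
  defines "X \<equiv> H + of_real (2 * s * q) * G + of_real (2 * s\<^sup>2 * q\<^sup>2 + s) * F"
  defines "P \<equiv> - of_real (2 * s * q) * (V * cnj V) - (of_real (2 * s) + \<i> * of_real (2 * k)) * (cnj F * V)
                - of_real (2 * s ^ 3 * q ^ 3) * (F * cnj F)"
  defines "P' \<equiv> - of_real (2 * s) * (V * cnj V) - of_real (2 * s * q) * (V' * cnj V + V * cnj V')
                - (of_real (2 * s) + \<i> * of_real (2 * k)) * (cnj G * V + cnj F * V')
                - of_real (6 * s ^ 3 * q\<^sup>2) * (F * cnj F) - of_real (2 * s ^ 3 * q ^ 3) * (G * cnj F + F * cnj G)"
  shows "2 * Re (cnj S * (\<i> * X)) =
    Re (P' + of_real (2 * s * q) * P) + 4 * s * (cmod V)\<^sup>2 + 4 * s ^ 3 * q\<^sup>2 * (cmod F)\<^sup>2"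
  unfolding V_def V'_def S_def X_def P_def P'_def cmod_power2
  by (simp add: algebra_simps power2_eq_square power3_eq_cube)

text \<open>
  For large \<open>s\<close> the squares absorb the transport term, the term with \<open>k'\<close> (the time derivative of the
  coefficient \<open>k\<close>), and still leave a multiple of \<open>\<bar>G\<bar>\<^sup>2\<close>.
\<close>

lemma carleman_pointwise:
  fixes F G H W :: complex and q s k k' m br B K2 :: real
  assumes s: "1 \<le> s" and m: "0 < m" and q: "1 \<le> q" and br: "br\<^sup>2 \<le> B\<^sup>2 * m"
    and s1: "B\<^sup>2 \<le> 3 * s * m" and s2: "B\<^sup>2 * s + K2 \<le> 3 * s\<^sup>2 * m" and k': "\<bar>k'\<bar> \<le> K2 * s"
    and W: "W = \<i> * of_real m * H + of_real br * G"
  defines "V \<equiv> G + of_real (s * q) * F"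
  defines "V' \<equiv> H + (of_real s * F + of_real (s * q) * G)"
  defines "P \<equiv> - of_real (2 * s * q) * (V * cnj V) - (of_real (2 * s) + \<i> * of_real (2 * k)) * (cnj F * V)
                - of_real (2 * s ^ 3 * q ^ 3) * (F * cnj F)"
  defines "P' \<equiv> - of_real (2 * s) * (V * cnj V) - of_real (2 * s * q) * (V' * cnj V + V * cnj V')
                - (of_real (2 * s) + \<i> * of_real (2 * k)) * (cnj G * V + cnj F * V')
                - of_real (6 * s ^ 3 * q\<^sup>2) * (F * cnj F) - of_real (2 * s ^ 3 * q ^ 3) * (G * cnj F + F * cnj G)"
  shows "m * Re (P' + of_real (2 * s * q) * P) + s * m / 2 * (cmod G)\<^sup>2 \<le>
     Re (- of_real (2 * (k * m)) * (- \<i> * of_real (2 * s * q) * (G * cnj F) - of_real k * (F * cnj F))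
             - \<i> * of_real (2 * s) * (of_real q * (G * cnj W - cnj G * W) - of_real (1 + 2 * s * q\<^sup>2) * (cnj F * W))
             - of_real k * (W * cnj F + F * cnj W)) - k' * (cmod F)\<^sup>2"
    (is "?lhs \<le> Re ?A - _")
proof -
  define S where "S = - \<i> * (of_real (2 * s * q) * V + of_real s * F) - of_real k * F"
  define X where "X = H + of_real (2 * s * q) * G + of_real (2 * s\<^sup>2 * q\<^sup>2 + s) * F"
  have A: "Re ?A = 2 * Re (cnj S * (W - of_real (k * m) * F))"
    unfolding S_def V_def by (rule carleman_time_derivative_form)
  have Bq: "W - of_real (k * m) * F = of_real m * (\<i> * X + S) + of_real br * G"
    unfolding W S_def V_def X_def by (rule conjugated_equation_splitting)
  have D: "2 * Re (cnj S * (\<i> * X)) =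
    Re (P' + of_real (2 * s * q) * P) + 4 * s * (cmod V)\<^sup>2 + 4 * s ^ 3 * q\<^sup>2 * (cmod F)\<^sup>2"
    unfolding P_def P'_def S_def X_def V'_def V_def by (rule carleman_commutator_identity)
  have sq: "m * (2 * Re (cnj S * (\<i> * X))) - (cmod (of_real br * G))\<^sup>2 / (2 * m) \<le> Re ?A"
    unfolding A Bq by (rule square_completion_bound[OF m])
  have R: "(cmod (of_real br * G))\<^sup>2 / (2 * m) \<le> B\<^sup>2 / 2 * (cmod G)\<^sup>2"
  proof -
    have "(cmod (of_real br * G))\<^sup>2 / (2 * m) = br\<^sup>2 / (2 * m) * (cmod G)\<^sup>2"
      by (simp add: norm_mult power_mult_distrib)
    also have "\<dots> \<le> B\<^sup>2 / 2 * (cmod G)\<^sup>2"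
      using br m by (intro mult_right_mono) (simp_all add: field_simps)
    finally show ?thesis .
  qed
  have G: "(cmod G)\<^sup>2 \<le> 2 * (cmod V)\<^sup>2 + 2 * (s\<^sup>2 * q\<^sup>2 * (cmod F)\<^sup>2)"
  proof -
    have "cmod G \<le> cmod V + s * q * cmod F"
    proof -
      have "G = V - of_real (s * q) * F" by (simp add: V_def)
      then have "cmod G \<le> cmod V + cmod (of_real (s * q) * F)" using norm_triangle_ineq4 by metis
      then show ?thesis using s q by (simp add: norm_mult)
    qed
    then have "(cmod G)\<^sup>2 \<le> (cmod V + s * q * cmod F)\<^sup>2" by (rule power_mono) simp
    also have "\<dots> \<le> 2 * (cmod V)\<^sup>2 + 2 * (s * q * cmod F)\<^sup>2"
      using sum_squares_bound[of "cmod V" "s * q * cmod F"] by (simp add: power2_sum)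
    finally show ?thesis by (simp add: power_mult_distrib)
  qed
  have K2: "0 \<le> K2" using k' s by (metis abs_ge_zero order_trans zero_le_mult_iff linorder_not_less not_one_le_zero order_less_le_trans zero_less_one)
  have "(B\<^sup>2 / 2 + s * m / 2) * (cmod G)\<^sup>2 \<le> (B\<^sup>2 / 2 + s * m / 2) * (2 * (cmod V)\<^sup>2 + 2 * (s\<^sup>2 * q\<^sup>2 * (cmod F)\<^sup>2))"
    using s m by (intro mult_left_mono G) simp
  also have "\<dots> = (B\<^sup>2 + s * m) * (cmod V)\<^sup>2 + (B\<^sup>2 * s\<^sup>2 * q\<^sup>2 + s ^ 3 * m * q\<^sup>2) * (cmod F)\<^sup>2"
    by (simp add: algebra_simps power2_eq_square power3_eq_cube)
  also have "\<dots> \<le> (4 * s * m) * (cmod V)\<^sup>2 + (4 * s ^ 3 * m * q\<^sup>2 - K2 * s) * (cmod F)\<^sup>2"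
  proof (intro add_mono mult_right_mono)
    show "B\<^sup>2 + s * m \<le> 4 * s * m" using s1 by (simp add: mult.commute)
    have "K2 * s * 1 \<le> K2 * s * q\<^sup>2"
      using K2 s q by (intro mult_left_mono) (auto simp: one_le_power)
    also have "\<dots> = (s * q\<^sup>2) * K2" by simp
    also have "\<dots> \<le> (s * q\<^sup>2) * (3 * s\<^sup>2 * m - B\<^sup>2 * s)"
      using s2 s by (intro mult_left_mono) auto
    finally show "B\<^sup>2 * s\<^sup>2 * q\<^sup>2 + s ^ 3 * m * q\<^sup>2 \<le> 4 * s ^ 3 * m * q\<^sup>2 - K2 * s"
      by (simp add: algebra_simps power2_eq_square power3_eq_cube)
  qed auto
  finally have main: "B\<^sup>2 / 2 * (cmod G)\<^sup>2 + s * m / 2 * (cmod G)\<^sup>2 + K2 * s * (cmod F)\<^sup>2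
      \<le> m * (4 * s * (cmod V)\<^sup>2 + 4 * s ^ 3 * q\<^sup>2 * (cmod F)\<^sup>2)"
    by (simp add: algebra_simps)
  have "k' * (cmod F)\<^sup>2 \<le> K2 * s * (cmod F)\<^sup>2"
    using k' by (intro mult_right_mono) auto
  then show ?thesis
    using sq R main unfolding D by (simp add: algebra_simps)
qed

lemma Re_integral_mono:
  assumes "integrable M f" "integrable M g" "\<And>x. x \<in> space M \<Longrightarrow> Re (f x) \<le> Re (g x)"
  shows "Re (integral\<^sup>L M f) \<le> Re (integral\<^sup>L M g)"
proof -
  have "(\<integral>x. Re (f x) \<partial>M) \<le> (\<integral>x. Re (g x) \<partial>M)"
    using assms by (intro integral_mono) auto
  then show ?thesis using assms by simp
qed

text \<open>
  The square of the spatial factor of the Carleman weight.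
\<close>

definition carleman_weight :: "real \<Rightarrow> real \<Rightarrow> real" where
  "carleman_weight s y = exp (s * (1 + y)\<^sup>2)"

lemma carleman_weight_derivatives:
  "((\<lambda>y. complex_of_real (carleman_weight s y)) has_vector_derivative
     of_real (2 * s * (1 + y) * carleman_weight s y)) (at y within S)"
  "((\<lambda>y. complex_of_real ((1 + y) * carleman_weight s y)) has_vector_derivative
     of_real ((1 + 2 * s * (1 + y)\<^sup>2) * carleman_weight s y)) (at y within S)"
proof -
  have "(carleman_weight s has_real_derivative 2 * s * (1 + y) * carleman_weight s y) (at y within S)"
    unfolding carleman_weight_def by (auto intro!: derivative_eq_intros simp: algebra_simps)
  note d = this
  then show "((\<lambda>y. complex_of_real (carleman_weight s y)) has_vector_derivative
     of_real (2 * s * (1 + y) * carleman_weight s y)) (at y within S)"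
    by (rule has_vector_derivative_of_real)
  have "((\<lambda>y. (1 + y) * carleman_weight s y) has_real_derivative (1 + 2 * s * (1 + y)\<^sup>2) * carleman_weight s y) (at y within S)"
    by (auto intro!: derivative_eq_intros d simp: algebra_simps power2_eq_square)
  then show "((\<lambda>y. complex_of_real ((1 + y) * carleman_weight s y)) has_vector_derivative
     of_real ((1 + 2 * s * (1 + y)\<^sup>2) * carleman_weight s y)) (at y within S)"
    by (rule has_vector_derivative_of_real)
qed

lemma carleman_weight_continuous: "continuous_on S (carleman_weight s)"
  unfolding carleman_weight_def by (intro continuous_intros)

context moving_interval_solution
begin

text \<open>
  The pointwise inequality, multiplied by the weight and integrated over the interval. The exact
  derivative contributes boundary terms only; since \<open>F\<close> vanishes at the ends, they reduce to \<open>\<bar>G\<bar>\<^sup>2\<close>, and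
  the one at the left end has the favourable sign.
\<close>

lemma carleman_fixed_time:
  fixes s k k' K2 :: real
  defines "a \<equiv> \<lambda>y. complex_of_real ((1 + y) * carleman_weight s y)"
    and "a' \<equiv> \<lambda>y. complex_of_real ((1 + 2 * s * (1 + y)\<^sup>2) * carleman_weight s y)"
    and "c \<equiv> \<lambda>y. complex_of_real (carleman_weight s y)"
  assumes t: "t \<in> {0..\<tau>}" and s: "1 \<le> s"
    and s1: "B\<^sup>2 \<le> 3 * s / L\<^sup>2" and s2: "B\<^sup>2 * s + K2 \<le> 3 * s\<^sup>2 / L\<^sup>2" and k': "\<bar>k'\<bar> \<le> K2 * s"
  shows "s * exp s / (2 * L\<^sup>2) * energy t - 4 * s * exp (4 * s) * (cmod (G t 1))\<^sup>2 \<le>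
    - 2 * (k * (1 / (l t)\<^sup>2)) * (2 * s * Im (LINT y|dx 0 1. a y * (G t y * cnj (F t y)))
                              - k * Re (LINT y|dx 0 1. c y * (F t y * cnj (F t y))))
    + 2 * s * Im (LINT y|dx 0 1. a y * (G t y * cnj (W t y) - cnj (G t y) * W t y) - a' y * (cnj (F t y) * W t y))
    - k' * Re (LINT y|dx 0 1. c y * (F t y * cnj (F t y)))
    - k * Re (LINT y|dx 0 1. c y * (W t y * cnj (F t y) + F t y * cnj (W t y)))"
proof -
  define m where "m = 1 / (l t)\<^sup>2"
  have l: "1 \<le> l t" "l t \<le> L" using l_bounds[OF t] by auto
  have m: "0 < m" "1 / L\<^sup>2 \<le> m" "m \<le> 1"
    using l by (auto simp: m_def intro!: frac_le power_mono)
  define c' where "c' = (\<lambda>y. complex_of_real (2 * s * (1 + y) * carleman_weight s y))"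
  have cont: "continuous_on {0..1} a" "continuous_on {0..1} a'" "continuous_on {0..1} c" "continuous_on {0..1} c'"
    unfolding a_def a'_def c_def c'_def by (intro continuous_intros carleman_weight_continuous)+
  have pc: "primitive 0 1 c c'"
    by (rule primitive_C1[OF _ _ cont(4)]) (auto simp only: c_def c'_def carleman_weight_derivatives zero_le_one)
  have iN: "integrable (dx 0 1) (\<lambda>y. a y * (G t y * cnj (F t y)))"
    unfolding mult.assoc[symmetric] by (intro L2_mult_integrable L2_continuous_mult cont L2_cnj G_L2 F_L2 t)
  have iQ: "integrable (dx 0 1) (\<lambda>y. c y * (F t y * cnj (F t y)))"
    unfolding mult.assoc[symmetric] by (intro L2_mult_integrable L2_continuous_mult cont L2_cnj F_L2 t)
  have iN': "integrable (dx 0 1) (\<lambda>y. a y * (G t y * cnj (W t y) - cnj (G t y) * W t y) - a' y * (cnj (F t y) * W t y))"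
    unfolding right_diff_distrib mult.assoc[symmetric]
    by (intro Bochner_Integration.integrable_diff L2_mult_integrable L2_continuous_mult cont L2_cnj F_L2 G_L2 W_L2 t)
  have iQ': "integrable (dx 0 1) (\<lambda>y. c y * (W t y * cnj (F t y) + F t y * cnj (W t y)))"
    unfolding distrib_left mult.assoc[symmetric]
    by (intro Bochner_Integration.integrable_add L2_mult_integrable L2_continuous_mult cont L2_cnj F_L2 W_L2 t)
  \<comment> \<open>\<open>J\<close> is the integrand on the right, \<open>K\<close> collects the exact derivative and the gain.\<close>
  define J where "J y = - of_real (2 * (k * m)) * (- \<i> * of_real (2 * s) * (a y * (G t y * cnj (F t y))) - of_real k * (c y * (F t y * cnj (F t y))))
     - \<i> * of_real (2 * s) * (a y * (G t y * cnj (W t y) - cnj (G t y) * W t y) - a' y * (cnj (F t y) * W t y))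
     - of_real k * (c y * (W t y * cnj (F t y) + F t y * cnj (W t y))) - of_real k' * (c y * (F t y * cnj (F t y)))" for y
  have iJ: "integrable (dx 0 1) J"
    unfolding J_def
    by (intro Bochner_Integration.integrable_diff integrable_mult_right iN iQ iN' iQ')
  have "integral\<^sup>L (dx 0 1) J = - of_real (2 * (k * m)) * (- \<i> * of_real (2 * s) * (LINT y|dx 0 1. a y * (G t y * cnj (F t y))) - of_real k * (LINT y|dx 0 1. c y * (F t y * cnj (F t y))))
     - \<i> * of_real (2 * s) * (LINT y|dx 0 1. a y * (G t y * cnj (W t y) - cnj (G t y) * W t y) - a' y * (cnj (F t y) * W t y))
     - of_real k * (LINT y|dx 0 1. c y * (W t y * cnj (F t y) + F t y * cnj (W t y))) - of_real k' * (LINT y|dx 0 1. c y * (F t y * cnj (F t y)))"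
    unfolding J_def
    by (simp only: Bochner_Integration.integral_diff Bochner_Integration.integrable_diff integrable_mult_right
        integral_mult_right_zero iN iQ iN' iQ')
  then have ReJ: "Re (integral\<^sup>L (dx 0 1) J) =
    - 2 * (k * m) * (2 * s * Im (LINT y|dx 0 1. a y * (G t y * cnj (F t y)))
                              - k * Re (LINT y|dx 0 1. c y * (F t y * cnj (F t y))))
    + 2 * s * Im (LINT y|dx 0 1. a y * (G t y * cnj (W t y) - cnj (G t y) * W t y) - a' y * (cnj (F t y) * W t y))
    - k' * Re (LINT y|dx 0 1. c y * (F t y * cnj (F t y)))
    - k * Re (LINT y|dx 0 1. c y * (W t y * cnj (F t y) + F t y * cnj (W t y)))"
    by (simp only:) simp
  define V where "V y = G t y + of_real (s * (1 + y)) * F t y" for y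
  define V' where "V' y = H t y + (of_real s * F t y + of_real (s * (1 + y)) * G t y)" for y
  define P where "P y = - of_real (2 * s * (1 + y)) * (V y * cnj (V y))
      - (of_real (2 * s) + \<i> * of_real (2 * k)) * (cnj (F t y) * V y)
      - of_real (2 * s ^ 3 * (1 + y) ^ 3) * (F t y * cnj (F t y))" for y
  define P' where "P' y = (- of_real (2 * s) * (V y * cnj (V y)) + - of_real (2 * s * (1 + y)) * (V' y * cnj (V y) + V y * cnj (V' y)))
      - (of_real (2 * s) + \<i> * of_real (2 * k)) * (cnj (G t y) * V y + cnj (F t y) * V' y)
      - (of_real (6 * s ^ 3 * (1 + y)\<^sup>2) * (F t y * cnj (F t y)) + of_real (2 * s ^ 3 * (1 + y) ^ 3) * (G t y * cnj (F t y) + F t y * cnj (G t y)))" for y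
  have d1: "primitive 0 1 (\<lambda>y. complex_of_real (s * (1 + y))) (\<lambda>y. of_real s)"
   and d2: "primitive 0 1 (\<lambda>y. - complex_of_real (2 * s * (1 + y))) (\<lambda>y. - of_real (2 * s))"
    by (rule primitive_C1; auto intro!: derivative_eq_intros simp: scaleR_conv_of_real)+
  have d3: "primitive 0 1 (\<lambda>y. complex_of_real (2 * s ^ 3 * (1 + y) ^ 3)) (\<lambda>y. of_real (6 * s ^ 3 * (1 + y)\<^sup>2))"
  proof (rule primitive_C1)
    fix y :: real
    have "((\<lambda>y. 2 * s ^ 3 * (1 + y) ^ 3) has_real_derivative 6 * s ^ 3 * (1 + y)\<^sup>2) (at y within {0..1})"
      by (auto intro!: derivative_eq_intros)
    then show "((\<lambda>y. complex_of_real (2 * s ^ 3 * (1 + y) ^ 3)) has_vector_derivative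
        of_real (6 * s ^ 3 * (1 + y)\<^sup>2)) (at y within {0..1})"
      by (rule has_vector_derivative_of_real)
  qed (auto intro!: continuous_intros simp del: of_real_mult of_real_power of_real_add)
  have pV: "primitive 0 1 V V'"
    unfolding V_def V'_def by (intro primitive_add primitive_mult GH FG t d1)
  have pP: "primitive 0 1 P P'"
    unfolding P_def P'_def
    by (intro primitive_diff primitive_mult primitive_cmult primitive_cnj pV FG t d2 d3)
  have pB: "primitive 0 1 (\<lambda>y. c y * P y) (\<lambda>y. c' y * P y + c y * P' y)"
    by (rule primitive_mult[OF pc pP])
  define \<alpha> where "\<alpha> = s * exp s / (2 * L\<^sup>2)"
  define K where "K y = of_real m * (c' y * P y + c y * P' y) + of_real \<alpha> * (G t y * cnj (G t y))" for y
  have iK: "integrable (dx 0 1) K"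
    unfolding K_def
    by (intro Bochner_Integration.integrable_add integrable_mult_right primitive_integrable[OF pB] GG_integrable t)
  have "Re (integral\<^sup>L (dx 0 1) K) \<le> Re (integral\<^sup>L (dx 0 1) J)"
  proof (rule Re_integral_mono[OF iK iJ])
    fix y assume "y \<in> space (dx 0 1)"
    then have y: "y \<in> {0<..<1}" by simp
    let ?cc = "carleman_weight s y"
    let ?A = "- of_real (2 * (k * m)) * (- \<i> * of_real (2 * s * (1 + y)) * (G t y * cnj (F t y)) - of_real k * (F t y * cnj (F t y)))
             - \<i> * of_real (2 * s) * (of_real (1 + y) * (G t y * cnj (W t y) - cnj (G t y) * W t y) - of_real (1 + 2 * s * (1 + y)\<^sup>2) * (cnj (F t y) * W t y))
             - of_real k * (W t y * cnj (F t y) + F t y * cnj (W t y))"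
    have "m * Re (P' y + of_real (2 * s * (1 + y)) * P y) + s * m / 2 * (cmod (G t y))\<^sup>2 \<le> Re ?A - k' * (cmod (F t y))\<^sup>2"
    proof -
      have br: "(l' t / l t * y)\<^sup>2 \<le> B\<^sup>2 * m"
      proof -
        have "(l' t * y)\<^sup>2 \<le> (B * 1)\<^sup>2"
          using y l'_bounds[OF t] B_nonneg by (intro power_mono mult_mono) auto
        then show ?thesis using l by (simp add: m_def power_mult_distrib power_divide divide_right_mono)
      qed
      have "3 * s * (1 / L\<^sup>2) \<le> 3 * s * m" "3 * s\<^sup>2 * (1 / L\<^sup>2) \<le> 3 * s\<^sup>2 * m"
        using s m by (intro mult_left_mono; simp)+
      then have ms: "B\<^sup>2 \<le> 3 * s * m" "B\<^sup>2 * s + K2 \<le> 3 * s\<^sup>2 * m" using s1 s2 by auto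
      have q: "1 \<le> 1 + y" using y by simp
      have Weq: "W t y = \<i> * of_real m * H t y + of_real (l' t / l t * y) * G t y"
        unfolding m_def by (rule W_eq[OF t y])
      have P'y: "P' y = - of_real (2 * s) * (V y * cnj (V y)) - of_real (2 * s * (1 + y)) * (V' y * cnj (V y) + V y * cnj (V' y))
        - (of_real (2 * s) + \<i> * of_real (2 * k)) * (cnj (G t y) * V y + cnj (F t y) * V' y)
        - of_real (6 * s ^ 3 * (1 + y)\<^sup>2) * (F t y * cnj (F t y)) - of_real (2 * s ^ 3 * (1 + y) ^ 3) * (G t y * cnj (F t y) + F t y * cnj (G t y))"
        by (simp only: P'_def add_uminus_conv_diff mult_minus_left diff_diff_eq add_ac)
      show ?thesis
        unfolding P'y unfolding P_def V_def V'_def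
        by (rule carleman_pointwise[where k=k and F="F t y" and H="H t y", OF s m(1) q br ms k' Weq])
    qed
    then have 1: "?cc * (m * Re (P' y + of_real (2 * s * (1 + y)) * P y) + s * m / 2 * (cmod (G t y))\<^sup>2)
        \<le> ?cc * (Re ?A - k' * (cmod (F t y))\<^sup>2)"
      by (intro mult_left_mono) (simp_all add: carleman_weight_def)
    have 2: "\<alpha> \<le> ?cc * (s * m / 2)"
    proof -
      have "s * 1 \<le> s * (1 + y)\<^sup>2" using y s by (intro mult_left_mono) (auto simp: one_le_power)
      then have "exp s \<le> ?cc" by (simp add: carleman_weight_def)
      moreover have "0 \<le> ?cc" by (simp add: carleman_weight_def)
      ultimately have "exp s * (s * (1 / L\<^sup>2) / 2) \<le> ?cc * (s * m / 2)"
        using s m by (intro mult_mono divide_right_mono mult_left_mono) auto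
      then show ?thesis by (simp add: \<alpha>_def mult.commute)
    qed
    have "Re (K y) = ?cc * (m * Re (P' y + of_real (2 * s * (1 + y)) * P y)) + \<alpha> * (cmod (G t y))\<^sup>2"
    proof -
      have "K y = of_real (?cc * m) * (P' y + of_real (2 * s * (1 + y)) * P y) + of_real (\<alpha> * (cmod (G t y))\<^sup>2)"
        unfolding K_def c'_def c_def of_real_mult[of \<alpha>] complex_norm_square by (simp add: algebra_simps)
      then show ?thesis by (simp only: plus_complex.sel Re_complex_of_real mult.assoc) simp
    qed
    also have "\<dots> \<le> ?cc * (m * Re (P' y + of_real (2 * s * (1 + y)) * P y) + s * m / 2 * (cmod (G t y))\<^sup>2)"
      using mult_right_mono[OF 2, of "(cmod (G t y))\<^sup>2"] by (simp add: algebra_simps)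
    also note 1
    also have "?cc * (Re ?A - k' * (cmod (F t y))\<^sup>2) = Re (J y)"
    proof -
      have "J y = of_real ?cc * ?A - of_real (?cc * k' * (cmod (F t y))\<^sup>2)"
        unfolding J_def a_def a'_def c_def of_real_mult[of "?cc * k'"] complex_norm_square by (simp add: algebra_simps)
      then have "Re (J y) = Re (of_real ?cc * ?A) - ?cc * k' * (cmod (F t y))\<^sup>2"
        by (simp only: minus_complex.sel Re_complex_of_real)
      also have "Re (of_real ?cc * ?A) = ?cc * Re ?A"
        by (simp only: times_complex.sel Re_complex_of_real Im_complex_of_real mult_zero_left diff_zero)
      finally show ?thesis by (simp only: right_diff_distrib mult.assoc)
    qed
    finally show "Re (K y) \<le> Re (J y)" .
  qed
  moreover have "Re (integral\<^sup>L (dx 0 1) K) \<ge> \<alpha> * energy t - 4 * s * exp (4 * s) * (cmod (G t 1))\<^sup>2"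
  proof -
    have "integral\<^sup>L (dx 0 1) K = of_real m * (c 1 * P 1 - c 0 * P 0) + of_real \<alpha> * of_real (energy t)"
      unfolding K_def of_real_energy
      by (simp only: Bochner_Integration.integral_add integrable_mult_right integral_mult_right_zero
          primitive_integrable[OF pB] GG_integrable[OF t] primitive_FTC[OF pB zero_le_one])
    moreover have "P 1 = of_real (- 4 * s * (cmod (G t 1))\<^sup>2)"
      unfolding of_real_mult[of "- 4 * s"] complex_norm_square by (simp add: P_def V_def F_1[OF t])
    moreover have "P 0 = of_real (- 2 * s * (cmod (G t 0))\<^sup>2)"
      unfolding of_real_mult[of "- 2 * s"] complex_norm_square by (simp add: P_def V_def F_0[OF t])
    moreover have "c 1 = of_real (exp (4 * s))" "c 0 = of_real (exp s)"
      by (simp_all add: c_def carleman_weight_def mult.commute)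
    ultimately have "integral\<^sup>L (dx 0 1) K = of_real (m * (exp (4 * s) * (- 4 * s * (cmod (G t 1))\<^sup>2)
         - exp s * (- 2 * s * (cmod (G t 0))\<^sup>2)) + \<alpha> * energy t)"
      by (simp only: of_real_add of_real_mult of_real_diff)
    then have "Re (integral\<^sup>L (dx 0 1) K) = m * (exp (4 * s) * (- 4 * s * (cmod (G t 1))\<^sup>2)
         - exp s * (- 2 * s * (cmod (G t 0))\<^sup>2)) + \<alpha> * energy t"
      by (simp only: Re_complex_of_real)
    moreover have "m * (4 * s * exp (4 * s) * (cmod (G t 1))\<^sup>2) \<le> 1 * (4 * s * exp (4 * s) * (cmod (G t 1))\<^sup>2)"
      using m s by (intro mult_right_mono) auto
    moreover have "0 \<le> m * (exp s * (2 * s * (cmod (G t 0))\<^sup>2))"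
      using m s by auto
    ultimately show ?thesis by (simp add: algebra_simps)
  qed
  ultimately show ?thesis
    using ReJ unfolding \<alpha>_def m_def by linarith
qed

end

section \<open>Observability of classical solutions\<close>

text \<open>
  How large \<open>s\<close> must be. The conditions on \<open>B\<^sup>2\<close> let the squares absorb the lower-order terms, where the
  constant in parentheses, times \<open>s\<close>, bounds the time derivative of \<open>s l\<^sup>2 \<eta>'\<close>. The last condition makes
  the functional at the end points of the time interval, which is at most \<open>exp (- 4 s) s (4 + 16 L\<^sup>2/\<tau>)\<close>
  times the energy, small against the contribution of the middle of the interval.
\<close>

definition carleman_threshold :: "real \<Rightarrow> real \<Rightarrow> real \<Rightarrow> real \<Rightarrow> bool" where
  "carleman_threshold \<tau> L B s \<longleftrightarrow> 1 \<le> s \<and> B\<^sup>2 \<le> 3 * s / L\<^sup>2 \<and>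
     B\<^sup>2 * s + (32 * L * B / \<tau> + 32 * L\<^sup>2 / \<tau>\<^sup>2) \<le> 3 * s\<^sup>2 / L\<^sup>2 \<and>
     (4 + 16 * L\<^sup>2 / \<tau>) * (1 + L) * exp (- (3 * s)) \<le> \<tau> / (8 * L\<^sup>2)"

lemma carleman_threshold_exists:
  assumes "0 < \<tau>" "1 \<le> L" "0 \<le> B"
  shows "\<exists>s. carleman_threshold \<tau> L B s"
proof -
  define K2 where "K2 = 32 * L * B / \<tau> + 32 * L\<^sup>2 / \<tau>\<^sup>2"
  define C where "C = (4 + 16 * L\<^sup>2 / \<tau>) * (1 + L)"
  define s where "s = 1 + (B\<^sup>2 + K2) * L\<^sup>2 + C * (8 * L\<^sup>2) / \<tau>"
  have nn: "0 \<le> K2" "0 \<le> C" "0 \<le> (B\<^sup>2 + K2) * L\<^sup>2" "0 \<le> C * (8 * L\<^sup>2) / \<tau>"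
    unfolding K2_def C_def using assms by auto
  have s1: "1 \<le> s" using nn by (simp add: s_def)
  have s2: "(B\<^sup>2 + K2) * L\<^sup>2 \<le> 3 * s" using nn by (simp add: s_def)
  have s3: "C * (8 * L\<^sup>2) / \<tau> \<le> s" using nn by (simp add: s_def)
  have a: "B\<^sup>2 + K2 \<le> 3 * s / L\<^sup>2" using s2 assms by (simp add: pos_le_divide_eq)
  have "(B\<^sup>2 + K2) * s \<le> 3 * s / L\<^sup>2 * s" using a s1 by (intro mult_right_mono) auto
  moreover have "K2 * 1 \<le> K2 * s" using nn s1 by (intro mult_left_mono) auto
  ultimately have b: "B\<^sup>2 * s + K2 \<le> 3 * s\<^sup>2 / L\<^sup>2" by (simp add: algebra_simps power2_eq_square)
  have "C * (8 * L\<^sup>2) / \<tau> \<le> exp (3 * s)"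
    using s3 s1 exp_ge_add_one_self[of "3 * s"] by linarith
  then have c: "C * exp (- (3 * s)) \<le> \<tau> / (8 * L\<^sup>2)"
    using assms by (simp add: exp_minus field_simps)
  show ?thesis
    unfolding carleman_threshold_def using s1 a b c nn unfolding K2_def C_def by (intro exI[of _ s]) auto
qed

context moving_interval_solution
begin

text \<open>
  The energy at time 0 is recovered from the derivative at the moving end alone.
\<close>

lemma observability:
  assumes s: "carleman_threshold \<tau> L B s"
  shows "\<tau> / (8 * L\<^sup>2) * energy 0 \<le>
    (4 * exp (5 * s) + \<tau> * B / (4 * L\<^sup>2)) * integral {0..\<tau>} (\<lambda>t. (cmod (G t 1))\<^sup>2)"
proof -
  define K2 where "K2 = 32 * L * B / \<tau> + 32 * L\<^sup>2 / \<tau>\<^sup>2"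
  define C1 where "C1 = 4 + 16 * L\<^sup>2 / \<tau>"
  have s1: "1 \<le> s" and sB: "B\<^sup>2 \<le> 3 * s / L\<^sup>2" and sK: "B\<^sup>2 * s + K2 \<le> 3 * s\<^sup>2 / L\<^sup>2"
    and sC: "C1 * (1 + L) * exp (- (3 * s)) \<le> \<tau> / (8 * L\<^sup>2)"
    using s unfolding carleman_threshold_def K2_def C1_def by auto
  let ?p = "\<lambda>t. (cmod (G t 1))\<^sup>2"
  define I where "I = integral {0..\<tau>} ?p"
  have pI: "?p integrable_on {0..\<tau>}"
    by (intro integrable_continuous_real trace_power2_continuous) auto
  have I0: "0 \<le> I" unfolding I_def by (rule integral_nonneg[OF pI]) simp
  define \<alpha> where "\<alpha> = s * exp s / (2 * L\<^sup>2)"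
  define \<beta> where "\<beta> = 4 * s * exp (4 * s)"
  have \<alpha>0: "0 \<le> \<alpha>" and \<beta>0: "0 \<le> \<beta>" using s1 by (auto simp: \<alpha>_def \<beta>_def)
  define M where "M = energy 0 - B * I"
  have EM: "M \<le> energy t" if "t \<in> {0..\<tau>}" for t
    unfolding M_def I_def by (rule energy_lower[OF that])
  \<comment> \<open>\<open>M\<close> is a lower bound for the energy at all times; if it is not positive, the claim is immediate.\<close>
  show ?thesis
  proof (cases "M \<le> 0")
    case True
    have "\<tau> / (8 * L\<^sup>2) * energy 0 \<le> \<tau> / (8 * L\<^sup>2) * (B * I)"
      using True tau by (intro mult_left_mono) (auto simp: M_def)
    also have "\<dots> = (\<tau> * B / (8 * L\<^sup>2)) * I" by simp
    also have "\<dots> \<le> (4 * exp (5 * s) + \<tau> * B / (4 * L\<^sup>2)) * I"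
    proof (rule mult_right_mono[OF _ I0])
      have "\<tau> * B / (8 * L\<^sup>2) \<le> \<tau> * B / (4 * L\<^sup>2)"
        using tau B_nonneg L_ge_1 by (intro divide_left_mono) auto
      then show "\<tau> * B / (8 * L\<^sup>2) \<le> 4 * exp (5 * s) + \<tau> * B / (4 * L\<^sup>2)"
        by (simp add: add_increasing)
    qed
    finally show ?thesis by (simp add: I_def)
  next
    case False
    define a where "a = (\<lambda>y. complex_of_real ((1 + y) * carleman_weight s y))"
    define a' where "a' = (\<lambda>y. complex_of_real ((1 + 2 * s * (1 + y)\<^sup>2) * carleman_weight s y))"
    define c where "c = (\<lambda>y. complex_of_real (carleman_weight s y))"
    have a_der: "(a has_vector_derivative a' y) (at y within {0..1})" for y
      unfolding a_def a'_def by (rule carleman_weight_derivatives)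
    have cont: "continuous_on {0..1} a" "continuous_on {0..1} a'" "continuous_on {0..1} c"
      unfolding a_def a'_def c_def by (intro continuous_intros carleman_weight_continuous)+
    have c_le: "carleman_weight s y \<le> exp (4 * s)" "0 \<le> carleman_weight s y" if "y \<in> {0..1}" for y
    proof -
      have "(1 + y)\<^sup>2 \<le> 2\<^sup>2" using that by (intro power_mono) auto
      then have "s * (1 + y)\<^sup>2 \<le> s * 4" using s1 by (intro mult_left_mono) auto
      then show "carleman_weight s y \<le> exp (4 * s)" by (simp add: carleman_weight_def mult.commute)
    qed (simp add: carleman_weight_def)
    define N where "N t = Im (LINT y|dx 0 1. a y * (G t y * cnj (F t y)))" for t
    define N' where "N' t = Im (LINT y|dx 0 1. a y * (G t y * cnj (W t y) - cnj (G t y) * W t y) - a' y * (cnj (F t y) * W t y))" for t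
    define Q where "Q t = Re (LINT y|dx 0 1. c y * (F t y * cnj (F t y)))" for t
    define Q' where "Q' t = Re (LINT y|dx 0 1. c y * (W t y * cnj (F t y) + F t y * cnj (W t y)))" for t
    have N_der: "(N has_real_derivative N' t) (at t within {0..\<tau>})" if "t \<in> {0..\<tau>}" for t
      unfolding N_def N'_def by (rule current_derivative[OF that a_der cont(2)])
    have Q_der: "(Q has_real_derivative Q' t) (at t within {0..\<tau>})" if "t \<in> {0..\<tau>}" for t
      unfolding Q_def Q'_def by (rule mass_derivative[OF that cont(3)])
    have N_le: "\<bar>N t\<bar> \<le> 2 * exp (4 * s) * energy t" if t: "t \<in> {0..\<tau>}" for t
    proof -
      have "cmod (LINT y|dx 0 1. a y * (G t y * cnj (F t y))) \<le> 2 * exp (4 * s) * energy t"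
      proof (rule current_bound[OF t cont(1) _ t])
        fix y :: real assume y: "y \<in> {0..1}"
        have "(1 + y) * carleman_weight s y \<le> 2 * exp (4 * s)"
          using y c_le[OF y] by (intro mult_mono) auto
        then show "cmod (a y) \<le> 2 * exp (4 * s)"
          using y c_le[OF y] unfolding a_def norm_of_real by (simp add: abs_mult)
      qed
      then show ?thesis unfolding N_def using abs_Im_le_cmod order_trans by blast
    qed
    have Q_le: "\<bar>Q t\<bar> \<le> exp (4 * s) * energy t" if t: "t \<in> {0..\<tau>}" for t
    proof -
      have "cmod (LINT y|dx 0 1. c y * (F t y * cnj (F t y))) \<le> exp (4 * s) * energy t"
        by (rule mass_bound[OF t cont(3) _ t t]) (use c_le in \<open>auto simp: c_def\<close>)
      then show ?thesis unfolding Q_def using abs_Re_le_cmod order_trans by blast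
    qed
    \<comment> \<open>The factor 16 makes \<open>\<eta>\<close> equal to 4 at both ends and at most 1 on the middle half.\<close>
    define \<eta> where "\<eta> t = 16 * (t / \<tau> - 1/2)\<^sup>2" for t
    define \<eta>' where "\<eta>' t = 32 / \<tau> * (t / \<tau> - 1/2)" for t
    have \<eta>_der: "(\<eta> has_real_derivative \<eta>' t) (at t within {0..\<tau>})" for t
      unfolding \<eta>_def[abs_def] \<eta>'_def using tau by (auto intro!: derivative_eq_intros)
    have \<eta>'_der: "(\<eta>' has_real_derivative 32 / \<tau>\<^sup>2) (at t within {0..\<tau>})" for t
      unfolding \<eta>'_def[abs_def] using tau by (auto intro!: derivative_eq_intros simp: power2_eq_square)
    have \<eta>'_le: "\<bar>\<eta>' t\<bar> \<le> 16 / \<tau>" if t: "t \<in> {0..\<tau>}" for t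
    proof -
      have "\<bar>t / \<tau> - 1/2\<bar> \<le> 1/2" using t tau by (auto simp: abs_le_iff field_simps)
      then have "32 / \<tau> * \<bar>t / \<tau> - 1/2\<bar> \<le> 32 / \<tau> * (1/2)" using tau by (intro mult_left_mono) auto
      moreover have "\<bar>\<eta>' t\<bar> = 32 / \<tau> * \<bar>t / \<tau> - 1/2\<bar>"
        unfolding \<eta>'_def abs_mult using tau by simp
      ultimately show ?thesis by simp
    qed
    define \<kappa> where "\<kappa> t = s * (l t)\<^sup>2 * \<eta>' t" for t
    define \<kappa>' where "\<kappa>' t = s * (2 * l t * l' t * \<eta>' t + (l t)\<^sup>2 * (32 / \<tau>\<^sup>2))" for t
    have \<kappa>_der: "(\<kappa> has_real_derivative \<kappa>' t) (at t within {0..\<tau>})" if t: "t \<in> {0..\<tau>}" for t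
      unfolding \<kappa>_def[abs_def] \<kappa>'_def
      by (auto intro!: derivative_eq_intros l_deriv[OF t] \<eta>'_der simp: algebra_simps power2_eq_square)
    have l: "1 \<le> l t" "l t \<le> L" "(l t)\<^sup>2 \<le> L\<^sup>2" if t: "t \<in> {0..\<tau>}" for t
      using l_bounds[OF t] by (auto intro: power_mono)
    have \<kappa>_le: "\<bar>\<kappa> t\<bar> \<le> s * (16 * L\<^sup>2 / \<tau>)" if t: "t \<in> {0..\<tau>}" for t
    proof -
      have "(l t)\<^sup>2 * \<bar>\<eta>' t\<bar> \<le> L\<^sup>2 * (16 / \<tau>)"
        by (intro mult_mono l \<eta>'_le t) auto
      then have "s * ((l t)\<^sup>2 * \<bar>\<eta>' t\<bar>) \<le> s * (L\<^sup>2 * (16 / \<tau>))" using s1 by (intro mult_left_mono) auto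
      then show ?thesis using s1 by (simp add: \<kappa>_def abs_mult mult_ac)
    qed
    have \<kappa>'_le: "\<bar>\<kappa>' t\<bar> \<le> K2 * s" if t: "t \<in> {0..\<tau>}" for t
    proof -
      have "\<bar>2 * l t * l' t * \<eta>' t\<bar> = 2 * (l t * l' t * \<bar>\<eta>' t\<bar>)"
        using l[OF t] l'_bounds[OF t] by (simp add: abs_mult)
      also have "l t * l' t * \<bar>\<eta>' t\<bar> \<le> L * B * (16 / \<tau>)"
        using l[OF t] l'_bounds[OF t] L_ge_1 B_nonneg by (intro mult_mono \<eta>'_le t) auto
      finally have 1: "\<bar>2 * l t * l' t * \<eta>' t\<bar> \<le> 32 * L * B / \<tau>" by simp
      have "(l t)\<^sup>2 * (32 / \<tau>\<^sup>2) \<le> L\<^sup>2 * (32 / \<tau>\<^sup>2)"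
        by (intro mult_right_mono l t) simp
      then have 2: "\<bar>(l t)\<^sup>2 * (32 / \<tau>\<^sup>2)\<bar> \<le> 32 * L\<^sup>2 / \<tau>\<^sup>2"
        by (simp add: mult.commute)
      have "\<bar>2 * l t * l' t * \<eta>' t + (l t)\<^sup>2 * (32 / \<tau>\<^sup>2)\<bar> \<le> \<bar>2 * l t * l' t * \<eta>' t\<bar> + \<bar>(l t)\<^sup>2 * (32 / \<tau>\<^sup>2)\<bar>"
        by (rule abs_triangle_ineq)
      also have "\<dots> \<le> K2" unfolding K2_def by (rule add_mono[OF 1 2])
      finally have "s * \<bar>2 * l t * l' t * \<eta>' t + (l t)\<^sup>2 * (32 / \<tau>\<^sup>2)\<bar> \<le> s * K2"
        using s1 by (intro mult_left_mono) auto
      then show ?thesis using s1 unfolding \<kappa>'_def abs_mult[of s] by (simp add: mult.commute)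
    qed
    \<comment> \<open>\<open>D\<close> is the functional \<open>\<langle>S z, z\<rangle>\<close> of the Carleman argument.\<close>
    define w where "w t = exp (- (2 * s * \<eta> t))" for t
    define D where "D t = w t * (2 * s * N t - \<kappa> t * Q t)" for t
    define D' where "D' t = w t * (- 2 * s * \<eta>' t * (2 * s * N t - \<kappa> t * Q t) + 2 * s * N' t - \<kappa>' t * Q t - \<kappa> t * Q' t)" for t
    have "(D has_real_derivative D' t) (at t within {0..\<tau>})" if t: "t \<in> {0..\<tau>}" for t
      unfolding D_def[abs_def] D'_def w_def
      by (auto intro!: derivative_eq_intros N_der[OF t] Q_der[OF t] \<kappa>_der[OF t] \<eta>_der simp: algebra_simps)
    then have D_int: "(D' has_integral (D \<tau> - D 0)) {0..\<tau>}"
      using tau by (intro fundamental_theorem_of_calculus)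
        (auto simp: has_real_derivative_iff_has_vector_derivative)
    have D'_ge: "w t * (\<alpha> * energy t - \<beta> * ?p t) \<le> D' t" if t: "t \<in> {0..\<tau>}" for t
    proof -
      have "\<kappa> t * (1 / (l t)\<^sup>2) = s * \<eta>' t" using l[OF t] by (simp add: \<kappa>_def)
      then have "\<alpha> * energy t - \<beta> * ?p t \<le> - 2 * s * \<eta>' t * (2 * s * N t - \<kappa> t * Q t) + 2 * s * N' t - \<kappa>' t * Q t - \<kappa> t * Q' t"
        using carleman_fixed_time[OF t s1 sB sK \<kappa>'_le[OF t], of "\<kappa> t"]
        unfolding N_def N'_def Q_def Q'_def a_def a'_def c_def \<alpha>_def \<beta>_def by (simp only: mult.assoc)
      then show ?thesis unfolding D'_def by (intro mult_left_mono) (auto simp: w_def)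
    qed
    have \<eta>_nonneg: "0 \<le> \<eta> t" for t by (simp add: \<eta>_def)
    have w_le: "w t \<le> 1" "0 \<le> w t" for t
      using s1 \<eta>_nonneg by (auto simp: w_def)
    have w_mid: "exp (- (2 * s)) \<le> w t" if "t \<in> {\<tau>/4..3*\<tau>/4}" for t
    proof -
      have "1/4 \<le> t / \<tau>" "t / \<tau> \<le> 3/4" using that tau by (simp_all add: field_simps)
      then have "\<bar>t / \<tau> - 1/2\<bar> \<le> \<bar>1/4\<bar>" by linarith
      then have "(t / \<tau> - 1/2)\<^sup>2 \<le> (1/4)\<^sup>2" by (simp only: abs_le_square_iff)
      then have "\<eta> t \<le> 1" unfolding \<eta>_def by (simp add: power_divide)
      then have "s * \<eta> t \<le> s * 1" using s1 by (intro mult_left_mono) auto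
      then show ?thesis by (simp add: w_def)
    qed
    have lower: "exp (- (2 * s)) * \<alpha> * M * (\<tau> / 2) - \<beta> * I \<le> D \<tau> - D 0"
    proof (rule has_integral_le[OF _ D_int])
      let ?S = "{\<tau>/4..3*\<tau>/4}"
      have "((\<lambda>t. exp (- (2 * s)) * \<alpha> * M) has_integral (exp (- (2 * s)) * \<alpha> * M * (\<tau> / 2))) ?S"
        using has_integral_const_real[of "exp (- (2 * s)) * \<alpha> * M" "\<tau>/4" "3*\<tau>/4"] tau by (simp add: mult.commute)
      then have "((\<lambda>t. if t \<in> ?S then exp (- (2 * s)) * \<alpha> * M else 0) has_integral (exp (- (2 * s)) * \<alpha> * M * (\<tau> / 2))) {0..\<tau>}"
        using tau by (subst has_integral_restrict) auto
      moreover have "((\<lambda>t. \<beta> * ?p t) has_integral (\<beta> * I)) {0..\<tau>}"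
        unfolding I_def by (intro has_integral_mult_right integrable_integral pI)
      ultimately show "((\<lambda>t. (if t \<in> ?S then exp (- (2 * s)) * \<alpha> * M else 0) - \<beta> * ?p t) has_integral
          (exp (- (2 * s)) * \<alpha> * M * (\<tau> / 2) - \<beta> * I)) {0..\<tau>}"
        by (rule has_integral_diff)
      fix t assume t: "t \<in> {0..\<tau>}"
      have 1: "(if t \<in> ?S then exp (- (2 * s)) * \<alpha> * M else 0) \<le> w t * (\<alpha> * energy t)"
      proof (cases "t \<in> ?S")
        case True
        have "exp (- (2 * s)) * (\<alpha> * M) \<le> w t * (\<alpha> * energy t)"
          using False \<alpha>0 by (intro mult_mono w_mid[OF True] mult_left_mono EM[OF t] w_le mult_nonneg_nonneg) auto
        then show ?thesis using True by (simp add: mult.assoc)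
      qed (use \<alpha>0 energy_nonneg w_le in \<open>auto intro!: mult_nonneg_nonneg\<close>)
      have 2: "w t * (\<beta> * ?p t) \<le> 1 * (\<beta> * ?p t)"
        using \<beta>0 w_le by (intro mult_right_mono) auto
      have 3: "w t * (\<alpha> * energy t - \<beta> * ?p t) = w t * (\<alpha> * energy t) - w t * (\<beta> * ?p t)"
        by (rule right_diff_distrib)
      show "(if t \<in> ?S then exp (- (2 * s)) * \<alpha> * M else 0) - \<beta> * ?p t \<le> D' t"
        using 1 2 3 D'_ge[OF t] by linarith
    qed
    have D_le: "\<bar>D t\<bar> \<le> exp (- (4 * s)) * s * C1 * energy t" if t: "t = 0 \<or> t = \<tau>" for t
    proof -
      have t': "t \<in> {0..\<tau>}" using t tau by auto
      have "\<eta> t = 4" using t tau by (auto simp: \<eta>_def power2_eq_square)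
      then have w: "w t = exp (- (8 * s))" by (simp add: w_def)
      have "\<bar>2 * s * N t - \<kappa> t * Q t\<bar> \<le> 2 * s * \<bar>N t\<bar> + \<bar>\<kappa> t\<bar> * \<bar>Q t\<bar>"
        using s1 abs_triangle_ineq4[of "2 * s * N t" "\<kappa> t * Q t"] by (simp add: abs_mult)
      also have "\<dots> \<le> 2 * s * (2 * exp (4 * s) * energy t) + s * (16 * L\<^sup>2 / \<tau>) * (exp (4 * s) * energy t)"
        using s1 tau by (intro add_mono mult_mono N_le Q_le \<kappa>_le t') auto
      also have "\<dots> = exp (4 * s) * (s * C1 * energy t)"
        by (simp add: C1_def algebra_simps)
      finally have "\<bar>D t\<bar> \<le> exp (- (8 * s)) * (exp (4 * s) * (s * C1 * energy t))"
        unfolding D_def w abs_mult abs_exp_cancel by (rule mult_left_mono) simp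
      also have "\<dots> = exp (- (4 * s)) * (s * C1 * energy t)"
        unfolding mult.assoc[symmetric] exp_add[symmetric] by simp
      finally show ?thesis by (simp add: mult.assoc)
    qed
    have C1: "0 \<le> C1" using tau by (simp add: C1_def)
    have "D \<tau> - D 0 \<le> \<bar>D \<tau>\<bar> + \<bar>D 0\<bar>" by simp
    also have "\<dots> \<le> exp (- (4 * s)) * s * C1 * energy \<tau> + exp (- (4 * s)) * s * C1 * energy 0"
      by (intro add_mono D_le) auto
    also have "\<dots> \<le> exp (- (4 * s)) * s * C1 * (L * energy 0) + exp (- (4 * s)) * s * C1 * energy 0"
      using s1 C1 tau by (intro add_mono mult_left_mono energy_upper) auto
    finally have "exp (- (2 * s)) * \<alpha> * M * (\<tau> / 2) \<le> exp (- (4 * s)) * s * C1 * (1 + L) * energy 0 + \<beta> * I"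
      using lower by (simp add: algebra_simps)
    moreover have "exp (- (2 * s)) * \<alpha> * M * (\<tau> / 2) = (s * exp (- s)) * (\<tau> / (4 * L\<^sup>2) * M)"
    proof -
      have "exp (- (2 * s)) * exp s = exp (- s)" by (simp add: exp_add[symmetric])
      then have "exp (- s) = exp (- (2 * s)) * exp s" by simp
      then show ?thesis unfolding \<alpha>_def by simp
    qed
    moreover have "exp (- (4 * s)) * s * C1 * (1 + L) * energy 0 = (s * exp (- s)) * (C1 * (1 + L) * exp (- (3 * s)) * energy 0)"
    proof -
      have "exp (- (4 * s)) = exp (- s) * exp (- (3 * s))" by (simp add: exp_add[symmetric])
      then show ?thesis by simp
    qed
    moreover have "\<beta> * I = (s * exp (- s)) * (4 * exp (5 * s) * I)"
    proof -
      have "exp (4 * s) = exp (- s) * exp (5 * s)" by (simp add: exp_add[symmetric])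
      then show ?thesis by (simp add: \<beta>_def)
    qed
    \<comment> \<open>After division by \<open>s exp (- s)\<close> only the factor \<open>exp (- 3 s)\<close> is left in front of the energy.\<close>
    ultimately have "(s * exp (- s)) * (\<tau> / (4 * L\<^sup>2) * M) \<le> (s * exp (- s)) * (C1 * (1 + L) * exp (- (3 * s)) * energy 0 + 4 * exp (5 * s) * I)"
      by (simp only: distrib_left)
    then have "\<tau> / (4 * L\<^sup>2) * M \<le> C1 * (1 + L) * exp (- (3 * s)) * energy 0 + 4 * exp (5 * s) * I"
      by (rule mult_left_le_imp_le) (use s1 in simp)
    also have "C1 * (1 + L) * exp (- (3 * s)) * energy 0 \<le> \<tau> / (8 * L\<^sup>2) * energy 0"
      by (rule mult_right_mono[OF sC energy_nonneg])
    finally have "\<tau> / (4 * L\<^sup>2) * M \<le> \<tau> / (8 * L\<^sup>2) * energy 0 + 4 * exp (5 * s) * I" by simp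
    moreover have "\<tau> / (4 * L\<^sup>2) * M = 2 * (\<tau> / (8 * L\<^sup>2) * energy 0) - \<tau> * B / (4 * L\<^sup>2) * I"
      by (simp add: M_def diff_divide_distrib algebra_simps)
    ultimately show ?thesis unfolding I_def[symmetric] distrib_right by linarith
  qed
qed

end

section \<open>From the evolution family to classical solutions\<close>

lemma primitive_has_derivative:
  assumes F: "primitive a b F f" and f: "continuous_on {a..b} f" and x: "x \<in> {a..b}"
  shows "(F has_vector_derivative f x) (at x within {a..b})"
proof -
  have ab: "a \<le> b" using x by simp
  define K where "K x = integral {a..x} f" for x
  have K: "(K has_vector_derivative f y) (at y within {a..b})" if "y \<in> {a..b}" for y
    unfolding K_def by (rule integral_has_vector_derivative[OF f that])
  have p: "primitive a b (\<lambda>x. F x - K x) (\<lambda>x. f x - f x)"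
    by (intro primitive_diff F primitive_C1[OF ab K f])
  have FK: "F y = K y + (F a - K a)" if "y \<in> {a..b}" for y
    using primitive_eq[OF p that] by (simp add: algebra_simps)
  have D: "((\<lambda>y. K y + (F a - K a)) has_vector_derivative f x) (at x within {a..b})"
    using has_vector_derivative_add[OF K[OF x] has_vector_derivative_const] by simp
  show ?thesis
    by (rule has_vector_derivative_transform[OF x _ D]) (rule FK)
qed

text \<open>
  Null sets are preserved under scaling.
\<close>

lemma AE_dx_scale:
  assumes l: "0 < l" and P: "AE y in dx 0 1. P y"
  shows "AE x in dx 0 l. P (x / l)"
proof -
  have "AE y in lebesgue. y \<in> {0<..<1} \<longrightarrow> P y"
    using P by (subst (asm) AE_restrict_space_iff) auto
  then have "\<exists>N. negligible N \<and> {y. \<not> (y \<in> {0<..<1} \<longrightarrow> P y)} \<subseteq> N"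
    by (simp only: eventually_ae_filter_negligible)
  then obtain N where N: "negligible N" "{y. \<not> (y \<in> {0<..<1} \<longrightarrow> P y)} \<subseteq> N"
    by (elim exE conjE)
  have "negligible ((\<lambda>y. l * y) ` N)"
    by (rule negligible_differentiable_image_negligible[OF _ N(1)])
       (auto intro!: derivative_intros simp: differentiable_on_def)
  moreover have "{x. \<not> (x \<in> {0<..<l} \<longrightarrow> P (x / l))} \<subseteq> (\<lambda>y. l * y) ` N"
  proof
    fix x assume x: "x \<in> {x. \<not> (x \<in> {0<..<l} \<longrightarrow> P (x / l))}"
    then have "x / l \<in> {y. \<not> (y \<in> {0<..<1} \<longrightarrow> P y)}" using l by auto
    then have "x / l \<in> N" using N(2) by blast
    then show "x \<in> (\<lambda>y. l * y) ` N" using l by (intro image_eqI[of _ _ "x / l"]) auto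
  qed
  ultimately have "AE x in lebesgue. x \<in> {0<..<l} \<longrightarrow> P (x / l)"
    unfolding eventually_ae_filter_negligible by blast
  then show ?thesis by (subst AE_restrict_space_iff) auto
qed

lemma L2_cong_AE:
  assumes f: "f \<in> L2 a b" and eq: "AE x in dx a b. f x = g x"
  shows "g \<in> L2 a b"
proof -
  have g: "g \<in> borel_measurable (dx a b)"
  proof -
    have iff: "h \<in> borel_measurable (dx a b) \<longleftrightarrow> (\<lambda>x. indicator {a<..<b} x *\<^sub>R h x) \<in> borel_measurable lebesgue"
      for h :: "real \<Rightarrow> complex"
      by (rule borel_measurable_restrict_space_iff) simp
    have "AE x in lebesgue. x \<in> {a<..<b} \<longrightarrow> f x = g x"
      using eq by (subst (asm) AE_restrict_space_iff) auto
    then have "AE x in lebesgue. indicator {a<..<b} x *\<^sub>R f x = indicator {a<..<b} x *\<^sub>R g x"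
      by eventually_elim (auto simp: indicator_def)
    then show ?thesis
      unfolding iff using L2_measurable[OF f, unfolded iff] by (rule borel_measurable_AE[rotated])
  qed
  moreover have "integrable (dx a b) (\<lambda>x. (cmod (g x))\<^sup>2)"
    by (rule integrable_cong_AE_imp[OF L2_square_integrable[OF f]]) (use g eq in auto)
  ultimately show ?thesis by (simp add: L2_def)
qed

text \<open>
  Transport of the representatives to the moving interval: the scaled function is continuously
  differentiable there, so its derivative is the continuous representative of the weak derivative, end
  points included.
\<close>

lemma solution_x_eq:
  assumes l: "0 < l t" and F: "primitive 0 1 F G" and G: "continuous_on {0..1} G"
    and eq: "AE y in dx 0 1. U t 0 f y = F y" and x: "x \<in> {0..l t}"
  shows "solution_x l U f x t = G (x / l t) / of_real (l t)"
proof -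
  let ?F = "\<lambda>x. F (x / l t)" and ?G = "\<lambda>x. G (x / l t) / of_real (l t)"
  have img: "(\<lambda>x. x / l t) ` {0..l t} \<subseteq> {0..1}" using l by auto
  have cG: "continuous_on {0..l t} ?G"
    by (intro continuous_intros continuous_on_compose2[OF G _ img]) (use l in auto)
  have pF: "primitive 0 (l t) ?F ?G"
  proof (rule primitive_C1[OF _ _ cG])
    fix x assume x: "x \<in> {0..l t}"
    have "((\<lambda>x. x / l t) has_vector_derivative (1 / l t)) (at x within {0..l t})"
      using l by (auto intro!: derivative_eq_intros simp: has_real_derivative_iff_has_vector_derivative[symmetric])
    moreover have "(F has_vector_derivative G (x / l t)) (at (x / l t) within (\<lambda>x. x / l t) ` {0..l t})"
      by (rule has_vector_derivative_within_subset[OF primitive_has_derivative[OF F G] img]) (use x l in auto)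
    ultimately have "(F \<circ> (\<lambda>x. x / l t) has_vector_derivative (1 / l t) *\<^sub>R G (x / l t)) (at x within {0..l t})"
      by (rule vector_diff_chain_within)
    then show "(?F has_vector_derivative ?G x) (at x within {0..l t})"
      by (simp add: o_def scaleR_conv_of_real)
  qed (use l in simp)
  have wF: "has_weak_deriv 0 (l t) ?F ?G"
    by (rule has_weak_deriv_primitive[OF pF L2_continuous[OF cG]]) (use l in simp)
  have AE: "AE x in dx 0 (l t). ?F x = solution l U f x t"
    unfolding solution_def using AE_dx_scale[OF l eq] by eventually_elim simp
  have L2: "(\<lambda>\<xi>. solution l U f \<xi> t) \<in> L2 0 (l t)"
    by (rule L2_cong_AE[OF has_weak_deriv_L2(1)[OF wF] AE])
  have "has_weak_deriv 0 (l t) (\<lambda>\<xi>. solution l U f \<xi> t) ?G"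
    by (rule has_weak_deriv_cong_AE[OF wF AE L2]) (auto intro: has_weak_deriv_L2(2)[OF wF])
  then have "AE x in dx 0 (l t). wderiv 0 (l t) (\<lambda>\<xi>. solution l U f \<xi> t) x = ?G x"
    by (rule wderiv_AE_eq[OF l])
  then show ?thesis
    unfolding solution_x_def by (rule cont_value_eq[OF l cG _ x])
qed

lemma L2norm_le_H2norm:
  "L2norm a b f \<le> H2norm a b f" "L2norm a b (wderiv a b f) \<le> H2norm a b f"
  "L2norm a b (wderiv a b (wderiv a b f)) \<le> H2norm a b f"
  by (auto simp: H2norm_def intro!: real_le_rsqrt)

lemma dom_A_L2: "f \<in> dom_A \<Longrightarrow> f \<in> L2 0 1"
  by (auto simp: dom_A_def H10_def intro: H1_L2)

lemma dom_A_H1: "f \<in> dom_A \<Longrightarrow> f \<in> H1 0 1"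
  by (auto simp: dom_A_def H10_def)

lemma L2_lim_of_bound:
  assumes lim: "((\<lambda>r. N r) \<longlongrightarrow> 0) (at t within S)"
    and L2: "\<And>r. r \<in> S \<Longrightarrow> f r \<in> L2 0 1" "f0 \<in> L2 0 1"
    and le: "\<And>r. r \<in> S \<Longrightarrow> L2norm 0 1 (\<lambda>y. f r y - f0 y) \<le> N r"
  shows "L2_lim f f0 (at t within S)"
  unfolding L2_lim_def
proof (intro conjI L2)
  show "\<forall>\<^sub>F r in at t within S. f r \<in> L2 0 1"
    using L2(1) by (auto simp: eventually_at_filter)
  show "((\<lambda>r. L2norm 0 1 (\<lambda>y. f r y - f0 y)) \<longlongrightarrow> 0) (at t within S)"
  proof (rule tendsto_0_le[OF lim, where K=1])
    have "norm (L2norm 0 1 (\<lambda>y. f r y - f0 y)) \<le> norm (N r) * 1" if "r \<in> S" for r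
      using le[OF that] by simp
    then show "\<forall>\<^sub>F r in at t within S. norm (L2norm 0 1 (\<lambda>y. f r y - f0 y)) \<le> norm (N r) * 1"
      by (auto simp: eventually_at_filter)
  qed
qed

context length_function
begin

text \<open>
  The representatives of \<open>U t 0 f\<close> for the different times \<open>t\<close> are chosen independently; continuity and
  differentiability in time are inherited since they only involve mean-square norms.
\<close>

lemma classical_solution_representatives:
  assumes gen: "generates_evolution_family \<tau> l l' U" and f: "f \<in> dom_A"
  obtains F G H W where "moving_interval_solution \<tau> L B l l' F G H W"
    "\<And>t. t \<in> {0..\<tau>} \<Longrightarrow> AE y in dx 0 1. U t 0 f y = F t y"
    "\<And>t. t \<in> {0..\<tau>} \<Longrightarrow> AE y in dx 0 1. wderiv 0 1 (U t 0 f) y = G t y"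
proof -
  have T: "(t, 0) \<in> time_triangle \<tau>" if "t \<in> {0..\<tau>}" for t
    using that by (auto simp: time_triangle_def)
  have U: "U t 0 f \<in> dom_A"
    and U_H2: "((\<lambda>r. H2norm 0 1 (\<lambda>y. U r 0 f y - U t 0 f y)) \<longlongrightarrow> 0) (at t within {0..\<tau>})"
    and U_L2: "((\<lambda>r. L2norm 0 1 (\<lambda>y. (U r 0 f y - U t 0 f y) / complex_of_real (r - t)
                               - op_A l l' t (U t 0 f) y)) \<longlongrightarrow> 0) (at t within {0..\<tau>})"
    if "t \<in> {0..\<tau>}" for t
    using gen f T[OF that] unfolding generates_evolution_family_def by blast+
  define H where "H t = wderiv 0 1 (wderiv 0 1 (U t 0 f))" for t
  have "\<exists>F G. primitive 0 1 F G \<and> primitive 0 1 G (H t) \<and> H t \<in> L2 0 1 \<and> F 0 = 0 \<and> F 1 = 0 \<and>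
    (AE x in dx 0 1. U t 0 f x = F x) \<and> (AE x in dx 0 1. wderiv 0 1 (U t 0 f) x = G x)"
    if "t \<in> {0..\<tau>}" for t
    unfolding H_def by (rule dom_A_representative[OF U[OF that]]) blast
  then have "\<forall>t\<in>{0..\<tau>}. \<exists>F G. primitive 0 1 F G \<and> primitive 0 1 G (H t) \<and> H t \<in> L2 0 1 \<and> F 0 = 0 \<and> F 1 = 0 \<and>
    (AE x in dx 0 1. U t 0 f x = F x) \<and> (AE x in dx 0 1. wderiv 0 1 (U t 0 f) x = G x)"
    by (intro ballI)
  from bchoice[OF this] obtain F where "\<forall>t\<in>{0..\<tau>}. \<exists>G. primitive 0 1 (F t) G \<and> primitive 0 1 G (H t) \<and> H t \<in> L2 0 1 \<and> F t 0 = 0 \<and> F t 1 = 0 \<and>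
    (AE x in dx 0 1. U t 0 f x = F t x) \<and> (AE x in dx 0 1. wderiv 0 1 (U t 0 f) x = G x)"
    by (elim exE)
  from bchoice[OF this] obtain G where "\<forall>t\<in>{0..\<tau>}. primitive 0 1 (F t) (G t) \<and> primitive 0 1 (G t) (H t) \<and> H t \<in> L2 0 1 \<and> F t 0 = 0 \<and> F t 1 = 0 \<and>
    (AE x in dx 0 1. U t 0 f x = F t x) \<and> (AE x in dx 0 1. wderiv 0 1 (U t 0 f) x = G t x)"
    by (elim exE)
  then have FG: "\<And>t. t \<in> {0..\<tau>} \<Longrightarrow> primitive 0 1 (F t) (G t)"
    "\<And>t. t \<in> {0..\<tau>} \<Longrightarrow> primitive 0 1 (G t) (H t)" "\<And>t. t \<in> {0..\<tau>} \<Longrightarrow> H t \<in> L2 0 1"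
    "\<And>t. t \<in> {0..\<tau>} \<Longrightarrow> F t 0 = 0" "\<And>t. t \<in> {0..\<tau>} \<Longrightarrow> F t 1 = 0"
    "\<And>t. t \<in> {0..\<tau>} \<Longrightarrow> AE x in dx 0 1. U t 0 f x = F t x"
    "\<And>t. t \<in> {0..\<tau>} \<Longrightarrow> AE x in dx 0 1. wderiv 0 1 (U t 0 f) x = G t x"
    by blast+
  have L2: "F t \<in> L2 0 1" "G t \<in> L2 0 1" "U t 0 f \<in> L2 0 1" "wderiv 0 1 (U t 0 f) \<in> L2 0 1"
    if "t \<in> {0..\<tau>}" for t
    by (rule L2_continuous[OF primitive_continuous[OF FG(1)[OF that]]]
          L2_continuous[OF primitive_continuous[OF FG(2)[OF that]]]
          dom_A_L2[OF U[OF that]] H1_L2(2)[OF dom_A_H1[OF U[OF that]]])+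
  define W where "W t y = \<i> * of_real (1 / (l t)\<^sup>2) * H t y + of_real (l' t / l t * y) * G t y" for t y
  have WL: "W t \<in> L2 0 1" if "t \<in> {0..\<tau>}" for t
    unfolding W_def by (intro L2_add L2_cmult FG that L2_continuous_mult L2 continuous_intros)
  have WA: "AE y in dx 0 1. op_A l l' t (U t 0 f) y = W t y" if "t \<in> {0..\<tau>}" for t
    using FG(7)[OF that] by eventually_elim (simp add: op_A_def W_def H_def)
  have diffD: "(\<lambda>y. U r 0 f y - U t 0 f y) \<in> H2 0 1" if "r \<in> {0..\<tau>}" "t \<in> {0..\<tau>}" for r t
    using dom_A_diff[OF U[OF that(1)] U[OF that(2)]] by (simp add: dom_A_def)
  have "moving_interval_solution \<tau> L B l l' F G H W"
  proof
    fix t assume t: "t \<in> {0..\<tau>}"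
    show "L2_lim F (F t) (at t within {0..\<tau>})"
    proof (rule L2_lim_of_bound[OF U_H2[OF t]])
      fix r assume r: "r \<in> {0..\<tau>}"
      have "AE y in dx 0 1. F r y - F t y = U r 0 f y - U t 0 f y"
        using FG(6)[OF r] FG(6)[OF t] by eventually_elim simp
      then have "L2norm 0 1 (\<lambda>y. F r y - F t y) = L2norm 0 1 (\<lambda>y. U r 0 f y - U t 0 f y)"
        by (rule L2norm_cong_AE; intro L2_measurable L2_diff L2 r t)
      also have "\<dots> \<le> H2norm 0 1 (\<lambda>y. U r 0 f y - U t 0 f y)" by (rule L2norm_le_H2norm)
      finally show "L2norm 0 1 (\<lambda>y. F r y - F t y) \<le> H2norm 0 1 (\<lambda>y. U r 0 f y - U t 0 f y)" .
    qed (use L2 t in auto)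
    show "L2_lim G (G t) (at t within {0..\<tau>})"
    proof (rule L2_lim_of_bound[OF U_H2[OF t]])
      fix r assume r: "r \<in> {0..\<tau>}"
      have "AE y in dx 0 1. G r y - G t y = wderiv 0 1 (\<lambda>y. U r 0 f y - U t 0 f y) y"
        using FG(7)[OF r] FG(7)[OF t] wderiv_diff[OF zero_less_one dom_A_H1[OF U[OF r]] dom_A_H1[OF U[OF t]]]
        by eventually_elim simp
      then have "L2norm 0 1 (\<lambda>y. G r y - G t y) = L2norm 0 1 (wderiv 0 1 (\<lambda>y. U r 0 f y - U t 0 f y))"
        by (rule L2norm_cong_AE; intro L2_measurable L2_diff L2 H1_L2 H1_diff dom_A_H1 U r t)
      also have "\<dots> \<le> H2norm 0 1 (\<lambda>y. U r 0 f y - U t 0 f y)" by (rule L2norm_le_H2norm)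
      finally show "L2norm 0 1 (\<lambda>y. G r y - G t y) \<le> H2norm 0 1 (\<lambda>y. U r 0 f y - U t 0 f y)" .
    qed (use L2 t in auto)
    show "L2_lim H (H t) (at t within {0..\<tau>})"
    proof (rule L2_lim_of_bound[OF U_H2[OF t]])
      fix r assume r: "r \<in> {0..\<tau>}"
      have D: "U r 0 f \<in> H2 0 1" "U t 0 f \<in> H2 0 1" using U[OF r] U[OF t] by (auto simp: dom_A_def)
      have "AE y in dx 0 1. H r y - H t y = wderiv 0 1 (wderiv 0 1 (\<lambda>y. U r 0 f y - U t 0 f y)) y"
        using H2_diff(2)[OF zero_less_one D] by eventually_elim (simp add: H_def)
      then have "L2norm 0 1 (\<lambda>y. H r y - H t y) = L2norm 0 1 (wderiv 0 1 (wderiv 0 1 (\<lambda>y. U r 0 f y - U t 0 f y)))"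
      proof (rule L2norm_cong_AE; intro L2_measurable L2_diff FG r t)
        show "wderiv 0 1 (wderiv 0 1 (\<lambda>y. U r 0 f y - U t 0 f y)) \<in> L2 0 1"
          using diffD[OF r t] by (auto simp: H2_def intro: H1_L2)
      qed
      also have "\<dots> \<le> H2norm 0 1 (\<lambda>y. U r 0 f y - U t 0 f y)" by (rule L2norm_le_H2norm)
      finally show "L2norm 0 1 (\<lambda>y. H r y - H t y) \<le> H2norm 0 1 (\<lambda>y. U r 0 f y - U t 0 f y)" .
    qed (use FG t in auto)
    show "L2_lim (\<lambda>r y. (F r y - F t y) / of_real (r - t)) (W t) (at t within {0..\<tau>})"
    proof (rule L2_lim_of_bound[OF U_L2[OF t]])
      fix r assume r: "r \<in> {0..\<tau>}"
      have Q: "(\<lambda>y. (F r y - F t y) / of_real (r - t)) \<in> L2 0 1"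
        using L2_cmult[OF L2_diff[OF L2(1)[OF r] L2(1)[OF t]], of "1 / of_real (r - t)"] by simp
      then show "(\<lambda>y. (F r y - F t y) / of_real (r - t)) \<in> L2 0 1" .
      have eq: "AE y in dx 0 1. (F r y - F t y) / of_real (r - t) - W t y =
          (U r 0 f y - U t 0 f y) / complex_of_real (r - t) - op_A l l' t (U t 0 f) y"
        using FG(6)[OF r] FG(6)[OF t] WA[OF t] by eventually_elim simp
      have "L2norm 0 1 (\<lambda>y. (F r y - F t y) / of_real (r - t) - W t y) =
        L2norm 0 1 (\<lambda>y. (U r 0 f y - U t 0 f y) / complex_of_real (r - t) - op_A l l' t (U t 0 f) y)"
        by (rule L2norm_cong_AE[OF eq L2_measurable[OF L2_diff[OF Q WL[OF t]]]
              L2_measurable[OF L2_cong_AE[OF L2_diff[OF Q WL[OF t]] eq]]])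
      then show "L2norm 0 1 (\<lambda>y. (F r y - F t y) / of_real (r - t) - W t y) \<le>
        L2norm 0 1 (\<lambda>y. (U r 0 f y - U t 0 f y) / complex_of_real (r - t) - op_A l l' t (U t 0 f) y)"
        by simp
    qed (rule WL[OF t])
  qed (use tau l_bounds l'_bounds l_deriv l_0 FG in \<open>auto simp: W_def\<close>)
  then show ?thesis using that FG(6,7) by blast
qed

end

section \<open>Boundary traces by density\<close>

lemma L2norm_power2_eq_integral:
  assumes "continuous_on {a..b} f"
  shows "(L2norm a b f)\<^sup>2 = integral {a..b} (\<lambda>x. (cmod (f x))\<^sup>2)"
proof -
  have "(L2norm a b f)\<^sup>2 = integral {a<..<b} (\<lambda>x. (cmod (f x))\<^sup>2)"
    unfolding L2norm_power2
    by (rule lebesgue_integral_eq_integral[OF L2_square_integrable[OF L2_continuous[OF assms]]]) simp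
  then show ?thesis by (simp add: integral_open_interval_real)
qed

lemma H10norm_diff:
  assumes "f \<in> H1 0 1" "g \<in> H1 0 1"
  shows "H10norm 0 1 (\<lambda>y. f y - g y) = L2norm 0 1 (\<lambda>y. wderiv 0 1 f y - wderiv 0 1 g y)"
  unfolding H10norm_def
  by (intro L2norm_cong_AE wderiv_diff assms zero_less_one L2_measurable L2_diff H1_L2 H1_diff)

lemma H10norm_diff_triangle:
  assumes "f \<in> H1 0 1" "g \<in> H1 0 1" "h \<in> H1 0 1"
  shows "H10norm 0 1 (\<lambda>y. f y - h y) \<le> H10norm 0 1 (\<lambda>y. f y - g y) + H10norm 0 1 (\<lambda>y. h y - g y)"
  unfolding H10norm_diff[OF assms(1,2)] H10norm_diff[OF assms(1,3)] H10norm_diff[OF assms(3,2)]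
    L2norm_minus_commute[of 0 1 "wderiv 0 1 h"]
  by (intro L2norm_diff_triangle H1_L2 assms)

lemma tendsto_H10norm:
  assumes v: "\<And>n. v n \<in> H1 0 1" and u: "u \<in> H1 0 1"
    and lim: "(\<lambda>n. H10norm 0 1 (\<lambda>y. v n y - u y)) \<longlonglongrightarrow> 0"
  shows "(\<lambda>n. H10norm 0 1 (v n)) \<longlonglongrightarrow> H10norm 0 1 u"
  using lim unfolding H10norm_diff[OF v u] unfolding H10norm_def
  by (rule tendsto_L2norm) (intro H1_L2 v u)+

lemma H10_approximation_in_dom_A:
  assumes "u \<in> H10 0 1"
  obtains \<phi> where "\<And>n. \<phi> n \<in> dom_A" "(\<lambda>n. H10norm 0 1 (\<lambda>y. \<phi> n y - u y)) \<longlonglongrightarrow> 0"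
proof -
  obtain \<phi> where \<phi>: "\<And>n. \<phi> n \<in> test_functions 0 1"
    and lim: "(\<lambda>n. H1norm 0 1 (\<lambda>x. \<phi> n x - u x)) \<longlonglongrightarrow> 0"
    using assms by (auto simp: H10_def)
  show ?thesis
  proof (rule that)
    show "\<phi> n \<in> dom_A" for n by (rule test_function_dom_A[OF \<phi>])
    show "(\<lambda>n. H10norm 0 1 (\<lambda>y. \<phi> n y - u y)) \<longlonglongrightarrow> 0"
      by (rule tendsto_sandwich[OF _ _ tendsto_const lim])
         (auto simp: H10norm_def L2norm_le_H1norm)
  qed
qed

lemma evolution_family_linear:
  assumes "evolution_family \<tau> U" "(t, s) \<in> time_triangle \<tau>" "f \<in> L2 0 1" "g \<in> L2 0 1"
  shows "L2_eq 0 1 (U t s (\<lambda>y. \<alpha> * f y + \<beta> * g y)) (\<lambda>y. \<alpha> * U t s f y + \<beta> * U t s g y)"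
proof -
  have "\<forall>(t, s)\<in>time_triangle \<tau>.
        (\<forall>f\<in>L2 0 1. U t s f \<in> L2 0 1) \<and>
        (\<forall>f\<in>L2 0 1. \<forall>g\<in>L2 0 1. \<forall>\<alpha> \<beta>.
           L2_eq 0 1 (U t s (\<lambda>y. \<alpha> * f y + \<beta> * g y)) (\<lambda>y. \<alpha> * U t s f y + \<beta> * U t s g y)) \<and>
        (\<exists>C. \<forall>f\<in>L2 0 1. L2norm 0 1 (U t s f) \<le> C * L2norm 0 1 f)"
    using assms(1) unfolding evolution_family_def by (rule conjunct1)
  from bspec[OF this assms(2)]
  have "\<forall>f\<in>L2 0 1. \<forall>g\<in>L2 0 1. \<forall>\<alpha> \<beta>.
      L2_eq 0 1 (U t s (\<lambda>y. \<alpha> * f y + \<beta> * g y)) (\<lambda>y. \<alpha> * U t s f y + \<beta> * U t s g y)"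
    by (simp only: prod.case, elim conjE)
  then show ?thesis using assms(3,4) by blast
qed

context length_function
begin

lemma evolution_family_of_generates: "generates_evolution_family \<tau> l l' U \<Longrightarrow> evolution_family \<tau> U"
  by (simp add: generates_evolution_family_def)

text \<open>
  Linearity of \<open>U t 0\<close> up to null sets determines the continuous representatives of the derivatives, and
  hence the traces, at every point.
\<close>

lemma solution_x_diff:
  assumes gen: "generates_evolution_family \<tau> l l' U" and f: "f \<in> dom_A" and g: "g \<in> dom_A"
    and t: "t \<in> {0..\<tau>}" and x: "x \<in> {0..l t}"
  shows "solution_x l U (\<lambda>y. f y - g y) x t = solution_x l U f x t - solution_x l U g x t"
proof -
  have h: "(\<lambda>y. f y - g y) \<in> dom_A" by (rule dom_A_diff[OF f g])
  have "\<exists>F G. primitive 0 1 F G \<and> continuous_on {0..1} G \<and> U t 0 k \<in> dom_A \<and>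
      (AE y in dx 0 1. U t 0 k y = F y) \<and> (AE y in dx 0 1. wderiv 0 1 (U t 0 k) y = G y)"
    if k: "k \<in> dom_A" for k
  proof -
    obtain F G H W where *: "moving_interval_solution \<tau> L B l l' F G H W"
      "\<And>t. t \<in> {0..\<tau>} \<Longrightarrow> AE y in dx 0 1. U t 0 k y = F t y"
      "\<And>t. t \<in> {0..\<tau>} \<Longrightarrow> AE y in dx 0 1. wderiv 0 1 (U t 0 k) y = G t y"
      using classical_solution_representatives[OF gen k] by blast
    have "U t 0 k \<in> dom_A"
      using gen k t unfolding generates_evolution_family_def time_triangle_def by fastforce
    moreover have "primitive 0 1 (F t) (G t)" "continuous_on {0..1} (G t)"
      using moving_interval_solution.FG[OF *(1) t] primitive_continuous[OF moving_interval_solution.GH[OF *(1) t]] by auto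
    ultimately show ?thesis using *(2,3)[OF t] by blast
  qed
  note rep = this
  obtain F1 G1 where 1: "primitive 0 1 F1 G1" "continuous_on {0..1} G1" "U t 0 f \<in> dom_A"
      "AE y in dx 0 1. U t 0 f y = F1 y" "AE y in dx 0 1. wderiv 0 1 (U t 0 f) y = G1 y"
    using rep[OF f] by (elim exE conjE)
  obtain F2 G2 where 2: "primitive 0 1 F2 G2" "continuous_on {0..1} G2" "U t 0 g \<in> dom_A"
      "AE y in dx 0 1. U t 0 g y = F2 y" "AE y in dx 0 1. wderiv 0 1 (U t 0 g) y = G2 y"
    using rep[OF g] by (elim exE conjE)
  obtain F3 G3 where 3: "primitive 0 1 F3 G3" "continuous_on {0..1} G3" "U t 0 (\<lambda>y. f y - g y) \<in> dom_A"
      "AE y in dx 0 1. U t 0 (\<lambda>y. f y - g y) y = F3 y" "AE y in dx 0 1. wderiv 0 1 (U t 0 (\<lambda>y. f y - g y)) y = G3 y"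
    using rep[OF h] by (elim exE conjE)
  have "L2_eq 0 1 (U t 0 (\<lambda>y. 1 * f y + (-1) * g y)) (\<lambda>y. 1 * U t 0 f y + (-1) * U t 0 g y)"
    by (rule evolution_family_linear[OF evolution_family_of_generates[OF gen]])
       (use t dom_A_L2[OF f] dom_A_L2[OF g] in \<open>auto simp: time_triangle_def\<close>)
  then have lin: "AE y in dx 0 1. U t 0 (\<lambda>y. f y - g y) y = U t 0 f y - U t 0 g y"
    by (simp add: L2_eq_def)
  have "AE y in dx 0 1. wderiv 0 1 (U t 0 (\<lambda>y. f y - g y)) y = wderiv 0 1 (U t 0 f) y - wderiv 0 1 (U t 0 g) y"
    by (rule has_weak_deriv_unique[OF zero_less_one H1_has_weak_deriv
          has_weak_deriv_diff[OF H1_has_weak_deriv H1_has_weak_deriv] lin])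
       (intro dom_A_H1 1 2 3)+
  then have eqG: "AE y in dx 0 1. G3 y = G1 y - G2 y"
    using 1(5) 2(5) 3(5) by eventually_elim simp
  have l: "0 < l t" using l_bounds[OF t] by simp
  have "G3 (x / l t) = G1 (x / l t) - G2 (x / l t)"
    by (rule continuous_AE_eq_imp_eq[OF zero_less_one 3(2) continuous_on_diff[OF 1(2) 2(2)] eqG])
       (use x l in auto)
  then show ?thesis
    unfolding solution_x_eq[of l t F1 G1 U f, OF l 1(1,2,4) x] solution_x_eq[of l t F2 G2 U g, OF l 2(1,2,4) x]
      solution_x_eq[of l t F3 G3 U "\<lambda>y. f y - g y", OF l 3(1,2,4) x]
    by (simp add: diff_divide_distrib)
qed

text \<open>
  The square root of this constant bounds the norm of the trace maps.
\<close>

definition admissibility_constant :: real where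
  "admissibility_constant = L\<^sup>2 * ((4 + 2 * B) * L * \<tau> + L + 1)"

definition observability_constant :: "real \<Rightarrow> real" where
  "observability_constant s = (4 * exp (5 * s) + \<tau> * B / (4 * L\<^sup>2)) * L\<^sup>2"

lemma classical_traces:
  assumes gen: "generates_evolution_family \<tau> l l' U" and f: "f \<in> dom_A"
  shows "(\<lambda>t. solution_x l U f 0 t) \<in> L2 0 \<tau>" and "(\<lambda>t. solution_x l U f (l t) t) \<in> L2 0 \<tau>"
    and "(L2norm 0 \<tau> (\<lambda>t. solution_x l U f 0 t))\<^sup>2 + (L2norm 0 \<tau> (\<lambda>t. solution_x l U f (l t) t))\<^sup>2
      \<le> admissibility_constant * (H10norm 0 1 f)\<^sup>2"
    and "carleman_threshold \<tau> L B s \<Longrightarrow> \<tau> / (8 * L\<^sup>2) * (H10norm 0 1 f)\<^sup>2 \<le> observability_constant s *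
      ((L2norm 0 \<tau> (\<lambda>t. solution_x l U f 0 t))\<^sup>2 + (L2norm 0 \<tau> (\<lambda>t. solution_x l U f (l t) t))\<^sup>2)"
proof -
  obtain F G H W where sol: "moving_interval_solution \<tau> L B l l' F G H W"
    and UF: "\<And>t. t \<in> {0..\<tau>} \<Longrightarrow> AE y in dx 0 1. U t 0 f y = F t y"
    and UG: "\<And>t. t \<in> {0..\<tau>} \<Longrightarrow> AE y in dx 0 1. wderiv 0 1 (U t 0 f) y = G t y"
    using classical_solution_representatives[OF gen f] by blast
  interpret sol: moving_interval_solution \<tau> L B l l' F G H W by (rule sol)
  let ?T0 = "\<lambda>t. solution_x l U f 0 t" and ?T1 = "\<lambda>t. solution_x l U f (l t) t"
  have l: "0 < l t" "1 \<le> l t" "l t \<le> L" if "t \<in> {0..\<tau>}" for t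
    using l_bounds[OF that] by auto
  have T: "?T0 t = G t 0 / of_real (l t)" "?T1 t = G t 1 / of_real (l t)" if t: "t \<in> {0..\<tau>}" for t
  proof -
    note eq = solution_x_eq[of l t "F t" "G t" U f, OF l(1)[OF t] sol.FG[OF t] primitive_continuous[OF sol.GH[OF t]] UF[OF t]]
    show "?T0 t = G t 0 / of_real (l t)" using eq[of 0] l(1)[OF t] by simp
    show "?T1 t = G t 1 / of_real (l t)" using eq[of "l t"] l(1)[OF t] by simp
  qed
  have cl: "continuous_on {0..\<tau>} l"
    by (rule DERIV_continuous_on[OF l_deriv])
  have c: "continuous_on {0..\<tau>} (\<lambda>t. G t x / of_real (l t))" if "x \<in> {0..1}" for x
    by (intro continuous_intros sol.G_trace_continuous that cl) (use l(1) in force)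
  have cT0: "continuous_on {0..\<tau>} ?T0"
    by (rule continuous_on_eq[OF c[of 0]]) (simp_all add: T(1))
  have cT1: "continuous_on {0..\<tau>} ?T1"
    by (rule continuous_on_eq[OF c[of 1]]) (simp_all add: T(2))
  show "?T0 \<in> L2 0 \<tau>" "?T1 \<in> L2 0 \<tau>"
    by (intro L2_continuous cT0 cT1)+
  have int: "(\<lambda>t. (cmod (?T0 t))\<^sup>2 + (cmod (?T1 t))\<^sup>2) integrable_on {0..\<tau>}"
    by (intro integrable_continuous_real continuous_intros cT0 cT1)
  have N: "(L2norm 0 \<tau> ?T0)\<^sup>2 + (L2norm 0 \<tau> ?T1)\<^sup>2 = integral {0..\<tau>} (\<lambda>t. (cmod (?T0 t))\<^sup>2 + (cmod (?T1 t))\<^sup>2)"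
    unfolding L2norm_power2_eq_integral[OF cT0] L2norm_power2_eq_integral[OF cT1]
    by (rule Henstock_Kurzweil_Integration.integral_add[symmetric])
       (intro integrable_continuous_real continuous_intros cT0 cT1)+
  have e: "sol.energy 0 = (H10norm 0 1 f)\<^sup>2"
  proof -
    have 0: "0 \<in> {0..\<tau>}" using tau by simp
    have U0: "U 0 0 f \<in> dom_A"
      using gen f 0 unfolding generates_evolution_family_def time_triangle_def by fastforce
    have "AE y in dx 0 1. U 0 0 f y = f y"
      using evolution_family_of_generates[OF gen] 0 dom_A_L2[OF f] unfolding evolution_family_def L2_eq_def by blast
    then have "AE y in dx 0 1. wderiv 0 1 (U 0 0 f) y = wderiv 0 1 f y"
      by (rule has_weak_deriv_unique[OF zero_less_one H1_has_weak_deriv[OF dom_A_H1[OF U0]] H1_has_weak_deriv[OF dom_A_H1[OF f]]])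
    then have "AE y in dx 0 1. G 0 y = wderiv 0 1 f y"
      using UG[OF 0] by eventually_elim simp
    then have "L2norm 0 1 (G 0) = L2norm 0 1 (wderiv 0 1 f)"
      by (rule L2norm_cong_AE[OF _ L2_measurable[OF sol.G_L2[OF 0]] L2_measurable[OF H1_L2(2)[OF dom_A_H1[OF f]]]])
    then show ?thesis by (simp add: sol.energy_def H10norm_def)
  qed
  have sq: "(cmod (?T0 t))\<^sup>2 = (cmod (G t 0))\<^sup>2 / (l t)\<^sup>2" "(cmod (?T1 t))\<^sup>2 = (cmod (G t 1))\<^sup>2 / (l t)\<^sup>2"
    if "t \<in> {0..\<tau>}" for t
    using T[OF that] l(1)[OF that] by (simp_all add: norm_divide power_divide)
  have "integral {0..\<tau>} (\<lambda>t. (cmod (?T0 t))\<^sup>2 + (cmod (?T1 t))\<^sup>2) \<le> integral {0..\<tau>} (\<lambda>t. (cmod (G t 0))\<^sup>2 + (cmod (G t 1))\<^sup>2)"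
  proof (rule integral_le[OF int])
    show "(\<lambda>t. (cmod (G t 0))\<^sup>2 + (cmod (G t 1))\<^sup>2) integrable_on {0..\<tau>}"
      by (intro integrable_continuous_real continuous_intros sol.G_trace_continuous) auto
    fix t assume t: "t \<in> {0..\<tau>}"
    have "x / (l t)\<^sup>2 \<le> x / 1" if "0 \<le> x" for x
      by (rule divide_left_mono) (use that l[OF t] in auto)
    then show "(cmod (?T0 t))\<^sup>2 + (cmod (?T1 t))\<^sup>2 \<le> (cmod (G t 0))\<^sup>2 + (cmod (G t 1))\<^sup>2"
      unfolding sq[OF t] by (intro add_mono) simp_all
  qed
  also have "\<dots> \<le> admissibility_constant * sol.energy 0"
    unfolding admissibility_constant_def by (rule sol.traces_le_energy)
  finally show "(L2norm 0 \<tau> ?T0)\<^sup>2 + (L2norm 0 \<tau> ?T1)\<^sup>2 \<le> admissibility_constant * (H10norm 0 1 f)\<^sup>2"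
    unfolding N e .
  assume s: "carleman_threshold \<tau> L B s"
  have "integral {0..\<tau>} (\<lambda>t. (cmod (G t 1))\<^sup>2) \<le> integral {0..\<tau>} (\<lambda>t. L\<^sup>2 * ((cmod (?T0 t))\<^sup>2 + (cmod (?T1 t))\<^sup>2))"
  proof (rule integral_le)
    show "(\<lambda>t. (cmod (G t 1))\<^sup>2) integrable_on {0..\<tau>}"
      by (intro integrable_continuous_real sol.trace_power2_continuous) auto
    show "(\<lambda>t. L\<^sup>2 * ((cmod (?T0 t))\<^sup>2 + (cmod (?T1 t))\<^sup>2)) integrable_on {0..\<tau>}"
      by (intro integrable_continuous_real continuous_intros cT0 cT1)
    fix t assume t: "t \<in> {0..\<tau>}"
    have "(cmod (G t 1))\<^sup>2 = (l t)\<^sup>2 * (cmod (?T1 t))\<^sup>2"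
      unfolding sq[OF t] using l(1)[OF t] by simp
    also have "\<dots> \<le> L\<^sup>2 * ((cmod (?T0 t))\<^sup>2 + (cmod (?T1 t))\<^sup>2)"
      using l[OF t] by (intro mult_mono power_mono) auto
    finally show "(cmod (G t 1))\<^sup>2 \<le> L\<^sup>2 * ((cmod (?T0 t))\<^sup>2 + (cmod (?T1 t))\<^sup>2)" .
  qed
  then have I: "integral {0..\<tau>} (\<lambda>t. (cmod (G t 1))\<^sup>2) \<le> L\<^sup>2 * ((L2norm 0 \<tau> ?T0)\<^sup>2 + (L2norm 0 \<tau> ?T1)\<^sup>2)"
    unfolding N by simp
  have "\<tau> / (8 * L\<^sup>2) * sol.energy 0 \<le> (4 * exp (5 * s) + \<tau> * B / (4 * L\<^sup>2)) * integral {0..\<tau>} (\<lambda>t. (cmod (G t 1))\<^sup>2)"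
    by (rule sol.observability[OF s])
  also have "\<dots> \<le> (4 * exp (5 * s) + \<tau> * B / (4 * L\<^sup>2)) * (L\<^sup>2 * ((L2norm 0 \<tau> ?T0)\<^sup>2 + (L2norm 0 \<tau> ?T1)\<^sup>2))"
    by (rule mult_left_mono[OF I]) (use tau B_nonneg in simp)
  finally show "\<tau> / (8 * L\<^sup>2) * (H10norm 0 1 f)\<^sup>2 \<le> observability_constant s * ((L2norm 0 \<tau> ?T0)\<^sup>2 + (L2norm 0 \<tau> ?T1)\<^sup>2)"
    unfolding observability_constant_def e by (simp only: mult.assoc)
qed

lemma trace_diff_le:
  assumes gen: "generates_evolution_family \<tau> l l' U" and f: "f \<in> dom_A" and g: "g \<in> dom_A"
    and e: "e = (\<lambda>t. 0) \<or> e = l"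
  shows "(\<lambda>t. solution_x l U f (e t) t) \<in> L2 0 \<tau>"
    and "L2norm 0 \<tau> (\<lambda>t. solution_x l U f (e t) t - solution_x l U g (e t) t)
      \<le> sqrt admissibility_constant * H10norm 0 1 (\<lambda>y. f y - g y)"
proof -
  show "(\<lambda>t. solution_x l U f (e t) t) \<in> L2 0 \<tau>"
    using classical_traces(1,2)[OF gen f] e by auto
  let ?h = "\<lambda>y. f y - g y"
  note h = dom_A_diff[OF f g]
  have "L2norm 0 \<tau> (\<lambda>t. solution_x l U f (e t) t - solution_x l U g (e t) t) = L2norm 0 \<tau> (\<lambda>t. solution_x l U ?h (e t) t)"
    unfolding L2norm_def
  proof (rule arg_cong[of _ _ sqrt], rule Bochner_Integration.integral_cong[OF refl])
    fix t assume "t \<in> space (dx 0 \<tau>)"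
    then have t: "t \<in> {0..\<tau>}" by simp
    then have "e t \<in> {0..l t}" using e l_bounds[OF t] by auto
    then show "(cmod (solution_x l U f (e t) t - solution_x l U g (e t) t))\<^sup>2 = (cmod (solution_x l U ?h (e t) t))\<^sup>2"
      using solution_x_diff[OF gen f g t] by simp
  qed
  also have "\<dots> \<le> sqrt (admissibility_constant * (H10norm 0 1 ?h)\<^sup>2)"
  proof (rule real_le_rsqrt)
    show "(L2norm 0 \<tau> (\<lambda>t. solution_x l U ?h (e t) t))\<^sup>2 \<le> admissibility_constant * (H10norm 0 1 ?h)\<^sup>2"
      using classical_traces(3)[OF gen h] e
      by (elim disjE) (simp_all add: add_increasing add_increasing2, (smt (verit) zero_le_power2)+)
  qed
  also have "\<dots> = sqrt admissibility_constant * H10norm 0 1 ?h"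
    by (simp add: real_sqrt_mult H10norm_def)
  finally show "L2norm 0 \<tau> (\<lambda>t. solution_x l U f (e t) t - solution_x l U g (e t) t)
      \<le> sqrt admissibility_constant * H10norm 0 1 ?h" .
qed

text \<open>
  The traces along one approximating sequence form a Cauchy sequence; any other approximating sequence
  has the same limit because the trace maps are Lipschitz continuous on the domain.
\<close>

lemma trace_extension:
  assumes gen: "generates_evolution_family \<tau> l l' U" and u: "u \<in> H10 0 1"
    and e: "e = (\<lambda>t. 0) \<or> e = l"
  shows "\<exists>g. \<forall>v. (\<forall>n::nat. v n \<in> dom_A) \<and> (\<lambda>n. H10norm 0 1 (\<lambda>y. v n y - u y)) \<longlonglongrightarrow> 0 \<longrightarrow>
     L2_converges 0 \<tau> (\<lambda>n t. solution_x l U (v n) (e t) t) g"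
proof -
  define K where "K = sqrt admissibility_constant"
  have K: "0 \<le> K"
    unfolding K_def admissibility_constant_def using tau l_bounds[of 0] l'_bounds[of 0] by auto
  have uH: "u \<in> H1 0 1" using u by (simp add: H10_def)
  obtain \<phi> where \<phi>: "\<And>n. \<phi> n \<in> dom_A" and lim: "(\<lambda>n. H10norm 0 1 (\<lambda>y. \<phi> n y - u y)) \<longlonglongrightarrow> 0"
    using H10_approximation_in_dom_A[OF u] by blast
  let ?T = "\<lambda>f t. solution_x l U f (e t) t"
  have T: "?T f \<in> L2 0 \<tau>" if "f \<in> dom_A" for f
    using trace_diff_le(1)[OF gen that that e] .
  have T_le: "L2norm 0 \<tau> (\<lambda>t. ?T f t - ?T g t) \<le> K * (H10norm 0 1 (\<lambda>y. f y - u y) + H10norm 0 1 (\<lambda>y. g y - u y))"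
    if "f \<in> dom_A" "g \<in> dom_A" for f g
  proof -
    have "L2norm 0 \<tau> (\<lambda>t. ?T f t - ?T g t) \<le> K * H10norm 0 1 (\<lambda>y. f y - g y)"
      unfolding K_def by (rule trace_diff_le(2)[OF gen that e])
    also have "\<dots> \<le> K * (H10norm 0 1 (\<lambda>y. f y - u y) + H10norm 0 1 (\<lambda>y. g y - u y))"
      by (intro mult_left_mono H10norm_diff_triangle dom_A_H1 that uH K)
    finally show ?thesis .
  qed
  have "\<exists>N. \<forall>m\<ge>N. \<forall>n\<ge>N. L2norm 0 \<tau> (\<lambda>t. ?T (\<phi> m) t - ?T (\<phi> n) t) < r" if r: "0 < r" for r
  proof -
    have "0 < (r / (K + 1)) / 2" using r K by simp
    from order_tendstoD(2)[OF lim this] obtain N where N: "\<And>n. N \<le> n \<Longrightarrow> H10norm 0 1 (\<lambda>y. \<phi> n y - u y) < (r / (K + 1)) / 2"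
      by (auto simp: eventually_sequentially)
    have "L2norm 0 \<tau> (\<lambda>t. ?T (\<phi> m) t - ?T (\<phi> n) t) < r" if "N \<le> m" "N \<le> n" for m n
    proof -
      have "L2norm 0 \<tau> (\<lambda>t. ?T (\<phi> m) t - ?T (\<phi> n) t) \<le> K * (H10norm 0 1 (\<lambda>y. \<phi> m y - u y) + H10norm 0 1 (\<lambda>y. \<phi> n y - u y))"
        by (rule T_le[OF \<phi> \<phi>])
      also have "\<dots> \<le> K * ((r / (K + 1)) / 2 + (r / (K + 1)) / 2)"
        by (intro mult_left_mono add_mono less_imp_le N that K)
      also have "\<dots> = K * (r / (K + 1))" by (simp only: field_sum_of_halves)
      also have "\<dots> < r" using K r by (simp add: pos_divide_less_eq algebra_simps)
      finally show ?thesis .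
    qed
    then show ?thesis by blast
  qed
  then obtain g where g: "g \<in> L2 0 \<tau>" "(\<lambda>n. L2norm 0 \<tau> (\<lambda>t. ?T (\<phi> n) t - g t)) \<longlonglongrightarrow> 0"
    using L2_complete[of "\<lambda>n. ?T (\<phi> n)" 0 \<tau>] T[OF \<phi>] by blast
  have "L2_converges 0 \<tau> (\<lambda>n t. ?T (v n) t) g"
    if v: "\<And>n::nat. v n \<in> dom_A" and vlim: "(\<lambda>n. H10norm 0 1 (\<lambda>y. v n y - u y)) \<longlonglongrightarrow> 0" for v
    unfolding L2_converges_def
  proof (intro conjI allI T v g)
    let ?b = "\<lambda>n. K * (H10norm 0 1 (\<lambda>y. v n y - u y) + H10norm 0 1 (\<lambda>y. \<phi> n y - u y)) + L2norm 0 \<tau> (\<lambda>t. ?T (\<phi> n) t - g t)"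
    have "?b \<longlonglongrightarrow> K * (0 + 0) + 0" by (intro tendsto_intros vlim lim g)
    then have b0: "?b \<longlonglongrightarrow> 0" by simp
    have "L2norm 0 \<tau> (\<lambda>t. ?T (v n) t - g t) \<le> ?b n" for n
      using L2norm_diff_triangle[OF T[OF v] T[OF \<phi>] g(1), of n n] T_le[OF v \<phi>, of n n] by linarith
    then show "(\<lambda>n. L2norm 0 \<tau> (\<lambda>t. ?T (v n) t - g t)) \<longlonglongrightarrow> 0"
      by (intro tendsto_sandwich[OF _ _ tendsto_const b0]) auto
  qed
  then show ?thesis by blast
qed

text \<open>
  Both sides are continuous along an approximating sequence in the domain.
\<close>

lemma observability_of_traces:
  assumes gen: "generates_evolution_family \<tau> l l' U" and u: "u \<in> H10 0 1"
    and s: "carleman_threshold \<tau> L B s" and bt: "boundary_traces \<tau> l U u g0 g1"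
  shows "\<tau> / (8 * L\<^sup>2) * (H10norm 0 1 u)\<^sup>2 \<le> observability_constant s *
    (LINT t|lebesgue_on {0<..<\<tau>}. (cmod (g0 t))\<^sup>2 + (cmod (g1 t))\<^sup>2)"
proof -
  obtain \<phi> where \<phi>: "\<And>n. \<phi> n \<in> dom_A" and lim: "(\<lambda>n. H10norm 0 1 (\<lambda>y. \<phi> n y - u y)) \<longlonglongrightarrow> 0"
    using H10_approximation_in_dom_A[OF u] by blast
  have uH: "u \<in> H1 0 1" using u by (simp add: H10_def)
  have c0: "L2_converges 0 \<tau> (\<lambda>n t. solution_x l U (\<phi> n) 0 t) g0"
    and c1: "L2_converges 0 \<tau> (\<lambda>n t. solution_x l U (\<phi> n) (l t) t) g1"
    using bt \<phi> lim unfolding boundary_traces_def by blast+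
  have L2: "g0 \<in> L2 0 \<tau>" "g1 \<in> L2 0 \<tau>" using c0 c1 by (auto simp: L2_converges_def)
  have n0: "(\<lambda>n. L2norm 0 \<tau> (\<lambda>t. solution_x l U (\<phi> n) 0 t)) \<longlonglongrightarrow> L2norm 0 \<tau> g0"
    by (rule tendsto_L2norm) (use c0 in \<open>auto simp: L2_converges_def\<close>)
  have n1: "(\<lambda>n. L2norm 0 \<tau> (\<lambda>t. solution_x l U (\<phi> n) (l t) t)) \<longlonglongrightarrow> L2norm 0 \<tau> g1"
    by (rule tendsto_L2norm) (use c1 in \<open>auto simp: L2_converges_def\<close>)
  have "\<tau> / (8 * L\<^sup>2) * (H10norm 0 1 u)\<^sup>2 \<le> observability_constant s * ((L2norm 0 \<tau> g0)\<^sup>2 + (L2norm 0 \<tau> g1)\<^sup>2)"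
  proof (rule LIMSEQ_le)
    show "(\<lambda>n. \<tau> / (8 * L\<^sup>2) * (H10norm 0 1 (\<phi> n))\<^sup>2) \<longlonglongrightarrow> \<tau> / (8 * L\<^sup>2) * (H10norm 0 1 u)\<^sup>2"
      by (intro tendsto_mult tendsto_const tendsto_power tendsto_H10norm dom_A_H1 \<phi> uH lim)
    show "(\<lambda>n. observability_constant s * ((L2norm 0 \<tau> (\<lambda>t. solution_x l U (\<phi> n) 0 t))\<^sup>2
          + (L2norm 0 \<tau> (\<lambda>t. solution_x l U (\<phi> n) (l t) t))\<^sup>2))
       \<longlonglongrightarrow> observability_constant s * ((L2norm 0 \<tau> g0)\<^sup>2 + (L2norm 0 \<tau> g1)\<^sup>2)"
      by (intro tendsto_mult tendsto_const tendsto_add tendsto_power n0 n1)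
  qed (use classical_traces(4)[OF gen \<phi> s] in blast)
  also have "(L2norm 0 \<tau> g0)\<^sup>2 + (L2norm 0 \<tau> g1)\<^sup>2 = (LINT t|lebesgue_on {0<..<\<tau>}. (cmod (g0 t))\<^sup>2 + (cmod (g1 t))\<^sup>2)"
    unfolding L2norm_power2 using L2 by (simp add: L2_def)
  finally show ?thesis .
qed

end

theorem theorem2p2:
  fixes \<tau> :: real and l l' l'' :: "real \<Rightarrow> real"
  assumes "\<tau> > 0"
    and "\<And>t. t \<in> {0..\<tau>} \<Longrightarrow> l t > 0"
    and "\<And>t. t \<in> {0..\<tau>} \<Longrightarrow> (l has_real_derivative l' t) (at t within {0..\<tau>})"
    and "\<And>t. t \<in> {0..\<tau>} \<Longrightarrow> (l' has_real_derivative l'' t) (at t within {0..\<tau>})"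
    and "continuous_on {0..\<tau>} l''"
    and "l 0 = 1"
    and "\<And>t. t \<in> {0<..<\<tau>} \<Longrightarrow> l' t > 0"
    and "\<And>t. t \<in> {0<..<\<tau>} \<Longrightarrow> l' t * l t < 1 / pi"
  shows "\<exists>c>0. \<forall>U. generates_evolution_family \<tau> l l' U \<longrightarrow>
           (\<forall>u0\<in>H10 0 1.
              (\<exists>g0 g1. boundary_traces \<tau> l U u0 g0 g1) \<and>
              (\<forall>g0 g1. boundary_traces \<tau> l U u0 g0 g1 \<longrightarrow>
                 c * (H10norm 0 1 u0)\<^sup>2
                   \<le> (LINT t|lebesgue_on {0<..<\<tau>}. (cmod (g0 t))\<^sup>2 + (cmod (g1 t))\<^sup>2)))"
proof -
  have cl: "continuous_on {0..\<tau>} l" and cl': "continuous_on {0..\<tau>} l'"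
    by (rule DERIV_continuous_on[OF assms(3)], assumption, rule DERIV_continuous_on[OF assms(4)])
  have l'_nonneg: "0 \<le> l' t" if "t \<in> {0..\<tau>}" for t
    by (rule continuous_ge_on_closure[of "{0<..<\<tau>}" l'])
       (use cl' assms(1) assms(7) that in \<open>auto intro: less_imp_le\<close>)
  have l_ge_1: "1 \<le> l t" if t: "t \<in> {0..\<tau>}" for t
  proof (cases "t = 0")
    case False
    then have "0 < t" using t by simp
    then have "l 0 < l t"
    proof (rule DERIV_pos_imp_increasing_open)
      fix x assume x: "0 < x" "x < t"
      then have "(l has_real_derivative l' x) (at x)"
        using assms(3)[of x] t at_within_interior[of x "{0..\<tau>}"] by auto
      then show "\<exists>y. DERIV l x :> y \<and> 0 < y" using assms(7)[of x] x t by auto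
    next
      show "continuous_on {0..t} l" by (rule continuous_on_subset[OF cl]) (use t in auto)
    qed
    then show ?thesis using assms(6) by simp
  qed (use assms(6) in simp)
  obtain L where L: "\<And>t. t \<in> {0..\<tau>} \<Longrightarrow> l t \<le> L"
    using continuous_attains_sup[OF compact_Icc _ cl] assms(1) by fastforce
  obtain B where B: "\<And>t. t \<in> {0..\<tau>} \<Longrightarrow> l' t \<le> B"
    using continuous_attains_sup[OF compact_Icc _ cl'] assms(1) by fastforce
  interpret length_function \<tau> L B l l'
    by unfold_locales (use assms(1,3,6) l_ge_1 L l'_nonneg B in auto)
  have LB: "1 \<le> L" "0 \<le> B"
    using l_bounds[of 0] l'_bounds[of 0] assms(1) by auto
  obtain s where s: "carleman_threshold \<tau> L B s"
    using carleman_threshold_exists[OF assms(1) LB] by blast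
  have pos: "0 < observability_constant s"
    unfolding observability_constant_def using LB assms(1) by (intro mult_pos_pos add_pos_nonneg) auto
  define c where "c = \<tau> / (8 * L\<^sup>2) / observability_constant s"
  show ?thesis
  proof (intro exI[of _ c] conjI allI impI ballI)
    show "0 < c" unfolding c_def using pos LB assms(1) by (intro divide_pos_pos) auto
    fix U u0 assume gen: "generates_evolution_family \<tau> l l' U" and u0: "u0 \<in> H10 0 1"
    show "\<exists>g0 g1. boundary_traces \<tau> l U u0 g0 g1"
      using trace_extension[OF gen u0, of "\<lambda>t. 0"] trace_extension[OF gen u0, of l]
      unfolding boundary_traces_def by blast
    fix g0 g1 assume "boundary_traces \<tau> l U u0 g0 g1"
    from observability_of_traces[OF gen u0 s this]
    show "c * (H10norm 0 1 u0)\<^sup>2 \<le> (LINT t|lebesgue_on {0<..<\<tau>}. (cmod (g0 t))\<^sup>2 + (cmod (g1 t))\<^sup>2)"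
      unfolding c_def times_divide_eq_left pos_divide_le_eq[OF pos]
      by (simp only: mult.commute[of _ "observability_constant s"])
  qed
qed

end
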